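(* For every class $\mathscr{C}$ of hypergraphs that has the logarithmically-bounded multi-intersection property (LogBMIP), and for every constant $k\ge 1$, the following is feasible in polynomial time: given a hypergraph $H\in\mathscr{C}$, check whether $\mathrm{ghw}(H)\le k$ and, if so, compute a GHD of $H$ of width $\le k$.
   Context: A hypergraph $H=(V(H),E(H))$ consists of a finite set $V(H)$ of vertices and a set $E(H)$ of non-empty subsets of $V(H)$ (edges), such that every vertex lies in at least one edge. $\|H\|$ denotes the size of (a reasonable representation of) $H$, with $\|H\|\le |V(H)|+|E(H)|\cdot|V(H)|$. For $\lambda:E(H)\to\{0,1\}$ let $B(\lambda)=\{v: \sum_{e\ni v}\lambda(e)\ge 1\}$ and $\mathrm{weight}(\lambda)=\sum_e\lambda(e)$. A tree decomposition (TD) of $H$ is a pair $\langle T,(B_u)_{u\in T}\rangle$ with $T$ a rooted tree and bags $B_u\subseteq V(H)$ such that (1) each $e\in E(H)$ satisfies $e\subseteq B_u$ for some node $u$, and (2) for each $v\in V(H)$ the set $\{u\in T: v\in B_u\}$ is connected in $T$. A generalized hypertree decomposition (GHD) is a TD together with functions $\lambda_u:E(H)\to\{0,1\}$ ($u\in T$) with $B_u\subseteq B(\lambda_u)$; its width is $\max_u \mathrm{weight}(\lambda_u)$, and $\mathrm{ghw}(H)$ is the minimum width over all GHDs of $H$. The $c$-multi-intersection width $c\text{-miwidth}(H)$ is the maximum cardinality of an intersection $e_1\cap\dots\cap e_c$ of $c$ distinct edges of $H$. A class $\mathscr{C}$ has the LogBMIP if there is a constant $c$ such that for the hypergraphs $H\in\mathscr{C}$,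 $c\text{-miwidth}(H)$ is $O(\log n)$, where $n=\|H\|$. *)

theory Defs
  imports
    "HOL-Library.Landau_Symbols"
    "HOL-Computational_Algebra.Polynomial"
begin

section \<open>Hypergraphs and generalized hypertree decompositions\<close>

record 'a hypergraph =
  verts :: "'a set"
  edges :: "'a set set"

definition is_hypergraph :: "'a hypergraph \<Rightarrow> bool" where
  "is_hypergraph H \<longleftrightarrow>
     finite (verts H) \<and>
     (\<forall>e\<in>edges H. e \<noteq> {} \<and> e \<subseteq> verts H) \<and>
     (\<forall>v\<in>verts H. \<exists>e\<in>edges H. v \<in> e)"

text \<open>The size of the incidence-matrix representation. Any other customary size measure
  (such as the sum of the edge cardinalities) is polynomially related to it.\<close>

definition hsize :: "'a hypergraph \<Rightarrow> nat" where
  "hsize H = card (verts H) + card (edges H) * card (verts H)"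

text \<open>The tree edges join each node other than the root to its parent; \<open>parent T (tree_root T)\<close> is
  irrelevant.\<close>

record 'n rtree =
  nodes :: "'n set"
  tree_root :: 'n
  parent :: "'n \<Rightarrow> 'n"

definition is_rtree :: "'n rtree \<Rightarrow> bool" where
  "is_rtree T \<longleftrightarrow>
     finite (nodes T) \<and> tree_root T \<in> nodes T \<and>
     (\<forall>u\<in>nodes T - {tree_root T}. parent T u \<in> nodes T) \<and>
     (\<forall>u\<in>nodes T. \<exists>i. (parent T ^^ i) u = tree_root T)"

definition tree_adj :: "'n rtree \<Rightarrow> ('n \<times> 'n) set" where
  "tree_adj T =
     {(u, parent T u) | u. u \<in> nodes T - {tree_root T}} \<union>
     {(parent T u, u) | u. u \<in> nodes T - {tree_root T}}"

definition connected_in :: "'n rtree \<Rightarrow> 'n set \<Rightarrow> bool" where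
  "connected_in T S \<longleftrightarrow> S \<subseteq> nodes T \<and> (\<forall>u\<in>S. \<forall>w\<in>S. (u, w) \<in> (tree_adj T \<inter> S \<times> S)\<^sup>*)"

definition is_tree_decomp :: "'a hypergraph \<Rightarrow> 'n rtree \<Rightarrow> ('n \<Rightarrow> 'a set) \<Rightarrow> bool" where
  "is_tree_decomp H T B \<longleftrightarrow>
     is_rtree T \<and>
     (\<forall>u\<in>nodes T. B u \<subseteq> verts H) \<and>
     (\<forall>e\<in>edges H. \<exists>u\<in>nodes T. e \<subseteq> B u) \<and>
     (\<forall>v\<in>verts H. connected_in T {u \<in> nodes T. v \<in> B u})"

definition covered :: "'a hypergraph \<Rightarrow> ('a set \<Rightarrow> nat) \<Rightarrow> 'a set" where
  "covered H l = {v \<in> verts H. (\<Sum>e\<in>{e \<in> edges H. v \<in> e}. l e) \<ge> 1}"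

definition weight :: "'a hypergraph \<Rightarrow> ('a set \<Rightarrow> nat) \<Rightarrow> nat" where
  "weight H l = (\<Sum>e\<in>edges H. l e)"

definition is_ghd ::
  "'a hypergraph \<Rightarrow> 'n rtree \<Rightarrow> ('n \<Rightarrow> 'a set) \<Rightarrow> ('n \<Rightarrow> 'a set \<Rightarrow> nat) \<Rightarrow> bool" where
  "is_ghd H T B L \<longleftrightarrow>
     is_tree_decomp H T B \<and>
     (\<forall>u\<in>nodes T. (\<forall>e\<in>edges H. L u e \<in> {0, 1}) \<and> B u \<subseteq> covered H (L u))"

definition ghd_width :: "'a hypergraph \<Rightarrow> 'n rtree \<Rightarrow> ('n \<Rightarrow> 'a set \<Rightarrow> nat) \<Rightarrow> nat" where
  "ghd_width H T L = Max ((\<lambda>u. weight H (L u)) ` nodes T)"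

text \<open>Trees are finite, so naming their nodes by natural numbers loses no generality.\<close>

definition ghw :: "'a hypergraph \<Rightarrow> nat" where
  "ghw H = (LEAST w. \<exists>(T :: nat rtree) B L. is_ghd H T B L \<and> ghd_width H T L = w)"

text \<open>If \<open>H\<close> has fewer than \<open>c\<close> edges there is no intersection to consider and the value is 0.\<close>

definition miwidth :: "nat \<Rightarrow> 'a hypergraph \<Rightarrow> nat" where
  "miwidth c H = Max (insert 0 {card (\<Inter>S) | S. S \<subseteq> edges H \<and> card S = c})"

definition LogBMIP :: "'a hypergraph set \<Rightarrow> bool" where
  "LogBMIP \<C> \<longleftrightarrow>
     (\<exists>c\<ge>1. \<exists>f :: nat \<Rightarrow> real. f \<in> O(\<lambda>n. ln (real n)) \<and>
        (\<forall>H\<in>\<C>. real (miwidth c H) \<le> f (hsize H)))"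


section \<open>Polynomial time\<close>

text \<open>
  The machine model is the WHILE language of N. D. Jones (Computability and Complexity from a
  Programming Perspective, MIT Press 1997): programs with finitely many variables that range over
  binary trees. Polynomial time for WHILE programs and for Turing machines coincide. Jones
  charges one unit per operation on trees represented as shared graphs; here every evaluation of
  a subexpression is charged the full size of the resulting tree (as if it were copied), so that
  no large tree can be built, compared or output in less time than it takes to write it down.
\<close>

datatype data = Atom | Pair data data

primrec dsize :: "data \<Rightarrow> nat" where
  "dsize Atom = 1"
| "dsize (Pair a b) = 1 + dsize a + dsize b"

datatype expr =
    Var nat
  | AtomE
  | PairE expr expr
  | Hd expr
  | Tl expr
  | Eq expr expr

datatype com =
    Skip
  | Assign nat expr
  | Seq com com
  | If expr com com
  | While expr com

type_synonym store = "nat \<Rightarrow> data"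

primrec hd_data :: "data \<Rightarrow> data" where
  "hd_data Atom = Atom"
| "hd_data (Pair a b) = a"

primrec tl_data :: "data \<Rightarrow> data" where
  "tl_data Atom = Atom"
| "tl_data (Pair a b) = b"

definition enc_bool :: "bool \<Rightarrow> data" where
  "enc_bool b = (if b then Pair Atom Atom else Atom)"

primrec val :: "expr \<Rightarrow> store \<Rightarrow> data" where
  "val (Var x) s = s x"
| "val AtomE s = Atom"
| "val (PairE a b) s = Pair (val a s) (val b s)"
| "val (Hd a) s = hd_data (val a s)"
| "val (Tl a) s = tl_data (val a s)"
| "val (Eq a b) s = enc_bool (val a s = val b s)"

primrec cost :: "expr \<Rightarrow> store \<Rightarrow> nat" where
  "cost (Var x) s = dsize (s x)"
| "cost AtomE s = 1"
| "cost (PairE a b) s = cost a s + cost b s + dsize (val (PairE a b) s)"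
| "cost (Hd a) s = cost a s + dsize (val (Hd a) s)"
| "cost (Tl a) s = cost a s + dsize (val (Tl a) s)"
| "cost (Eq a b) s = cost a s + cost b s + dsize (val (Eq a b) s)"

text \<open>\<open>exec C s t s'\<close>: started in store \<open>s\<close>, program \<open>C\<close> halts after time \<open>t\<close> in store \<open>s'\<close>.
  Tests regard \<open>Atom\<close> as false and every other tree as true.\<close>

inductive exec :: "com \<Rightarrow> store \<Rightarrow> nat \<Rightarrow> store \<Rightarrow> bool" where
  Skip: "exec Skip s 1 s"
| Assign: "exec (Assign x e) s (1 + cost e s) (s(x := val e s))"
| Seq: "exec C s t s' \<Longrightarrow> exec D s' t' s'' \<Longrightarrow> exec (Seq C D) s (t + t') s''"
| IfTrue: "val e s \<noteq> Atom \<Longrightarrow> exec C s t s' \<Longrightarrow> exec (If e C D) s (1 + cost e s + t) s'"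
| IfFalse: "val e s = Atom \<Longrightarrow> exec D s t s' \<Longrightarrow> exec (If e C D) s (1 + cost e s + t) s'"
| WhileFalse: "val e s = Atom \<Longrightarrow> exec (While e C) s (1 + cost e s) s"
| WhileTrue: "val e s \<noteq> Atom \<Longrightarrow> exec C s t s' \<Longrightarrow> exec (While e C) s' t' s'' \<Longrightarrow>
    exec (While e C) s (1 + cost e s + t + t') s''"

inductive_cases SkipE: "exec Skip s t s'"
inductive_cases AssignE: "exec (Assign x e) s t s'"
inductive_cases SeqE: "exec (Seq C D) s t s'"
inductive_cases IfE: "exec (If e C D) s t s'"
inductive_cases WhileE: "exec (While e C) s t s'"

lemma exec_deterministic:
  "exec C s t s' \<Longrightarrow> exec C s u r \<Longrightarrow> u = t \<and> r = s'"
proof (induction arbitrary: u r rule: exec.induct)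
  case (Skip s) then show ?case by (auto elim: SkipE)
next
  case (Assign x e s) then show ?case by (auto elim: AssignE)
next
  case (Seq C s t s' D t' s'')
  from Seq.prems show ?case by (rule SeqE) (metis Seq.IH)
next
  case (IfTrue e s C t s' D)
  from IfTrue.prems show ?case by (rule IfE) (auto dest!: IfTrue.IH simp: IfTrue.hyps(1))
next
  case (IfFalse e s D t s' C)
  from IfFalse.prems show ?case by (rule IfE) (auto dest!: IfFalse.IH simp: IfFalse.hyps(1))
next
  case (WhileFalse e s C)
  from WhileFalse.prems show ?case by (rule WhileE) (auto simp: WhileFalse.hyps(1))
next
  case (WhileTrue e s C t s' t' s'')
  from WhileTrue.prems show ?case by (rule WhileE) (auto dest!: WhileTrue.IH simp: WhileTrue.hyps(1))
qed

text \<open>A program receives its input in variable 0, all other variables being \<open>Atom\<close>, and leaves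
  its output in variable 0. In a search problem \<open>R i y\<close> says that \<open>y\<close> is a correct answer to
  instance \<open>i\<close>; nothing is required of inputs that do not encode an instance in \<open>I\<close>.\<close>

definition solvable_in_poly_time ::
  "('i \<Rightarrow> data) \<Rightarrow> 'i set \<Rightarrow> ('i \<Rightarrow> data \<Rightarrow> bool) \<Rightarrow> bool" where
  "solvable_in_poly_time enc I R \<longleftrightarrow>
     (\<exists>(C :: com) (p :: nat poly). \<forall>i\<in>I. \<exists>t s.
        exec C ((\<lambda>_. Atom)(0 := enc i)) t s \<and>
        t \<le> poly p (dsize (enc i)) \<and>
        R i (s 0))"


section \<open>The computational problem\<close>

primrec enc_nat :: "nat \<Rightarrow> data" where
  "enc_nat 0 = Atom"
| "enc_nat (Suc n) = Pair Atom (enc_nat n)"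

primrec enc_list :: "data list \<Rightarrow> data" where
  "enc_list [] = Atom"
| "enc_list (x # xs) = Pair x (enc_list xs)"

text \<open>A hypergraph is presented by an enumeration \<open>vs\<close> of its vertices and an enumeration \<open>es\<close>
  of its edges. The program only sees the number of vertices (in unary) and the incidence
  matrix, one row per edge; the size of this input is linear in \<open>hsize\<close>.\<close>

type_synonym 'a presentation = "'a list \<times> 'a set list"

fun presented :: "'a presentation \<Rightarrow> 'a hypergraph" where
  "presented (vs, es) = \<lparr>verts = set vs, edges = set es\<rparr>"

definition presentations :: "'a hypergraph set \<Rightarrow> 'a presentation set" where
  "presentations \<C> = {(vs, es). distinct vs \<and> distinct es \<and> presented (vs, es) \<in> \<C>}"

fun enc_hypergraph :: "'a presentation \<Rightarrow> data" where
  "enc_hypergraph (vs, es) =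
     Pair (enc_nat (length vs))
       (enc_list (map (\<lambda>e. enc_list (map (\<lambda>v. enc_bool (v \<in> e)) vs)) es))"

text \<open>For a decomposition with nodes \<open>0, \<dots>, m - 1\<close>: the root, followed by the list of all
  nodes, each given by its parent, the characteristic vector of its bag with respect to \<open>vs\<close>,
  and the vector of the values of its edge function with respect to \<open>es\<close>.\<close>

fun enc_ghd ::
  "'a presentation \<Rightarrow> nat \<Rightarrow> nat rtree \<Rightarrow> (nat \<Rightarrow> 'a set) \<Rightarrow> (nat \<Rightarrow> 'a set \<Rightarrow> nat) \<Rightarrow> data" where
  "enc_ghd (vs, es) m T B L =
     Pair (enc_nat (tree_root T))
       (enc_list (map (\<lambda>u.
          Pair (enc_nat (parent T u))
            (Pair (enc_list (map (\<lambda>v. enc_bool (v \<in> B u)) vs))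
                  (enc_list (map (\<lambda>e. enc_nat (L u e)) es)))) [0..<m]))"

text \<open>The answer \<open>Atom\<close> means ``no''. An encoded decomposition is always a \<open>Pair\<close>.\<close>

definition ghd_answer :: "nat \<Rightarrow> 'a presentation \<Rightarrow> data \<Rightarrow> bool" where
  "ghd_answer k P y \<longleftrightarrow>
     (if ghw (presented P) \<le> k
      then \<exists>m T B L.
        is_ghd (presented P) T B L \<and> nodes T = {..<m} \<and>
        ghd_width (presented P) T L \<le> k \<and>
        y = enc_ghd P m T B L
      else y = Atom)"

end

theory Submission
  imports Defs
begin

text \<open>
  A decomposition is assembled top down: given a connected block \<open>C\<close> of vertices, a separator \<open>X\<close>
  that meets \<open>C\<close> and contains all neighbours of \<open>C\<close> outside \<open>C\<close> is chosen, and the components of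
  \<open>C - X\<close> are decomposed recursively. If the separators range over a list of polynomial length, then
  so do the blocks, and the solvable blocks can be tabulated by increasing size. By Helly's theorem
  for subtrees, the bags of any decomposition of width at most \<open>k\<close> suffice as separators.

  It remains to bring these bags into a polynomial list. In a decomposition with maximal bags, each
  edge \<open>e\<close> of the cover of a bag \<open>B\<^sub>u\<close> satisfies
  \<open>e \<inter> B\<^sub>u = e \<inter> \<Inter>\<^sub>q B(\<lambda>\<^sub>q)\<close>, where \<open>q\<close> ranges over the intersection of the
  subtrees of the vertices in \<open>e \<inter> B\<^sub>u\<close>: a further vertex of the right-hand side could be
  added to all these bags. Distributing this intersection of unions until \<open>c\<close> edges are
  collected writes the bag as a union of at most \<open>k\<^sup>c\<close> sets, each of which is an intersection of
  fewer than \<open>c\<close> edges or a subset of an intersection of \<open>c\<close> distinct edges. The latter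
  have logarithmic size, hence only polynomially many subsets.
\<close>

section \<open>Polynomial-time computability in the WHILE language\<close>

text \<open>The decomposition found need not resemble the given one. Every component of the
  complement of a bag is solvable, whether or not it belongs to a node of the given tree, and
  Helly's theorem supplies a bag that splits it. Blocks shrink strictly, so |V| rounds of tabulation
  suffice and at most |V| nodes are built besides the root. Only the part of a separator in the
  closed neighbourhood of its block becomes a bag; its other vertices may occur in unrelated parts
  of the tree.

  Enlarging the bags is possible because e itself lies inside some bag B_t: the node t belongs to
  the intersection of the subtrees and to the subtree of every vertex of e, so adding a vertex of e
  keeps its subtree connected. The exponent in k^c splits as k * k^(c-1): there are at most k edges
  e in a cover, and for each the distribution starts with e already collected.

  The promise on the class is needed for listing the subsets of intersections of c edges. Polynomial
  time is therefore always relative to a set of instances, and intermediate values are bounded only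
  on states that really occur.\<close>

definition pbound :: "('j \<Rightarrow> nat) \<Rightarrow> 'j set \<Rightarrow> ('j \<Rightarrow> nat) \<Rightarrow> bool" where
  "pbound N A g \<longleftrightarrow> (\<exists>p :: nat poly. \<forall>j\<in>A. g j \<le> poly p (N j))"

lemma pbound_const: "pbound N A (\<lambda>_. c)"
  unfolding pbound_def by (rule exI[of _ "[:c:]"]) simp

lemma pbound_self: "pbound N A N"
  unfolding pbound_def by (rule exI[of _ "[:0, 1:]"]) simp

lemma pbound_add: "pbound N A g \<Longrightarrow> pbound N A h \<Longrightarrow> pbound N A (\<lambda>j. g j + h j)"
  unfolding pbound_def
proof (elim exE)
  fix p q :: "nat poly"
  assume "\<forall>j\<in>A. g j \<le> poly p (N j)" "\<forall>j\<in>A. h j \<le> poly q (N j)"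
  then show "\<exists>p. \<forall>j\<in>A. g j + h j \<le> poly p (N j)"
    by (intro exI[of _ "p + q"]) (auto intro: add_mono)
qed

lemma pbound_mult: "pbound N A g \<Longrightarrow> pbound N A h \<Longrightarrow> pbound N A (\<lambda>j. g j * h j)"
  unfolding pbound_def
proof (elim exE)
  fix p q :: "nat poly"
  assume "\<forall>j\<in>A. g j \<le> poly p (N j)" "\<forall>j\<in>A. h j \<le> poly q (N j)"
  then show "\<exists>p. \<forall>j\<in>A. g j * h j \<le> poly p (N j)"
    by (intro exI[of _ "p * q"]) (auto intro: mult_mono)
qed

lemma pbound_power: "pbound N A g \<Longrightarrow> pbound N A (\<lambda>j. g j ^ n)"
  by (induction n) (auto intro: pbound_const pbound_mult)

lemma pbound_mono: "pbound N A h \<Longrightarrow> (\<And>j. j \<in> A \<Longrightarrow> g j \<le> h j) \<Longrightarrow> pbound N A g"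
  unfolding pbound_def by (meson le_trans)

text \<open>Inside a loop the instances become tuples whose first component is the outer instance;
  bounds stay in terms of the outer input size.\<close>

lemma pbound_reindex:
  "pbound N A g \<Longrightarrow> (\<And>z. z \<in> B \<Longrightarrow> h z \<in> A) \<Longrightarrow> pbound (\<lambda>z. N (h z)) B (\<lambda>z. g (h z))"
  unfolding pbound_def by blast

lemmas pbound_intros = pbound_const pbound_add pbound_mult pbound_power

lemma dsize_pos [simp]: "0 < dsize d"
  by (cases d) auto

section \<open>Running a program on a disjoint block of variables\<close>

primrec shift_expr :: "nat \<Rightarrow> expr \<Rightarrow> expr" where
  "shift_expr k (Var x) = Var (x + k)"
| "shift_expr k AtomE = AtomE"
| "shift_expr k (PairE a b) = PairE (shift_expr k a) (shift_expr k b)"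
| "shift_expr k (Hd a) = Hd (shift_expr k a)"
| "shift_expr k (Tl a) = Tl (shift_expr k a)"
| "shift_expr k (Eq a b) = Eq (shift_expr k a) (shift_expr k b)"

text \<open>A program shifted by \<open>k\<close> cannot touch the variables below \<open>k\<close>,
  so it can serve as a subroutine without any analysis of the variables it uses.\<close>

primrec shift :: "nat \<Rightarrow> com \<Rightarrow> com" where
  "shift k Skip = Skip"
| "shift k (Assign x e) = Assign (x + k) (shift_expr k e)"
| "shift k (Seq C D) = Seq (shift k C) (shift k D)"
| "shift k (If e C D) = If (shift_expr k e) (shift k C) (shift k D)"
| "shift k (While e C) = While (shift_expr k e) (shift k C)"

definition overlay :: "nat \<Rightarrow> store \<Rightarrow> store \<Rightarrow> store" where
  "overlay k S s = (\<lambda>i. if i < k then S i else s (i - k))"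

lemma val_shift: "val (shift_expr k e) (overlay k S s) = val e s"
  by (induction e) (auto simp: overlay_def)

lemma cost_shift: "cost (shift_expr k e) (overlay k S s) = cost e s"
proof (induction e)
  case (PairE a b)
  then show ?case using val_shift[of k "PairE a b"] by simp
next
  case (Hd a)
  then show ?case using val_shift[of k "Hd a"] by simp
next
  case (Tl a)
  then show ?case using val_shift[of k "Tl a"] by simp
next
  case (Eq a b)
  then show ?case using val_shift[of k "Eq a b"] by simp
qed (auto simp: overlay_def)

lemma exec_shift: "exec C s t s' \<Longrightarrow> exec (shift k C) (overlay k S s) t (overlay k S s')"
proof (induction rule: exec.induct)
  case (Assign x e s)
  have *: "overlay k S (s(x := val e s)) =
      (overlay k S s)(x + k := val (shift_expr k e) (overlay k S s))"
    unfolding val_shift by (auto simp: overlay_def fun_eq_iff)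
  show ?case
    unfolding * shift.simps cost_shift[symmetric, of e s k S] by (rule exec.Assign)
next
  case (IfTrue e s C t s' D)
  then show ?case
    using exec.IfTrue[of "shift_expr k e" "overlay k S s"] by (simp add: cost_shift val_shift)
next
  case (IfFalse e s D t s' C)
  then show ?case
    using exec.IfFalse[of "shift_expr k e" "overlay k S s"] by (simp add: cost_shift val_shift)
next
  case (WhileFalse e s C)
  then show ?case
    using exec.WhileFalse[of "shift_expr k e" "overlay k S s"] by (simp add: cost_shift val_shift)
next
  case (WhileTrue e s C t s' t' s'')
  then show ?case
    using exec.WhileTrue[of "shift_expr k e" "overlay k S s"] by (simp add: cost_shift val_shift)
qed (auto intro: exec.intros simp flip: One_nat_def)

lemma exec_shift_overlay:
  assumes "exec C (\<lambda>i. S (i + k)) t s'"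
  shows "exec (shift k C) S t (overlay k S s')"
proof -
  have "overlay k S (\<lambda>i. S (i + k)) = S"
    by (auto simp: overlay_def)
  with exec_shift[OF assms, of k S] show ?thesis by simp
qed

text \<open>No assumption is made on the variables other than 0, so that programs can be reused inside
  loops, where their local variables hold garbage from earlier rounds.\<close>

definition runs :: "com \<Rightarrow> ('j \<Rightarrow> nat) \<Rightarrow> nat poly \<Rightarrow> 'j set \<Rightarrow> ('j \<Rightarrow> data) \<Rightarrow> ('j \<Rightarrow> data) \<Rightarrow> bool" where
  "runs C N p A e f \<longleftrightarrow>
     (\<forall>j\<in>A. \<forall>s. s 0 = e j \<longrightarrow> (\<exists>t s'. exec C s t s' \<and> s' 0 = f j \<and> t \<le> poly p (N j)))"

lemma runs_shift:
  assumes "runs C N p A e f" "j \<in> A" "S k = e j"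
  shows "\<exists>t s'. exec (shift k C) S t (overlay k S s') \<and> s' 0 = f j \<and> t \<le> poly p (N j)"
proof -
  from assms obtain t s' where "exec C (\<lambda>i. S (i + k)) t s'" "s' 0 = f j" "t \<le> poly p (N j)"
    unfolding runs_def by (metis add_0)
  then show ?thesis using exec_shift_overlay by blast
qed

text \<open>\<open>ptime N A e f\<close>: from \<open>e j\<close> one can compute \<open>f j\<close>, for all \<open>j \<in> A\<close>, in time polynomial in
  \<open>N j\<close>. The index \<open>j\<close> is an abstract instance, so that \<open>f\<close> may be written in terms of
  mathematical objects, and \<open>N\<close> stays the input size of the whole computation throughout.\<close>

definition ptime :: "('j \<Rightarrow> nat) \<Rightarrow> 'j set \<Rightarrow> ('j \<Rightarrow> data) \<Rightarrow> ('j \<Rightarrow> data) \<Rightarrow> bool" where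
  "ptime N A e f \<longleftrightarrow> pbound N A (\<lambda>j. dsize (e j)) \<and> pbound N A (\<lambda>j. dsize (f j)) \<and>
     (\<exists>C p. runs C N p A e f)"

lemma ptime_pbound: "ptime N A e f \<Longrightarrow> pbound N A (\<lambda>j. dsize (f j))"
  and ptime_pbound_env: "ptime N A e f \<Longrightarrow> pbound N A (\<lambda>j. dsize (e j))"
  unfolding ptime_def by auto

lemma ptimeI:
  assumes "pbound N A (\<lambda>j. dsize (e j))" "pbound N A (\<lambda>j. dsize (f j))" "pbound N A T"
    and "\<And>j s. j \<in> A \<Longrightarrow> s 0 = e j \<Longrightarrow> \<exists>t s'. exec C s t s' \<and> s' 0 = f j \<and> t \<le> T j"
  shows "ptime N A e f"
proof -
  from assms(3) obtain p where "\<And>j. j \<in> A \<Longrightarrow> T j \<le> poly p (N j)"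
    unfolding pbound_def by blast
  then have "runs C N p A e f"
    unfolding runs_def using assms(4) by (meson le_trans)
  with assms show ?thesis unfolding ptime_def by blast
qed

definition call :: "nat \<Rightarrow> com \<Rightarrow> com" where
  "call k C = Seq (Assign k (Var 0)) (shift k C)"

text \<open>Copying the input to variable \<open>k\<close> before running the shifted program keeps
  the environment in variable 0 intact. Several values can thus be computed from one environment in
  turn, each call leaving the earlier results below \<open>k\<close> alone.\<close>

lemma ptime_call:
  assumes "ptime N A e f"
  obtains C T where "pbound N A T"
    and "\<And>j S k. j \<in> A \<Longrightarrow> S 0 = e j \<Longrightarrow> 0 < k \<Longrightarrow>
      \<exists>t S'. exec (call k C) S t S' \<and> S' k = f j \<and> (\<forall>i<k. S' i = S i) \<and> t \<le> T j"
proof -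
  from assms obtain C p where C: "runs C N p A e f" and be: "pbound N A (\<lambda>j. dsize (e j))"
    unfolding ptime_def by blast
  show thesis
  proof (rule that[of "\<lambda>j. (1 + dsize (e j)) + poly p (N j)" C])
    show "pbound N A (\<lambda>j. (1 + dsize (e j)) + poly p (N j))"
      by (intro pbound_intros be) (auto simp: pbound_def)
    fix j and S :: store and k :: nat
    assume j: "j \<in> A" and S: "S 0 = e j" and k: "0 < k"
    have 1: "exec (Assign k (Var 0)) S (1 + dsize (e j)) (S(k := e j))"
      using exec.Assign[of k "Var 0" S] S by simp
    from runs_shift[OF C j, of "S(k := e j)" k] obtain t s' where
      2: "exec (shift k C) (S(k := e j)) t (overlay k (S(k := e j)) s')" "s' 0 = f j"
          "t \<le> poly p (N j)"
      by auto
    from exec.Seq[OF 1 2(1)] 2(2,3)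
    show "\<exists>t S'. exec (call k C) S t S' \<and> S' k = f j \<and> (\<forall>i<k. S' i = S i) \<and>
        t \<le> (1 + dsize (e j)) + poly p (N j)"
      unfolding call_def by (intro exI[of _ "1 + dsize (e j) + t"] exI[of _ "overlay k (S(k := e j))
          s'"])
        (auto simp: overlay_def)
  qed
qed

lemma ptime_cong: "ptime N A e f \<Longrightarrow> (\<And>j. j \<in> A \<Longrightarrow> f j = g j) \<Longrightarrow> ptime N A e g"
  unfolding ptime_def runs_def pbound_def by simp

lemma ptime_subset: "ptime N A e f \<Longrightarrow> B \<subseteq> A \<Longrightarrow> ptime N B e f"
  unfolding ptime_def runs_def pbound_def by (meson in_mono)

lemma ptime_reindex:
  assumes "ptime N A e f" "\<And>z. z \<in> B \<Longrightarrow> h z \<in> A"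
  shows "ptime (\<lambda>z. N (h z)) B (\<lambda>z. e (h z)) (\<lambda>z. f (h z))"
  using assms unfolding ptime_def runs_def pbound_def by (meson assms(2))

lemma ptime_env: "pbound N A (\<lambda>j. dsize (e j)) \<Longrightarrow> ptime N A e e"
  by (rule ptimeI[where C = Skip and T = "\<lambda>_. 1"])
    (use exec.Skip in \<open>auto intro: pbound_const simp flip: One_nat_def\<close>)

lemma exec_witness:
  "exec C s t s' \<Longrightarrow> s' 0 = x \<Longrightarrow> t \<le> T \<Longrightarrow> \<exists>t s'. exec C s t s' \<and> s' 0 = x \<and> t \<le> T"
  by blast

section \<open>Composition, tree operations and branching\<close>

lemma ptime_comp:
  assumes "ptime N A e f" "ptime N A f g"
  shows "ptime N A e g"
proof -
  from assms(1) obtain C p where C: "runs C N p A e f" unfolding ptime_def by blast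
  from assms(2) obtain D q where D: "runs D N q A f g" unfolding ptime_def by blast
  have "runs (Seq C D) N (p + q) A e g"
    unfolding runs_def
  proof (intro ballI allI impI)
    fix j and s :: store assume j: "j \<in> A" and "s 0 = e j"
    then obtain t s' where 1: "exec C s t s'" "s' 0 = f j" "t \<le> poly p (N j)"
      using C unfolding runs_def by blast
    with j obtain u s'' where 2: "exec D s' u s''" "s'' 0 = g j" "u \<le> poly q (N j)"
      using D unfolding runs_def by blast
    from 1 2 show "\<exists>t s'. exec (Seq C D) s t s' \<and> s' 0 = g j \<and> t \<le> poly (p + q) (N j)"
      by (intro exI[of _ "t + u"] exI[of _ s'']) (auto intro: exec.Seq)
  qed
  with assms show ?thesis unfolding ptime_def by blast
qed

lemma dsize_val_le_cost: "dsize (val x s) \<le> cost x s"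
  by (induction x) auto

lemma ptime_expr:
  assumes f: "ptime N A e f"
    and x: "\<And>j s. j \<in> A \<Longrightarrow> s 0 = f j \<Longrightarrow> val x s = g j \<and> cost x s \<le> c + c * dsize (f j)"
  shows "ptime N A e g"
proof (rule ptime_comp[OF f])
  have T: "pbound N A (\<lambda>j. 1 + (c + c * dsize (f j)))" by (intro pbound_intros ptime_pbound[OF f])
  show "ptime N A f g"
  proof (rule ptimeI[where C = "Assign 0 x", OF ptime_pbound[OF f] _ T])
    show "pbound N A (\<lambda>j. dsize (g j))"
    proof (rule pbound_mono[OF T])
      fix j assume "j \<in> A"
      with x[of j "\<lambda>_. f j"] dsize_val_le_cost[of x "\<lambda>_. f j"]
      show "dsize (g j) \<le> 1 + (c + c * dsize (f j))" by simp
    qed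
    fix j and s :: store assume "j \<in> A" "s 0 = f j"
    from x[of j s, OF this] show "\<exists>t s'. exec (Assign 0 x) s t s' \<and> s' 0 = g j \<and> t \<le>
        1 + (c + c * dsize (f j))"
      by (intro exec_witness[OF exec.Assign]) auto
  qed
qed

lemma ptime_Atom: "ptime N A e f \<Longrightarrow> ptime N A e (\<lambda>_. Atom)"
  by (rule ptime_expr[where x = AtomE and c = 1]) auto

lemma dsize_hd: "dsize (hd_data d) \<le> Suc (Suc (dsize d))" by (cases d) auto
lemma dsize_tl: "dsize (tl_data d) \<le> Suc (Suc (dsize d))" by (cases d) auto

lemma ptime_hd: "ptime N A e f \<Longrightarrow> ptime N A e (\<lambda>j. hd_data (f j))"
  by (rule ptime_expr[where x = "Hd (Var 0)" and c = 2], assumption) (simp add: dsize_hd)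

lemma ptime_tl: "ptime N A e f \<Longrightarrow> ptime N A e (\<lambda>j. tl_data (f j))"
  by (rule ptime_expr[where x = "Tl (Var 0)" and c = 2], assumption) (simp add: dsize_tl)

lemma ptime_Pair:
  assumes "ptime N A e f" "ptime N A e g"
  shows "ptime N A e (\<lambda>j. Pair (f j) (g j))"
proof -
  from assms(1) obtain C T where T: "pbound N A T" and C: "\<And>j S k. j \<in> A \<Longrightarrow> S 0 = e j \<Longrightarrow> 0 < k \<Longrightarrow>
      \<exists>t S'. exec (call k C) S t S' \<and> S' k = f j \<and> (\<forall>i<k. S' i = S i) \<and> t \<le> T j"
    by (rule ptime_call) blast
  from assms(2) obtain D U where U: "pbound N A U" and D: "\<And>j S k. j \<in> A \<Longrightarrow> S 0 = e j \<Longrightarrow> 0 < k \<Longrightarrow>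
      \<exists>t S'. exec (call k D) S t S' \<and> S' k = g j \<and> (\<forall>i<k. S' i = S i) \<and> t \<le> U j"
    by (rule ptime_call) blast
  note b = ptime_pbound[OF assms(1)] ptime_pbound[OF assms(2)]
  let ?x = "PairE (Var 1) (Var 2)"
  let ?T = "\<lambda>j. T j + (U j + (2 + 2 * dsize (f j) + 2 * dsize (g j)))"
  show ?thesis
  proof (rule ptimeI[where C = "Seq (call 1 C) (Seq (call 2 D) (Assign 0 ?x))" and T = ?T])
    show "pbound N A (\<lambda>j. dsize (Pair (f j) (g j)))" unfolding dsize.simps
        by (intro pbound_intros b)
    show "pbound N A ?T" by (intro pbound_intros b T U)
    fix j and s :: store assume j: "j \<in> A" and s: "s 0 = e j"
    from C[of j s 1, OF j s] obtain t s1 where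
      1: "exec (call 1 C) s t s1" "s1 1 = f j" "s1 0 = e j" "t \<le> T j" using s by auto
    from D[of j s1 2, OF j 1(3)] 1(2) obtain u s2 where
      2: "exec (call 2 D) s1 u s2" "s2 2 = g j" "s2 1 = f j" "u \<le> U j" by auto
    have "cost ?x s2 = 1 + 2 * dsize (f j) + 2 * dsize (g j)" "val ?x s2 = Pair (f j) (g j)"
      using 2 by simp_all
    with 1 2 show "\<exists>t s'. exec (Seq (call 1 C) (Seq (call 2 D) (Assign 0 ?x))) s t s' \<and>
        s' 0 = Pair (f j) (g j) \<and> t \<le> ?T j"
      by (intro exec_witness[OF exec.Seq[OF 1(1) exec.Seq[OF 2(1) exec.Assign]]]) simp_all
  qed (rule ptime_pbound_env[OF assms(1)])
qed

lemma ptime_Eq: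
  assumes "ptime N A e f" "ptime N A e g"
  shows "ptime N A e (\<lambda>j. enc_bool (f j = g j))"
  \<comment> \<open>On a pair with components of sizes a and b, the two projections cost 2 * (1 + a
    + b) + a + b and the truth value at most 3, whence the constant 5.\<close>
  by (rule ptime_expr[where x = "Eq (Hd (Var 0)) (Tl (Var 0))" and c = 5, OF ptime_Pair[OF assms]])
    (auto simp: enc_bool_def)

text \<open>Each branch is analysed only on the instances that enter it. This admits partial
  operations, such as taking the head of a list that is known to be non-empty in that
  branch.\<close>

lemma ptime_if:
  assumes "ptime N A e (\<lambda>j. enc_bool (b j))"
    and "ptime N {j \<in> A. b j} e f" "ptime N {j \<in> A. \<not> b j} e g"
  shows "ptime N A e (\<lambda>j. if b j then f j else g j)"
proof -
  let ?h = "\<lambda>j. if b j then f j else g j"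
  from assms(1) obtain B W where W: "pbound N A W" and B: "\<And>j S k. j \<in> A \<Longrightarrow> S 0 = e j \<Longrightarrow> 0 < k \<Longrightarrow>
      \<exists>t S'. exec (call k B) S t S' \<and> S' k = enc_bool (b j) \<and> (\<forall>i<k. S' i = S i) \<and> t \<le> W j"
    by (rule ptime_call) blast
  from assms(2) obtain C p pf where C: "runs C N p {j \<in> A. b j} e f"
    and pf: "\<And>j. j \<in> A \<Longrightarrow> b j \<Longrightarrow> dsize (f j) \<le> poly pf (N j)" unfolding ptime_def pbound_def by blast
  from assms(3) obtain D q pg where D: "runs D N q {j \<in> A. \<not> b j} e g"
    and pg: "\<And>j. j \<in> A \<Longrightarrow> \<not> b j \<Longrightarrow> dsize (g j) \<le> poly pg (N j)" unfolding ptime_def pbound_def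
        by blast
  \<comment> \<open>3 is the largest size of a truth value and bounds the cost of the test.\<close>
  let ?T = "\<lambda>j. W j + (1 + 3 + (poly p (N j) + poly q (N j)))"
  show ?thesis
  proof (rule ptimeI[where C = "Seq (call 1 B) (If (Var 1) C D)" and T = ?T])
    show "pbound N A (\<lambda>j. dsize (?h j))"
      unfolding pbound_def using pf pg by (intro exI[of _ "pf + pg"]) (auto intro: trans_le_add1
          trans_le_add2)
    have "pbound N A (\<lambda>j. poly p (N j))" "pbound N A (\<lambda>j. poly q (N j))" unfolding pbound_def
        by blast+
    then show "pbound N A ?T" by (intro pbound_intros W)
    fix j and s :: store assume j: "j \<in> A" and s: "s 0 = e j"
    from B[of j s 1, OF j s] obtain t s1 where
      1: "exec (call 1 B) s t s1" "s1 1 = enc_bool (b j)" "s1 0 = e j" "t \<le> W j" using s by auto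
    have "\<exists>u s2. exec (If (Var 1) C D) s1 u s2 \<and> s2 0 = ?h j \<and> u \<le> 1 + 3 + (poly p (N j) + poly q
        (N j))"
    proof (cases "b j")
      case True
      with C j 1(3) obtain u s2 where *: "exec C s1 u s2" "s2 0 = f j" "u \<le> poly p (N j)"
        unfolding runs_def by blast
      show ?thesis by (rule exec_witness[OF exec.IfTrue[OF _ *(1)]])
          (use * True 1(2) in \<open>auto simp: enc_bool_def\<close>)
    next
      case False
      with D j 1(3) obtain u s2 where *: "exec D s1 u s2" "s2 0 = g j" "u \<le> poly q (N j)"
        unfolding runs_def by blast
      show ?thesis by (rule exec_witness[OF exec.IfFalse[OF _ *(1)]])
          (use * False 1(2) in \<open>auto simp: enc_bool_def\<close>)
    qed
    then obtain u s2 where 2: "exec (If (Var 1) C D) s1 u s2" "s2 0 = ?h j"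
      "u \<le> 1 + 3 + (poly p (N j) + poly q (N j))" by blast
    show "\<exists>t s'. exec (Seq (call 1 B) (If (Var 1) C D)) s t s' \<and> s' 0 = ?h j \<and> t \<le> ?T j"
      by (rule exec_witness[OF exec.Seq[OF 1(1) 2(1)]]) (use 1(4) 2(2,3) in auto)
  qed (rule ptime_pbound_env[OF assms(1)])
qed

section \<open>Loops over encoded lists\<close>

abbreviation elist :: "('x \<Rightarrow> data) \<Rightarrow> 'x list \<Rightarrow> data" where
  "elist E xs \<equiv> enc_list (map E xs)"

lemma enc_list_eq_Atom [simp]: "enc_list xs = Atom \<longleftrightarrow> xs = []"
  by (cases xs) auto

lemma length_le_dsize: "length xs < dsize (enc_list xs)"
  by (induction xs) auto

lemma dsize_mem_enc_list: "x \<in> set xs \<Longrightarrow> dsize x \<le> dsize (enc_list xs)"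
  by (induction xs) auto

lemma dsize_mem: "x \<in> set xs \<Longrightarrow> dsize (E x) \<le> dsize (elist E xs)"
  by (rule dsize_mem_enc_list) simp

text \<open>The sequence of states is prescribed as a function of instance and round number, so the
  body has to be correct and fast only on states that occur. The bound \<open>b\<close> makes the
  cost of the test uniform over the rounds.\<close>

lemma ptime_loop:
  fixes st :: "'j \<Rightarrow> nat \<Rightarrow> data"
  assumes body: "ptime (\<lambda>z. N (fst z)) (SIGMA j:A. {..<n j}) (\<lambda>z. st (fst z) (snd z))
      (\<lambda>z. st (fst z) (Suc (snd z)))"
    and n: "pbound N A n" and b: "pbound N A b" "\<And>j i. j \<in> A \<Longrightarrow> i \<le> n j \<Longrightarrow> dsize (st j i) \<le> b j"
    and test: "\<And>j i s. j \<in> A \<Longrightarrow> i \<le> n j \<Longrightarrow> s 0 = st j i \<Longrightarrow>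
      (val x s = Atom \<longleftrightarrow> i = n j) \<and> cost x s \<le> c + c * dsize (st j i)"
  shows "ptime N A (\<lambda>j. st j 0) (\<lambda>j. st j (n j))"
proof -
  from body obtain C p where C: "runs C (\<lambda>z. N (fst z)) p (SIGMA j:A. {..<n j}) (\<lambda>z. st (fst z)
      (snd z))
      (\<lambda>z. st (fst z) (Suc (snd z)))" unfolding ptime_def by blast
  let ?Q = "\<lambda>j. 1 + (c + c * b j) + poly p (N j)"
  have loop: "\<exists>t s'. exec (While x C) s t s' \<and> s' 0 = st j (n j) \<and> t \<le> (m + 1) * ?Q j"
    if "j \<in> A" "i + m = n j" "s 0 = st j i" for j i m s
    using that
  proof (induction m arbitrary: i s)
    case 0
    have "val x s = Atom" "cost x s \<le> c + c * dsize (st j i)" "c * dsize (st j i) \<le> c * b j"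
      using test[of j i s] 0 by (auto intro!: mult_le_mono2 b(2))
    then have "val x s = Atom" "1 + cost x s \<le> ?Q j" by linarith+
    with 0 show ?case by (intro exec_witness[OF exec.WhileFalse]) simp_all
  next
    case (Suc m)
    then have ji: "(j, i) \<in> (SIGMA j:A. {..<n j})" by auto
    from C ji Suc.prems(3) obtain t s1 where 1: "exec C s t s1" "s1 0 = st j (Suc i)"
        "t \<le> poly p (N j)"
      unfolding runs_def by fastforce
    from Suc.IH[of "Suc i" s1] Suc.prems(1,2) 1(2) obtain t' s2 where
      2: "exec (While x C) s1 t' s2" "s2 0 = st j (n j)" "t' \<le> (m + 1) * ?Q j" by auto
    have 3: "val x s \<noteq> Atom" "cost x s \<le> c + c * dsize (st j i)" "c * dsize (st j i) \<le> c * b j"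
      using test[of j i s] Suc.prems by (auto intro!: mult_le_mono2 b(2))
    have "1 + cost x s + t \<le> ?Q j" using 1(3) 3(2,3) by linarith
    with 2(2,3) show ?case by (intro exec_witness[OF exec.WhileTrue[OF 3(1) 1(1) 2(1)]]) simp_all
  qed
  show ?thesis
  proof (rule ptimeI[where C = "While x C" and T = "\<lambda>j. (n j + 1) * ?Q j"])
    have "pbound N A (\<lambda>j. poly p (N j))" unfolding pbound_def by blast
    then show "pbound N A (\<lambda>j. (n j + 1) * ?Q j)" by (intro pbound_intros n b(1))
    show "pbound N A (\<lambda>j. dsize (st j 0))" "pbound N A (\<lambda>j. dsize (st j (n j)))"
      by (rule pbound_mono[OF b(1)], simp add: b(2))+
  qed (rule loop, auto)
qed

text \<open>The accumulator ranges over the values that actually occur, i.e. the folds over proper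
  prefixes. The body is given an opaque environment \<open>e'\<close> into which everything computable from
  \<open>e\<close> can be transferred.\<close>

theorem ptime_fold:
  fixes E :: "'j \<Rightarrow> 'x \<Rightarrow> data" and F :: "'j \<Rightarrow> 'a \<Rightarrow> data" and G :: "'j \<Rightarrow> 'x \<Rightarrow> 'a \<Rightarrow> 'a"
    and e :: "'j \<Rightarrow> data"
  defines "B A xs a \<equiv> {(j, fold (G j) ys (a j), x) | j ys x. j \<in> A \<and> (\<exists>zs. xs j = ys @ x # zs)}"
  assumes xs: "ptime N A e (\<lambda>j. elist (E j) (xs j))"
    and a: "ptime N A e (\<lambda>j. F j (a j))"
    and b: "pbound N A b" "\<And>j ys zs. j \<in> A \<Longrightarrow> xs j = ys @ zs \<Longrightarrow> dsize (F j (fold (G j) ys (a j))) \<le>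
        b j"
    and body: "\<And>e'.
       (\<And>f. ptime N A e f \<Longrightarrow> ptime (\<lambda>z. N (fst z)) (B A xs a) e' (\<lambda>z. f (fst z))) \<Longrightarrow>
       ptime (\<lambda>z. N (fst z)) (B A xs a) e' (\<lambda>z. F (fst z) (fst (snd z))) \<Longrightarrow>
       ptime (\<lambda>z. N (fst z)) (B A xs a) e' (\<lambda>z. E (fst z) (snd (snd z))) \<Longrightarrow>
       ptime (\<lambda>z. N (fst z)) (B A xs a) e' (\<lambda>z. F (fst z) (G (fst z) (snd (snd z)) (fst (snd z))))"
  shows "ptime N A e (\<lambda>j. F j (fold (G j) (xs j) (a j)))"
proof -
  let ?B = "B A xs a" and ?N = "\<lambda>z. N (fst z)"
  \<comment> \<open>All that the body may read: outer environment, accumulator and current item,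
    packed into one tree.\<close>
  let ?e = "\<lambda>z. Pair (e (fst z)) (Pair (F (fst z) (fst (snd z))) (E (fst z) (snd (snd z))))"
  note bxs = ptime_pbound[OF xs] and be = ptime_pbound_env[OF xs]
  have mem: "fst z \<in> A" if "z \<in> ?B" for z using that unfolding B_def by auto
  have "pbound ?N ?B (\<lambda>z. 2 + dsize (e (fst z)) + (b (fst z) + dsize (elist (E (fst z))
      (xs (fst z)))))"
    by (intro pbound_intros pbound_reindex[OF be] pbound_reindex[OF b(1)] pbound_reindex[OF bxs]
        mem)
  then have "pbound ?N ?B (\<lambda>z. dsize (?e z))"
  proof (rule pbound_mono)
    fix z assume "z \<in> ?B"
    then obtain j ys x zs where z: "z = (j, fold (G j) ys (a j), x)" "j \<in> A" "xs j = ys @ x # zs"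
      unfolding B_def by blast
    have "dsize (E j x) \<le> dsize (elist (E j) (xs j))" using z by (intro dsize_mem) auto
    with b(2)[OF z(2,3)] z
    show "dsize (?e z) \<le> 2 + dsize (e (fst z)) + (b (fst z) + dsize (elist (E (fst z))
        (xs (fst z))))"
      by simp
  qed
  from ptime_env[OF this] have env: "ptime ?N ?B ?e ?e" .
  have G: "ptime ?N ?B ?e (\<lambda>z. F (fst z) (G (fst z) (snd (snd z)) (fst (snd z))))"
  proof (rule body)
    have 1: "ptime ?N ?B ?e (\<lambda>z. e (fst z))" using ptime_hd[OF env] by simp
    show "ptime ?N ?B ?e (\<lambda>z. f (fst z))" if "ptime N A e f" for f
      by (rule ptime_comp[OF 1 ptime_reindex[OF that mem]])
    show "ptime ?N ?B ?e (\<lambda>z. F (fst z) (fst (snd z)))" using ptime_hd[OF ptime_tl[OF env]] by simp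
    show "ptime ?N ?B ?e (\<lambda>z. E (fst z) (snd (snd z)))" using ptime_tl[OF ptime_tl[OF env]] by simp
  qed
  let ?n = "\<lambda>j. length (xs j)"
  let ?acc = "\<lambda>j i. fold (G j) (take i (xs j)) (a j)"
  let ?st = "\<lambda>j i. Pair (e j) (Pair (F j (?acc j i)) (elist (E j) (drop i (xs j))))"
  let ?b = "\<lambda>j. 2 + dsize (e j) + (b j + dsize (elist (E j) (xs j)))"
  have bb: "pbound N A ?b" by (intro pbound_intros be b(1) bxs)
  have drop_le: "dsize (enc_list (drop i ds)) \<le> dsize (enc_list ds)" for i ds
    by (induction ds arbitrary: i) (auto simp: drop_Cons split: nat.split intro: le_SucI
        trans_le_add2)
  have st_le: "dsize (?st j i) \<le> ?b j" if "j \<in> A" for j i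
    using b(2)[OF that, of "take i (xs j)" "drop i (xs j)"] drop_le[of i "map (E j) (xs j)"]
        by (simp add: drop_map)
  let ?S = "SIGMA j:A. {..<?n j}"
  have "ptime ?N ?S (\<lambda>z. ?st (fst z) (snd z)) (\<lambda>z. ?st (fst z) (Suc (snd z)))"
  proof -
    have "pbound ?N ?S (\<lambda>z. dsize (?st (fst z) (snd z)))"
      by (rule pbound_mono[OF pbound_reindex[where h = fst, OF bb]]) (auto simp only: mem_Sigma_iff
          fst_conv intro!: st_le)
    from ptime_env[OF this] have s: "ptime ?N ?S (\<lambda>z. ?st (fst z) (snd z)) (\<lambda>z. ?st (fst z)
        (snd z))" .
    let ?x = "\<lambda>z. xs (fst z) ! snd z"
    have parts: "ptime ?N ?S (\<lambda>z. ?st (fst z) (snd z)) (\<lambda>z. e (fst z))"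
      "ptime ?N ?S (\<lambda>z. ?st (fst z) (snd z)) (\<lambda>z. F (fst z) (?acc (fst z) (snd z)))"
      "ptime ?N ?S (\<lambda>z. ?st (fst z) (snd z)) (\<lambda>z. elist (E (fst z)) (drop (snd z) (xs (fst z))))"
      using ptime_hd[OF s] ptime_hd[OF ptime_tl[OF s]] ptime_tl[OF ptime_tl[OF s]] by simp_all
    have D: "drop (snd z) (xs (fst z)) = ?x z # drop (Suc (snd z)) (xs (fst z))" if "z \<in> ?S" for z
      using that by (auto simp: Cons_nth_drop_Suc)
    have x: "ptime ?N ?S (\<lambda>z. ?st (fst z) (snd z)) (\<lambda>z. E (fst z) (?x z))"
      and r: "ptime ?N ?S (\<lambda>z. ?st (fst z) (snd z)) (\<lambda>z. elist (E (fst z)) (drop (Suc (snd z))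
          (xs (fst z))))"
      by (rule ptime_cong[OF ptime_hd[OF parts(3)]], simp add: D)
        (rule ptime_cong[OF ptime_tl[OF parts(3)]], simp add: D)
    \<comment> \<open>The body was analysed on triples with an accumulator, whereas the loop runs
      over round numbers; each round number yields such a triple.\<close>
    have "(fst z, ?acc (fst z) (snd z), ?x z) \<in> ?B" if "z \<in> ?S" for z
    proof -
      from that have "fst z \<in> A" "snd z < length (xs (fst z))" by auto
      with id_take_nth_drop[OF this(2)] show ?thesis unfolding B_def by blast
    qed
    from ptime_reindex[where h = "\<lambda>z. (fst z, ?acc (fst z) (snd z), ?x z)" and B = ?S, OF G this]
    have "ptime ?N ?S (\<lambda>z. Pair (e (fst z)) (Pair (F (fst z) (?acc (fst z) (snd z)))
        (E (fst z) (?x z))))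
        (\<lambda>z. F (fst z) (G (fst z) (?x z) (?acc (fst z) (snd z))))"
      by (simp only: fst_conv snd_conv)
    from ptime_comp[OF ptime_Pair[OF parts(1) ptime_Pair[OF parts(2) x]] this]
    have "ptime ?N ?S (\<lambda>z. ?st (fst z) (snd z)) (\<lambda>z. F (fst z) (?acc (fst z) (Suc (snd z))))"
      by (rule ptime_cong) (auto simp: take_Suc_conv_app_nth)
    from ptime_Pair[OF parts(1) ptime_Pair[OF this r]] show ?thesis .
  qed
  then have "ptime N A (\<lambda>j. ?st j 0) (\<lambda>j. ?st j (?n j))"
  \<comment> \<open>The test is the rest of the list, which is \<open>Atom\<close> exactly when
    nothing is left.\<close>
  proof (rule ptime_loop[where x = "Tl (Tl (Var 0))" and c = 3 and b = ?b])
    show "pbound N A ?n" by (rule pbound_mono[OF bxs]) (metis length_le_dsize length_map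
        less_imp_le)
  qed (use bb st_le in auto)
  moreover have "ptime N A e (\<lambda>j. ?st j 0)"
    using ptime_Pair[OF ptime_env[OF be] ptime_Pair[OF a xs]] by simp
  ultimately have "ptime N A e (\<lambda>j. ?st j (?n j))" by (rule ptime_comp[rotated])
  from ptime_hd[OF ptime_tl[OF this]] show ?thesis by simp
qed

section \<open>Booleans and standard list functions\<close>

lemma ptime_const:
  assumes "ptime N A e f"
  shows "ptime N A e (\<lambda>_. d)"
  by (induction d) (auto intro: ptime_Pair ptime_Atom[OF assms])

lemma enc_bool_eq [simp]: "enc_bool a = enc_bool b \<longleftrightarrow> a = b"
  by (auto simp: enc_bool_def)

lemma ptime_not:
  assumes "ptime N A e (\<lambda>j. enc_bool (a j))"
  shows "ptime N A e (\<lambda>j. enc_bool (\<not> a j))"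
proof -
  have "ptime N A e (\<lambda>j. enc_bool (enc_bool (a j) = enc_bool False))"
    by (intro ptime_Eq assms ptime_const[OF assms])
  then show ?thesis by simp
qed

lemma ptime_conj:
  assumes "ptime N A e (\<lambda>j. enc_bool (a j))" "ptime N A e (\<lambda>j. enc_bool (b j))"
  shows "ptime N A e (\<lambda>j. enc_bool (a j \<and> b j))"
proof -
  have "ptime N A e (\<lambda>j. if a j then enc_bool (b j) else enc_bool False)"
    by (intro ptime_if assms ptime_const[OF assms(1)]) (auto intro: ptime_subset[OF assms(2)]
      ptime_subset[OF ptime_const[OF assms(1)]])
  then show ?thesis by (rule ptime_cong) simp
qed

lemma ptime_imp:
  assumes "ptime N A e (\<lambda>j. enc_bool (a j))" "ptime N A e (\<lambda>j. enc_bool (b j))"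
  shows "ptime N A e (\<lambda>j. enc_bool (a j \<longrightarrow> b j))"
  using ptime_not[OF ptime_conj[OF assms(1) ptime_not[OF assms(2)]]] by simp

lemma dsize_enc_list: "dsize (enc_list ds) = 1 + (\<Sum>d\<leftarrow>ds. 1 + dsize d)"
  by (induction ds) auto

lemma dsize_elist: "dsize (elist E xs) = 1 + (\<Sum>x\<leftarrow>xs. 1 + dsize (E x))"
  by (induction xs) auto

lemma ptime_Nil: "ptime N A e f \<Longrightarrow> ptime N A e (\<lambda>j. elist (E j) [])"
  by (simp add: ptime_const)

lemma ptime_Cons:
  "ptime N A e (\<lambda>j. E j (x j)) \<Longrightarrow> ptime N A e (\<lambda>j. elist (E j) (xs j)) \<Longrightarrow>
   ptime N A e (\<lambda>j. elist (E j) (x j # xs j))"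
  by (simp add: ptime_Pair)

lemma ptime_is_Nil:
  assumes "ptime N A e (\<lambda>j. elist (E j) (xs j))"
  shows "ptime N A e (\<lambda>j. enc_bool (xs j = []))"
proof -
  have "ptime N A e (\<lambda>j. enc_bool (elist (E j) (xs j) = Atom))"
    by (intro ptime_Eq assms ptime_const[OF assms])
  then show ?thesis by simp
qed

lemma ptime_list_hd:
  assumes "ptime N A e (\<lambda>j. elist (E j) (xs j))" "\<And>j. j \<in> A \<Longrightarrow> xs j \<noteq> []"
  shows "ptime N A e (\<lambda>j. E j (hd (xs j)))"
proof (rule ptime_cong[OF ptime_hd[OF assms(1)]])
  fix j assume "j \<in> A"
  from assms(2)[OF this] show "hd_data (elist (E j) (xs j)) = E j (hd (xs j))" by (cases "xs j")
      auto
qed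

lemma ptime_list_tl:
  assumes "ptime N A e (\<lambda>j. elist (E j) (xs j))"
  shows "ptime N A e (\<lambda>j. elist (E j) (tl (xs j)))"
proof (rule ptime_cong[OF ptime_tl[OF assms]])
  show "tl_data (elist (E j) (xs j)) = elist (E j) (tl (xs j))" for j
    by (cases "xs j") auto
qed

lemma ptime_rev:
  fixes E :: "'j \<Rightarrow> 'x \<Rightarrow> data"
  assumes xs: "ptime N A e (\<lambda>j. elist (E j) (xs j))"
  shows "ptime N A e (\<lambda>j. elist (E j) (rev (xs j)))"
proof -
  have "ptime N A e (\<lambda>j. elist (E j) (fold (\<lambda>x a. x # a) (xs j) []))"
  proof (rule ptime_fold[where E = E and F = "\<lambda>j. elist (E j)" and a = "\<lambda>_. []",
      OF xs ptime_Nil[OF xs] ptime_pbound[OF xs]])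
    fix j ys zs assume "xs j = ys @ zs"
    then show "dsize (elist (E j) (fold (\<lambda>x a. x # a) ys [])) \<le> dsize (elist (E j) (xs j))"
      by (simp add: dsize_enc_list fold_Cons_rev rev_map[symmetric] comp_def)
  qed (rule ptime_Cons)
  then show ?thesis by (simp add: fold_Cons_rev)
qed

text \<open>Items can be added only at the front, so the first list is reversed before it is folded
  onto the second.\<close>

lemma ptime_append:
  fixes E :: "'j \<Rightarrow> 'x \<Rightarrow> data"
  assumes xs: "ptime N A e (\<lambda>j. elist (E j) (xs j))" and ys: "ptime N A e (\<lambda>j. elist (E j) (ys j))"
  shows "ptime N A e (\<lambda>j. elist (E j) (xs j @ ys j))"
proof -
  have "ptime N A e (\<lambda>j. elist (E j) (fold (\<lambda>x a. x # a) (rev (xs j)) (ys j)))"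
  proof (rule ptime_fold[where E = E and F = "\<lambda>j. elist (E j)" and a = ys, OF ptime_rev[OF xs] ys
      pbound_add[OF ptime_pbound[OF xs] ptime_pbound[OF ys]]])
    fix j us vs assume *: "rev (xs j) = us @ vs"
    have "dsize (elist (E j) (fold (\<lambda>x a. x # a) us (ys j))) \<le> dsize (elist (E j) (rev (us @ vs))) +
        dsize (elist (E j) (ys j))"
      by (simp add: dsize_enc_list fold_Cons_rev rev_map[symmetric] comp_def)
    then show "dsize (elist (E j) (fold (\<lambda>x a. x # a) us (ys j))) \<le> dsize (elist (E j) (xs j)) +
        dsize (elist (E j) (ys j))"
      using * by (metis rev_rev_ident)
  qed (rule ptime_Cons)
  then show ?thesis by (simp add: fold_Cons_rev)
qed

lemma ptime_concat:
  fixes E :: "'j \<Rightarrow> 'x \<Rightarrow> data"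
  assumes xss: "ptime N A e (\<lambda>j. elist (elist (E j)) (xss j))"
  shows "ptime N A e (\<lambda>j. elist (E j) (concat (xss j)))"
proof -
  have fold_eq: "fold (\<lambda>x a. a @ x) xs a = a @ concat xs" for xs :: "'y list list" and a
    by (induction xs arbitrary: a) auto
  have "ptime N A e (\<lambda>j. elist (E j) (fold (\<lambda>x a. a @ x) (xss j) []))"
  proof (rule ptime_fold[where E = "\<lambda>j. elist (E j)" and F = "\<lambda>j. elist (E j)" and a = "\<lambda>_. []",
      OF xss ptime_Nil[OF xss] ptime_pbound[OF xss]])
    fix j ys zs assume "xss j = ys @ zs"
    moreover have "dsize (elist (E j) (concat ys)) \<le> dsize (elist (elist (E j)) (ys @ zs))"
      by (induction ys) (auto simp: dsize_enc_list comp_def)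
    ultimately show "dsize (elist (E j) (fold (\<lambda>x a. a @ x) ys [])) \<le>
        dsize (elist (elist (E j)) (xss j))"
      by (simp add: fold_eq del: map_map)
  qed (rule ptime_append)
  then show ?thesis by (simp add: fold_eq)
qed

text \<open>The obligation for the body of a loop over \<open>xs\<close>. Its two premises let
  \<open>e'\<close> simulate the outer environment and hand over the current item; nothing else is
  known about \<open>e'\<close>, so nested loops need no bookkeeping of variables.\<close>

abbreviation (input) ptime_each where
  "ptime_each N A e E xs g \<equiv> (\<And>e'.
     (\<And>f. ptime N A e f \<Longrightarrow> ptime (\<lambda>z. N (fst z)) (SIGMA j:A. set (xs j)) e' (\<lambda>z. f (fst z))) \<Longrightarrow>
     ptime (\<lambda>z. N (fst z)) (SIGMA j:A. set (xs j)) e' (\<lambda>z. E (fst z) (snd z)) \<Longrightarrow>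
     ptime (\<lambda>z. N (fst z)) (SIGMA j:A. set (xs j)) e' (\<lambda>z. g (fst z) (snd z)))"

theorem ptime_map:
  fixes E g :: "'j \<Rightarrow> 'x \<Rightarrow> data"
  assumes xs: "ptime N A e (\<lambda>j. elist (E j) (xs j))" and body: "PROP ptime_each N A e E xs g"
  shows "ptime N A e (\<lambda>j. elist (g j) (xs j))"
proof -
  let ?e = "\<lambda>z. Pair (e (fst z)) (E (fst z) (snd z))"
  let ?N = "\<lambda>z. N (fst z)" and ?B = "SIGMA j:A. set (xs j)"
  note bxs = ptime_pbound[OF xs] and be = ptime_pbound_env[OF xs]
  have mem: "fst z \<in> A" if "z \<in> ?B" for z using that by auto
  have "pbound ?N ?B (\<lambda>z. dsize (?e z))"
  proof (rule pbound_mono)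
    show "pbound ?N ?B (\<lambda>z. 1 + dsize (e (fst z)) + dsize (elist (E (fst z)) (xs (fst z))))"
      by (intro pbound_intros pbound_reindex[OF be] pbound_reindex[OF bxs] mem)
  qed (use dsize_mem in fastforce)
  from ptime_env[OF this] have env: "ptime ?N ?B ?e ?e" .
  have g: "ptime ?N ?B ?e (\<lambda>z. g (fst z) (snd z))"
  proof (rule body)
    have 1: "ptime ?N ?B ?e (\<lambda>z. e (fst z))" using ptime_hd[OF env] by simp
    show "ptime ?N ?B ?e (\<lambda>z. f (fst z))" if "ptime N A e f" for f
      by (rule ptime_comp[OF 1 ptime_reindex[OF that mem]])
    show "ptime ?N ?B ?e (\<lambda>z. E (fst z) (snd z))" using ptime_tl[OF env] by simp
  qed
  then obtain p where p: "\<And>j x. j \<in> A \<Longrightarrow> x \<in> set (xs j) \<Longrightarrow> dsize (g j x) \<le> poly p (N j)"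
    using ptime_pbound unfolding pbound_def by fastforce
  \<comment> \<open>The list has fewer items than the size of its encoding, and \<open>p\<close>
    bounds each result.\<close>
  have b: "pbound N A (\<lambda>j. 1 + dsize (elist (E j) (xs j)) * (1 + poly p (N j)))"
    by (intro pbound_intros bxs) (auto simp: pbound_def)
  have fold_eq: "fold (\<lambda>x a. h x # a) ys a = rev (map h ys) @ a" for h :: "'x \<Rightarrow> data" and ys a
    by (induction ys arbitrary: a) auto
  \<comment> \<open>The accumulator holds the encoded results themselves, in reverse order.\<close>
  have "ptime N A e (\<lambda>j. elist (\<lambda>d. d) (fold (\<lambda>x a. g j x # a) (xs j) []))"
  proof (rule ptime_fold[where E = E and F = "\<lambda>j. elist (\<lambda>d. d)" and a = "\<lambda>_. []",
      OF xs ptime_Nil[OF xs] b])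
    fix j ys zs assume *: "j \<in> A" "xs j = ys @ zs"
    have "dsize (enc_list (rev (map (g j) ys))) = dsize (elist (g j) ys)"
      by (simp add: dsize_enc_list rev_map[symmetric])
    also have "\<dots> = 1 + (\<Sum>x\<leftarrow>ys. 1 + dsize (g j x))" by (rule dsize_elist)
    also have "(\<Sum>x\<leftarrow>ys. 1 + dsize (g j x)) \<le> (\<Sum>x\<leftarrow>ys. 1 + poly p (N j))"
      by (rule sum_list_mono) (use p * in auto)
    also have "\<dots> = length ys * (1 + poly p (N j))" by (simp add: sum_list_triv)
    also have "\<dots> \<le> dsize (elist (E j) (xs j)) * (1 + poly p (N j))"
      using length_le_dsize[of "map (E j) (xs j)"] * by (intro mult_right_mono) auto
    finally show "dsize (elist (\<lambda>d. d) (fold (\<lambda>x a. g j x # a) ys [])) \<le>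
        1 + dsize (elist (E j) (xs j)) * (1 + poly p (N j))"
      by (simp add: fold_eq mult_le_mono1)
  next
    fix e'
    let ?B' = "{(j, fold (\<lambda>x a. g j x # a) ys [], x) | j ys x. j \<in> A \<and> (\<exists>zs. xs j = ys @ x # zs)}"
    assume 1: "\<And>f. ptime N A e f \<Longrightarrow> ptime ?N ?B' e' (\<lambda>z. f (fst z))"
      and 2: "ptime ?N ?B' e' (\<lambda>z. elist (\<lambda>d. d) (fst (snd z)))"
      and 3: "ptime ?N ?B' e' (\<lambda>z. E (fst z) (snd (snd z)))"
    have "(fst z, snd (snd z)) \<in> ?B" if "z \<in> ?B'" for z using that by auto
    from ptime_reindex[where h = "\<lambda>z. (fst z, snd (snd z))" and B = ?B', OF g this]
    have "ptime ?N ?B' (\<lambda>z. Pair (e (fst z)) (E (fst z) (snd (snd z))))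
        (\<lambda>z. g (fst z) (snd (snd z)))"
      by (simp only: fst_conv snd_conv)
    from ptime_Pair[OF ptime_comp[OF ptime_Pair[OF 1[OF ptime_env[OF be]] 3] this] 2]
    show "ptime ?N ?B' e' (\<lambda>z. elist (\<lambda>d. d) (g (fst z) (snd (snd z)) # fst (snd z)))" by simp
  qed
  from ptime_rev[OF this] show ?thesis by (simp add: fold_eq)
qed

text \<open>Filtering amounts to mapping into lists of length at most one and concatenating.\<close>

lemma ptime_filter:
  fixes E :: "'j \<Rightarrow> 'x \<Rightarrow> data" and P :: "'j \<Rightarrow> 'x \<Rightarrow> bool"
  assumes xs: "ptime N A e (\<lambda>j. elist (E j) (xs j))"
    and body: "PROP ptime_each N A e E xs (\<lambda>j x. enc_bool (P j x))"
  shows "ptime N A e (\<lambda>j. elist (E j) (filter (P j) (xs j)))"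
proof -
  have "ptime N A e (\<lambda>j. elist (\<lambda>x. elist (E j) (if P j x then [x] else [])) (xs j))"
  proof (rule ptime_map[OF xs], goal_cases)
    case (1 e')
    let ?B = "SIGMA j:A. set (xs j)"
    note Nil = ptime_Nil[OF 1(2)]
    have "ptime (\<lambda>z. N (fst z)) ?B e' (\<lambda>z. elist (E (fst z)) [snd z])"
      by (rule ptime_Cons) (rule 1(2), rule Nil)
    then have "ptime (\<lambda>z. N (fst z)) ?B e' (\<lambda>z. if P (fst z) (snd z) then elist (E (fst z)) [snd z]
        else elist (E (fst z)) [])"
      by (intro ptime_if body[OF 1]) (auto intro: ptime_subset intro!: ptime_subset[OF Nil,
          simplified])
    then show ?case by (rule ptime_cong) simp
  qed
  then have *: "ptime N A e (\<lambda>j. elist (elist (E j)) (map (\<lambda>x. if P j x then [x] else []) (xs j)))"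
    by (simp add: comp_def)
  moreover have "concat (map (\<lambda>x. if P j x then [x] else []) ys) = filter (P j) ys" for j ys
    by (induction ys) auto
  ultimately show ?thesis using ptime_concat[OF *] by simp
qed

lemma ptime_list_all:
  fixes E :: "'j \<Rightarrow> 'x \<Rightarrow> data" and P :: "'j \<Rightarrow> 'x \<Rightarrow> bool"
  assumes xs: "ptime N A e (\<lambda>j. elist (E j) (xs j))"
    and body: "PROP ptime_each N A e E xs (\<lambda>j x. enc_bool (P j x))"
  shows "ptime N A e (\<lambda>j. enc_bool (\<forall>x\<in>set (xs j). P j x))"
proof -
  have "ptime N A e (\<lambda>j. elist (E j) (filter (\<lambda>x. \<not> P j x) (xs j)))"
    by (rule ptime_filter[OF xs]) (intro ptime_not body, assumption+)
  from ptime_is_Nil[OF this] show ?thesis by (simp add: filter_empty_conv)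
qed

lemma ptime_list_ex:
  fixes E :: "'j \<Rightarrow> 'x \<Rightarrow> data" and P :: "'j \<Rightarrow> 'x \<Rightarrow> bool"
  assumes xs: "ptime N A e (\<lambda>j. elist (E j) (xs j))"
    and body: "PROP ptime_each N A e E xs (\<lambda>j x. enc_bool (P j x))"
  shows "ptime N A e (\<lambda>j. enc_bool (\<exists>x\<in>set (xs j). P j x))"
proof -
  have "ptime N A e (\<lambda>j. enc_bool (\<forall>x\<in>set (xs j). \<not> P j x))"
    by (rule ptime_list_all[OF xs]) (intro ptime_not body, assumption+)
  from ptime_not[OF this] show ?thesis by simp
qed

text \<open>A program can compare only encodings, so equal encodings must mean equal objects on the
  values at hand. For vertex sets this holds as long as they stay inside the list of
  vertices.\<close>

lemma ptime_mem:
  fixes E :: "'j \<Rightarrow> 'x \<Rightarrow> data"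
  assumes x: "ptime N A e (\<lambda>j. E j (x j))" and xs: "ptime N A e (\<lambda>j. elist (E j) (xs j))"
    and inj: "\<And>j y. j \<in> A \<Longrightarrow> y \<in> set (xs j) \<Longrightarrow> E j y = E j (x j) \<Longrightarrow> y = x j"
  shows "ptime N A e (\<lambda>j. enc_bool (x j \<in> set (xs j)))"
proof -
  have "ptime N A e (\<lambda>j. enc_bool (\<exists>y\<in>set (xs j). E j y = E j (x j)))"
  proof (rule ptime_list_ex[OF xs], goal_cases)
    case (1 e')
    show ?case by (rule ptime_Eq[OF 1(2) 1(1)[OF x]])
  qed
  then show ?thesis by (rule ptime_cong) (use inj in \<open>auto simp: enc_bool_def\<close>)
qed

lemma ptime_uniq:
  fixes E :: "'j \<Rightarrow> 'x \<Rightarrow> data"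
  assumes xs: "ptime N A e (\<lambda>j. elist (E j) (xs j))"
    and inj: "\<And>j. j \<in> A \<Longrightarrow> inj_on (E j) (set (xs j))"
  shows "ptime N A e (\<lambda>j. elist (E j) (fold List.insert (xs j) []))"
proof (rule ptime_fold[where E = E and F = "\<lambda>j. elist (E j)" and a = "\<lambda>_. []",
    OF xs ptime_Nil[OF xs] ptime_pbound[OF xs]])
  fix j ys zs assume *: "xs j = ys @ zs"
  have "dsize (elist (E j) (fold List.insert ys a)) \<le> (\<Sum>x\<leftarrow>ys. 1 + dsize (E j x)) + dsize
      (elist (E j) a)" for a
  proof (induction ys arbitrary: a)
    case (Cons x ys)
    have "dsize (elist (E j) (List.insert x a)) \<le> 1 + dsize (E j x) + dsize (elist (E j) a)"
      by (simp add: List.insert_def)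
    with Cons[of "List.insert x a"] show ?case by simp
  qed simp
  from this[of "[]"] show "dsize (elist (E j) (fold List.insert ys [])) \<le>
      dsize (elist (E j) (xs j))"
    using * by (simp add: dsize_enc_list comp_def)
next
  fix e'
  let ?B = "{(j, fold List.insert ys [], x) | j ys x. j \<in> A \<and> (\<exists>zs. xs j = ys @ x # zs)}"
  assume 2: "ptime (\<lambda>z. N (fst z)) ?B e' (\<lambda>z. elist (E (fst z)) (fst (snd z)))"
      and 3: "ptime (\<lambda>z. N (fst z)) ?B e' (\<lambda>z. E (fst z) (snd (snd z)))"
  have set_fold: "set (fold List.insert ys a) = set ys \<union> set a" for ys a :: "'x list"
    by (induction ys arbitrary: a) auto
  have "ptime (\<lambda>z. N (fst z)) ?B e' (\<lambda>z. enc_bool (snd (snd z) \<in> set (fst (snd z))))"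
    by (rule ptime_mem[OF 3 2]) (use inj in \<open>fastforce simp: set_fold inj_on_def\<close>)
  then have "ptime (\<lambda>z. N (fst z)) ?B e' (\<lambda>z. if snd (snd z) \<in> set (fst (snd z)) then elist
      (E (fst z)) (fst (snd z))
     else elist (E (fst z)) (snd (snd z) # fst (snd z)))"
    by (rule ptime_if) (rule ptime_subset[OF 2], blast, rule ptime_subset[OF ptime_Cons[OF 3 2]],
        blast)
  then show "ptime (\<lambda>z. N (fst z)) ?B e' (\<lambda>z. elist (E (fst z)) (List.insert (snd (snd z))
      (fst (snd z))))"
    by (rule ptime_cong) (simp add: List.insert_def)
qed

lemma enc_nat_eq_elist: "enc_nat n = elist (\<lambda>_. Atom) (replicate n ())"
  by (induction n) auto

lemma dsize_enc_nat: "dsize (enc_nat n) = 2 * n + 1"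
  by (induction n) auto

text \<open>A unary counter is a list of units, so this is a fold. The size bound on all iterates is
  a hypothesis because a polynomial step, iterated polynomially often, may produce values of
  exponential size.\<close>

theorem ptime_iterate:
  fixes F :: "'j \<Rightarrow> 'a \<Rightarrow> data"
  defines "B A n f a \<equiv> {(j, (f j ^^ i) (a j)) | j i. j \<in> A \<and> i < n j}"
  assumes n: "ptime N A e (\<lambda>j. enc_nat (n j))" and a: "ptime N A e (\<lambda>j. F j (a j))"
    and b: "pbound N A b" "\<And>j i. j \<in> A \<Longrightarrow> i \<le> n j \<Longrightarrow> dsize (F j ((f j ^^ i) (a j))) \<le> b j"
    and body: "\<And>e'.
       (\<And>g. ptime N A e g \<Longrightarrow> ptime (\<lambda>z. N (fst z)) (B A n f a) e' (\<lambda>z. g (fst z))) \<Longrightarrow>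
       ptime (\<lambda>z. N (fst z)) (B A n f a) e' (\<lambda>z. F (fst z) (snd z)) \<Longrightarrow>
       ptime (\<lambda>z. N (fst z)) (B A n f a) e' (\<lambda>z. F (fst z) (f (fst z) (snd z)))"
  shows "ptime N A e (\<lambda>j. F j ((f j ^^ n j) (a j)))"
proof -
  have fold_eq: "fold (\<lambda>_. g) xs c = (g ^^ length xs) c" for g :: "'a \<Rightarrow> 'a" and xs :: "unit list"
      and c
    by (induction xs arbitrary: c) (auto simp: funpow_swap1)
  let ?e = "\<lambda>z. Pair (e (fst z)) (F (fst z) (snd z))"
  let ?N = "\<lambda>z. N (fst z)" and ?B = "B A n f a"
  note be = ptime_pbound_env[OF a]
  have mem: "fst z \<in> A" if "z \<in> ?B" for z using that unfolding B_def by auto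
  have "pbound ?N ?B (\<lambda>z. dsize (?e z))"
  proof (rule pbound_mono)
    show "pbound ?N ?B (\<lambda>z. 1 + dsize (e (fst z)) + b (fst z))"
      by (intro pbound_intros pbound_reindex[OF be] pbound_reindex[OF b(1)] mem)
  qed (auto simp: B_def intro!: b(2))
  from ptime_env[OF this] have env: "ptime ?N ?B ?e ?e" .
  have g: "ptime ?N ?B ?e (\<lambda>z. F (fst z) (f (fst z) (snd z)))"
  proof (rule body)
    have 1: "ptime ?N ?B ?e (\<lambda>z. e (fst z))" using ptime_hd[OF env] by simp
    show "ptime ?N ?B ?e (\<lambda>z. f (fst z))" if "ptime N A e f" for f
      by (rule ptime_comp[OF 1 ptime_reindex[OF that mem]])
    show "ptime ?N ?B ?e (\<lambda>z. F (fst z) (snd z))" using ptime_tl[OF env] by simp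
  qed
  have "ptime N A e (\<lambda>j. F j (fold (\<lambda>_. f j) (replicate (n j) ()) (a j)))"
  proof (rule ptime_fold[where E = "\<lambda>_ _. Atom" and F = F and a = a, OF n[unfolded enc_nat_eq_elist]
      a b(1)])
    show "dsize (F j (fold (\<lambda>_. f j) ys (a j))) \<le> b j" if "j \<in> A" "replicate (n j) () = ys @ zs"
        for j ys zs
    proof -
      have "length ys \<le> n j" using arg_cong[OF that(2), of length] by simp
      with b(2) that show ?thesis by (simp add: fold_eq)
    qed
  next
    fix e'
    let ?B' = "{(j, fold (\<lambda>_. f j) ys (a j), x) | j ys x. j \<in> A \<and> (\<exists>zs. replicate (n j) () =
        ys @ x # zs)}"
    assume 1: "\<And>f. ptime N A e f \<Longrightarrow> ptime (\<lambda>z. N (fst z)) ?B' e' (\<lambda>z. f (fst z))"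
      and 2: "ptime (\<lambda>z. N (fst z)) ?B' e' (\<lambda>z. F (fst z) (fst (snd z)))"
    have "ptime (\<lambda>z. N (fst z)) ?B' e' (\<lambda>z. Pair (e (fst z)) (F (fst z) (fst (snd z))))"
      by (rule ptime_Pair[OF 1[OF ptime_env[OF be]] 2])
    moreover have "(fst z, fst (snd z)) \<in> ?B" if "z \<in> ?B'" for z
    proof -
      from that obtain j ys x zs where z: "z = (j, fold (\<lambda>_. f j) ys (a j), x)" "j \<in> A"
          "replicate (n j) () = ys @ x # zs"
        by blast
      have "length ys < n j" using arg_cong[OF z(3), of length] by simp
      with z show ?thesis by (auto simp: B_def fold_eq)
    qed
    from ptime_reindex[where h = "\<lambda>z. (fst z, fst (snd z))" and B = ?B', OF g this]
    have "ptime (\<lambda>z. N (fst z)) ?B' (\<lambda>z. Pair (e (fst z)) (F (fst z) (fst (snd z))))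
        (\<lambda>z. F (fst z) (f (fst z) (fst (snd z))))"
      by (simp only: fst_conv snd_conv)
    ultimately show "ptime (\<lambda>z. N (fst z)) ?B' e' (\<lambda>z. F (fst z) (f (fst z) (fst (snd z))))"
      by (rule ptime_comp)
  qed
  then show ?thesis by (simp add: fold_eq)
qed

lemma ptime_length:
  assumes "ptime N A e (\<lambda>j. elist (E j) (xs j))"
  shows "ptime N A e (\<lambda>j. enc_nat (length (xs j)))"
proof -
  have "ptime N A e (\<lambda>j. elist (\<lambda>_. Atom) (xs j))"
    by (rule ptime_map[OF assms]) (rule ptime_const)
  moreover have "elist (\<lambda>_. Atom) xs = enc_nat (length xs)" for xs :: "'b list"
    by (induction xs) auto
  ultimately show ?thesis by simp
qed

text \<open>Pointwise operations on two characteristic vectors require walking along both. The fold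
  runs over the first encoding and keeps the rest of the second, together with the reversed output,
  in its state.\<close>

lemma ptime_zip:
  fixes E F :: "'j \<Rightarrow> 'x \<Rightarrow> data"
  assumes E: "ptime N A e (\<lambda>j. elist (E j) (xs j))" and F: "ptime N A e (\<lambda>j. elist (F j) (xs j))"
  shows "ptime N A e (\<lambda>j. elist (\<lambda>x. Pair (E j x) (F j x)) (xs j))"
proof -
  define H where "H = (\<lambda>j (s :: 'x list \<times> 'x list). Pair (elist (F j) (fst s))
      (elist (\<lambda>x. Pair (E j x) (F j x)) (snd s)))"
  define G where "G = (\<lambda>(x::'x) (s :: 'x list \<times> 'x list). (tl (fst s), (x # snd s)))"
  have fold_eq: "fold G ys (ys @ zs, a) = (zs, rev ys @ a)" for ys zs a
    by (induction ys arbitrary: a) (auto simp: G_def)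
  have init: "ptime N A e (\<lambda>j. H j (xs j, []))"
    unfolding H_def using ptime_Pair[OF F ptime_const[OF F]] by simp
  \<comment> \<open>Each output item is one \<open>Pair\<close> larger than its two parts together;
    the constant 10 is generous.\<close>
  have b: "pbound N A (\<lambda>j. 10 + 10 * dsize (elist (E j) (xs j)) + 10 * dsize (elist (F j) (xs j)))"
    by (intro pbound_intros ptime_pbound[OF E] ptime_pbound[OF F])
  have "ptime N A e (\<lambda>j. H j (fold G (xs j) (xs j, [])))"
  proof (rule ptime_fold[where E = E and F = H and a = "\<lambda>j. (xs j, [])", OF E init b])
    fix j ys zs assume *: "xs j = ys @ zs"
    have "dsize (elist (\<lambda>x. Pair (E j x) (F j x)) (rev ys)) \<le> 1 + 2 * (\<Sum>x\<leftarrow>ys. 1 + dsize (E j x)) + 2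
        * (\<Sum>x\<leftarrow>ys. 1 + dsize (F j x))"
      by (induction ys) (auto simp: dsize_enc_list)
    then show "dsize (H j (fold G ys (xs j, []))) \<le> 10 + 10 * dsize (elist (E j) (xs j)) + 10 *
        dsize (elist (F j) (xs j))"
      unfolding * fold_eq by (simp add: H_def dsize_enc_list comp_def)
  next
    fix e'
    let ?B = "{(j, fold G ys (xs j, []), x) | j ys x. j \<in> A \<and> (\<exists>zs. xs j = ys @ x # zs)}"
    assume 1: "\<And>f. ptime N A e f \<Longrightarrow> ptime (\<lambda>z. N (fst z)) ?B e' (\<lambda>z. f (fst z))"
      and 2: "ptime (\<lambda>z. N (fst z)) ?B e' (\<lambda>z. H (fst z) (fst (snd z)))"
      and 3: "ptime (\<lambda>z. N (fst z)) ?B e' (\<lambda>z. E (fst z) (snd (snd z)))"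
    have r: "ptime (\<lambda>z. N (fst z)) ?B e' (\<lambda>z. elist (F (fst z)) (fst (fst (snd z))))"
      and o: "ptime (\<lambda>z. N (fst z)) ?B e' (\<lambda>z. elist (\<lambda>x. Pair (E (fst z) x) (F (fst z) x))
          (snd (fst (snd z))))"
      using ptime_hd[OF 2] ptime_tl[OF 2] by (simp_all add: H_def)
    have "ptime (\<lambda>z. N (fst z)) ?B e' (\<lambda>z. F (fst z) (snd (snd z)))"
      by (rule ptime_cong[OF ptime_hd[OF r]]) (auto simp: fold_eq)
    from ptime_Pair[OF ptime_list_tl[OF r] ptime_Pair[OF ptime_Pair[OF 3 this] o]]
    show "ptime (\<lambda>z. N (fst z)) ?B e' (\<lambda>z. H (fst z) (G (snd (snd z)) (fst (snd z))))"
      by (simp add: H_def G_def)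
  qed
  from ptime_tl[OF this] have "ptime N A e (\<lambda>j. elist (\<lambda>x. Pair (E j x) (F j x)) (rev (xs j)))"
    using fold_eq[of "xs _" "[]" "[]"] by (simp add: H_def)
  from ptime_rev[OF this] show ?thesis by simp
qed

section \<open>The algorithm\<close>

text \<open>One round of flooding outside \<open>X\<close>. Additions take effect within the same
  pass over the edges, which can only speed up the closure.\<close>

definition spread :: "'a set list \<Rightarrow> 'a set \<Rightarrow> 'a set \<Rightarrow> 'a set" where
  "spread es X C = fold (\<lambda>e C. if e \<inter> C = {} then C else C \<union> (e - X)) es C"

definition component :: "'a list \<Rightarrow> 'a set list \<Rightarrow> 'a set \<Rightarrow> 'a set \<Rightarrow> 'a set" where
  "component vs es X S = (spread es X ^^ length vs) S"

text \<open>Every component of the complement of \<open>X\<close> contains \<open>e - X\<close> for some edge \<open>e\<close>; these sets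
  serve as seeds, since single vertices are not readily available in the input.\<close>

definition components :: "'a list \<Rightarrow> 'a set list \<Rightarrow> 'a set \<Rightarrow> 'a set \<Rightarrow> 'a set list" where
  "components vs es X C =
     fold List.insert (map (\<lambda>e. component vs es X (e - X)) (filter (\<lambda>e. \<not> e \<inter> C \<subseteq> X) es)) []"

text \<open>The closed neighbourhood of \<open>C\<close> in the primal graph, for a set
  \<open>C\<close> of vertices that are covered by edges.\<close>

definition neighbourhood :: "'a set list \<Rightarrow> 'a set \<Rightarrow> 'a set" where
  "neighbourhood es C = fold (\<lambda>e a. a \<union> e) (filter (\<lambda>e. e \<inter> C \<noteq> {}) es) {}"

text \<open>In the robber and cops reading, \<open>X\<close> is a winning move against a robber in
  \<open>C\<close>, given that the blocks of the table \<open>T\<close> are won. Meeting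
  \<open>C\<close> forces progress; containing the boundary of \<open>C\<close> keeps the robber
  inside \<open>C\<close>.\<close>

definition splits ::
  "'a list \<Rightarrow> 'a set list \<Rightarrow> ('a set \<times> 'a set set \<times> 'a set) list \<Rightarrow> 'a set \<Rightarrow> 'a set \<Rightarrow> bool" where
  "splits vs es T C X \<longleftrightarrow> C \<inter> X \<noteq> {} \<and> (\<forall>e\<in>set es. e \<inter> C \<noteq> {} \<longrightarrow> e \<subseteq> C \<union> X) \<and>
     (\<forall>C'\<in>set (components vs es X C). C' \<in> set (map fst T))"

text \<open>Only components of the complement of a listed separator arise in the recursion, at most
  one per separator and edge; this keeps the table polynomial.\<close>

definition blocks :: "'a list \<Rightarrow> 'a set list \<Rightarrow> ('a set set \<times> 'a set) list \<Rightarrow> 'a set list" where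
  "blocks vs es seps = concat (map (\<lambda>p. components vs es (snd p) (set vs)) seps)"

definition moves ::
  "'a list \<Rightarrow> 'a set list \<Rightarrow> ('a set set \<times> 'a set) list \<Rightarrow> ('a set \<times> 'a set set \<times> 'a set) list" where
  "moves vs es seps = concat (map (\<lambda>C. map (\<lambda>p. (C, p)) seps) (blocks vs es seps))"

text \<open>The \<open>r\<close>-th iterate holds the moves that win within \<open>r\<close> rounds.
  Each round filters the fixed list \<open>moves\<close> afresh, so no iterate is longer than that
  list.\<close>

definition winning ::
  "'a list \<Rightarrow> 'a set list \<Rightarrow> ('a set set \<times> 'a set) list \<Rightarrow> nat \<Rightarrow> ('a set \<times> 'a set set \<times> 'a set) list"
      where
  "winning vs es seps r =
     ((\<lambda>T. filter (\<lambda>t. splits vs es T (fst t) (snd (snd t))) (moves vs es seps)) ^^ r) []"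

text \<open>The appended entry keeps \<open>hd\<close> defined for blocks missing from the
  table.\<close>

definition lookup :: "('a set \<times> 'a set set \<times> 'a set) list \<Rightarrow> 'a set \<Rightarrow> 'a set set \<times> 'a set" where
  "lookup T C = snd (hd (filter (\<lambda>t. fst t = C) T @ [(C, {}, {})]))"

text \<open>A queue of open blocks, each with the number of its future parent, and the nodes emitted
  so far as parent, bag and cover. The number of a node is its position in the second list.\<close>

type_synonym 'a build_state = "(nat \<times> 'a set) list \<times> (nat \<times> 'a set \<times> 'a set set) list"

text \<open>The root has an empty bag and joins the components of a possibly disconnected
  hypergraph.\<close>

definition build_init :: "'a list \<Rightarrow> 'a set list \<Rightarrow> 'a build_state" where
  "build_init vs es = (map (\<lambda>C. (0, C)) (components vs es {} (set vs)), [(0, {}, {})])"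

text \<open>The bag is the separator cut down to the closed neighbourhood of the block: the other
  vertices of the separator may occur in unrelated places of the tree, and keeping them could break
  connectedness.\<close>

definition build_step ::
  "'a list \<Rightarrow> 'a set list \<Rightarrow> ('a set \<times> 'a set set \<times> 'a set) list \<Rightarrow> 'a build_state \<Rightarrow> 'a build_state"
      where
  "build_step vs es T s = (if fst s = [] then s else
     (tl (fst s) @ map (\<lambda>C. (length (snd s), C)) (components vs es
         (snd (lookup T (snd (hd (fst s))))) (snd (hd (fst s)))),
      snd s @ [(fst (hd (fst s)),
        snd (lookup T (snd (hd (fst s)))) \<inter> neighbourhood es (snd (hd (fst s))),
        fst (lookup T (snd (hd (fst s)))))]))"

text \<open>If all blocks that come up are won, each step lowers the total size of the open blocks,
  so \<open>length vs\<close> steps empty the queue.\<close>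

definition build ::
  "'a list \<Rightarrow> 'a set list \<Rightarrow> ('a set \<times> 'a set set \<times> 'a set) list \<Rightarrow> (nat \<times> 'a set \<times> 'a set set) list"
      where
  "build vs es T = snd ((build_step vs es T ^^ length vs) (build_init vs es))"

section \<open>Components as classes of reachability outside a set\<close>

definition adj :: "'a set list \<Rightarrow> 'a set \<Rightarrow> ('a \<times> 'a) set" where
  "adj es X = {(a, b). \<exists>e\<in>set es. a \<in> e - X \<and> b \<in> e - X}"

definition reach :: "'a set list \<Rightarrow> 'a set \<Rightarrow> 'a \<Rightarrow> 'a set" where
  "reach es X v = (adj es X)\<^sup>* `` {v}"

text \<open>An application that changes the set enlarges it, which can happen at most
  \<open>card V\<close> times.\<close>

lemma inflationary_stable:
  assumes "finite V" and f: "\<And>C. C \<subseteq> V \<Longrightarrow> C \<subseteq> f C \<and> f C \<subseteq> V" and "S \<subseteq> V"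
  shows "f ((f ^^ card V) S) = (f ^^ card V) S"
proof -
  have sub: "(f ^^ i) S \<subseteq> V" for i using f assms(3) by (induction i) auto
  have "i \<le> card ((f ^^ i) S) \<or> f ((f ^^ i) S) = (f ^^ i) S" for i
  proof (induction i)
    case (Suc i)
    show ?case
    proof (cases "f ((f ^^ i) S) = (f ^^ i) S")
      case False
      then have "(f ^^ i) S \<subset> f ((f ^^ i) S)" using f[OF sub[of i]] by blast
      then have "card ((f ^^ i) S) < card ((f ^^ Suc i) S)"
        using sub[of "Suc i"] \<open>finite V\<close> by (auto intro!: psubset_card_mono intro: finite_subset)
      with Suc False show ?thesis by simp
    qed simp
  qed simp
  from this[of "card V"] show ?thesis
  proof
    assume "card V \<le> card ((f ^^ card V) S)"
    with sub[of "card V"] \<open>finite V\<close> have "(f ^^ card V) S = V" by (simp add: card_seteq)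
    with f[of V] show ?thesis by auto
  qed
qed

lemma spread_increasing: "C \<subseteq> spread es X C"
  unfolding spread_def by (induction es arbitrary: C) (auto, blast+)

lemma spread_least:
  assumes "C \<subseteq> D" "\<And>e. e \<in> set es \<Longrightarrow> e \<inter> D \<noteq> {} \<Longrightarrow> e - X \<subseteq> D"
  shows "spread es X C \<subseteq> D"
  using assms unfolding spread_def
proof (induction es arbitrary: C)
  case (Cons e es)
  have "(if e \<inter> C = {} then C else C \<union> (e - X)) \<subseteq> D"
    using Cons.prems(1) Cons.prems(2)[of e] by auto
  from Cons.IH[OF this] Cons.prems(2) show ?case by simp
qed simp

lemma spread_contains:
  assumes "e \<in> set es" "e \<inter> C \<noteq> {}"
  shows "e - X \<subseteq> spread es X C"
  using assms
proof (induction es arbitrary: C)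
  case (Cons f es)
  let ?C = "if f \<inter> C = {} then C else C \<union> (f - X)"
  have step: "spread (f # es) X C = spread es X ?C" by (simp add: spread_def)
  show ?case
  proof (cases "e = f")
    case True
    then have "e - X \<subseteq> ?C" using Cons.prems by auto
    with spread_increasing[of ?C es X] show ?thesis unfolding step by blast
  next
    case False
    then have "e \<in> set es" "e \<inter> ?C \<noteq> {}" using Cons.prems by auto
    then show ?thesis unfolding step by (rule Cons.IH)
  qed
qed simp

lemma reach_refl: "v \<in> reach es X v"
  by (simp add: reach_def)

lemma reach_avoids: "w \<in> reach es X v \<Longrightarrow> v \<notin> X \<Longrightarrow> w \<notin> X"
  unfolding reach_def by (auto elim: rtranclE simp: adj_def)

lemma reach_edge:
  assumes "w \<in> reach es X v" "v \<notin> X" "e \<in> set es" "w \<in> e"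
  shows "e - X \<subseteq> reach es X v"
proof
  fix x assume "x \<in> e - X"
  with assms reach_avoids[OF assms(1,2)] have "(w, x) \<in> adj es X" by (auto simp: adj_def)
  with assms(1) show "x \<in> reach es X v" unfolding reach_def by (auto intro: rtrancl_into_rtrancl)
qed

lemma reach_subset:
  assumes "v \<in> D" "v \<notin> X" "\<And>e. e \<in> set es \<Longrightarrow> e \<inter> D \<noteq> {} \<Longrightarrow> e - X \<subseteq> D"
  shows "reach es X v \<subseteq> D"
proof
  fix w assume "w \<in> reach es X v"
  then have "(v, w) \<in> (adj es X)\<^sup>*" by (simp add: reach_def)
  then show "w \<in> D"
    by (induction rule: rtrancl_induct) (use assms in \<open>auto simp: adj_def\<close>)
qed

lemma reach_eq:
  assumes "w \<in> reach es X v"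
  shows "reach es X w = reach es X v"
proof -
  have "sym (adj es X)" by (auto simp: sym_def adj_def)
  then have "sym ((adj es X)\<^sup>*)" by (rule sym_rtrancl)
  moreover have vw: "(v, w) \<in> (adj es X)\<^sup>*" using assms by (simp add: reach_def)
  ultimately have wv: "(w, v) \<in> (adj es X)\<^sup>*" by (rule symD)
  have "(w, x) \<in> (adj es X)\<^sup>* \<longleftrightarrow> (v, x) \<in> (adj es X)\<^sup>*" for x
    using rtrancl_trans[OF vw, of x] rtrancl_trans[OF wv, of x] by blast
  then show ?thesis by (auto simp: reach_def)
qed

lemma neighbourhood_eq: "neighbourhood es C = \<Union>{e \<in> set es. e \<inter> C \<noteq> {}}"
proof -
  have "fold (\<lambda>e a. a \<union> e) xs A = A \<union> \<Union>(set xs)" for xs and A :: "'a set"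
    by (induction xs arbitrary: A) auto
  then show ?thesis by (simp add: neighbourhood_def)
qed

lemma set_fold_insert: "set (fold List.insert xs a) = set xs \<union> set a"
  by (induction xs arbitrary: a) auto

lemma distinct_fold_insert: "distinct a \<Longrightarrow> distinct (fold List.insert xs a)"
  by (induction xs arbitrary: a) auto

locale hypergraph_lists =
  fixes vs :: "'a list" and es :: "'a set list"
  assumes distinct_vs: "distinct vs" and distinct_es: "distinct es"
    and edge_nonempty: "e \<in> set es \<Longrightarrow> e \<noteq> {}"
    and edge_subset: "e \<in> set es \<Longrightarrow> e \<subseteq> set vs"
    and vertex_covered: "v \<in> set vs \<Longrightarrow> \<exists>e\<in>set es. v \<in> e"
begin

text \<open>\<open>reach\<close> is closed under edges outside \<open>X\<close>, so flooding never
  leaves it. The stable result of the flooding is closed as well and contains \<open>v\<close>, so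
  it contains \<open>reach\<close>.\<close>

lemma component_eq:
  assumes "e \<in> set es" "v \<in> e - X"
  shows "component vs es X (e - X) = reach es X v"
proof
  have R: "f - X \<subseteq> reach es X v" if "f \<in> set es" "f \<inter> reach es X v \<noteq> {}" for f
  proof -
    from that obtain w where "w \<in> reach es X v" "w \<in> f" by blast
    with reach_edge[of w es X v f] that assms show ?thesis by blast
  qed
  have "e - X \<subseteq> reach es X v" using reach_edge[OF reach_refl, of v X e es] assms by blast
  then have "(spread es X ^^ n) (e - X) \<subseteq> reach es X v" for n
    by (induction n) (simp_all add: spread_least[OF _ R])
  then show "component vs es X (e - X) \<subseteq> reach es X v" by (simp add: component_def)
next
  let ?D = "component vs es X (e - X)"
  have n: "length vs = card (set vs)" using distinct_card[OF distinct_vs] by simp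
  have "spread es X ?D = ?D" unfolding component_def n
  proof (rule inflationary_stable)
    fix C assume "C \<subseteq> set vs"
    then have "spread es X C \<subseteq> set vs" using spread_least[of C "set vs" es X] edge_subset by blast
    then show "C \<subseteq> spread es X C \<and> spread es X C \<subseteq> set vs" using spread_increasing[of C es X]
        by blast
  qed (use assms edge_subset in auto)
  then have "f - X \<subseteq> ?D" if "f \<in> set es" "f \<inter> ?D \<noteq> {}" for f
    using spread_contains[OF that, of X] by simp
  moreover have "e - X \<subseteq> (spread es X ^^ n) (e - X)" for n
  proof (induction n)
    case (Suc n)
    with spread_increasing[of "(spread es X ^^ n) (e - X)" es X] show ?case by simp
  qed simp
  ultimately show "reach es X v \<subseteq> ?D"
    using assms by (intro reach_subset) (auto simp: component_def)
qed

text \<open>The list collects the components that meet \<open>C - X\<close>. That they stay inside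
  \<open>C\<close> requires a separating \<open>X\<close> and is left to
  \<open>reach_in_block\<close>.\<close>

lemma set_components:
  assumes "C \<subseteq> set vs"
  shows "set (components vs es X C) = reach es X ` (C - X)"
proof -
  have "set (components vs es X C) = (\<lambda>e. component vs es X (e - X)) ` {e \<in> set es. \<not> e \<inter> C \<subseteq> X}"
    by (simp add: components_def set_fold_insert)
  also have "\<dots> = reach es X ` (C - X)"
  proof (intro equalityI subsetI)
    fix D assume "D \<in> (\<lambda>e. component vs es X (e - X)) ` {e \<in> set es. \<not> e \<inter> C \<subseteq> X}"
    then obtain e v where "D = component vs es X (e - X)" "e \<in> set es" "v \<in> e" "v \<in> C" "v \<notin> X"
        by blast
    with component_eq[of e v X] show "D \<in> reach es X ` (C - X)" by auto
  next
    fix D assume "D \<in> reach es X ` (C - X)"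
    then obtain v where v: "D = reach es X v" "v \<in> C - X" by blast
    then have "v \<in> set vs" using assms by blast
    from vertex_covered[OF this] obtain e where "e \<in> set es" "v \<in> e" by blast
    with v component_eq[of e v X] show "D \<in> (\<lambda>e. component vs es X (e - X)) ` {e \<in> set es. \<not> e \<inter> C \<subseteq>
        X}"
      by auto
  qed
  finally show ?thesis .
qed

lemma distinct_components: "distinct (components vs es X C)"
  unfolding components_def by (rule distinct_fold_insert) simp

text \<open>\<open>sorted_wrt disjnt\<close> is disjointness by position; it also excludes that a
  non-empty set is listed twice, as needed for summing cardinalities.\<close>

lemma components_disjoint:
  assumes "C \<subseteq> set vs"
  shows "sorted_wrt disjnt (components vs es X C)"
proof -
  have "disjnt A B" if AB: "A \<in> set (components vs es X C)" "B \<in> set (components vs es X C)" "A \<noteq> B"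
      for A B
  proof -
    from AB obtain a b where ab: "A = reach es X a" "B = reach es X b"
      unfolding set_components[OF assms] by blast
    show ?thesis
    proof (rule ccontr)
      assume "\<not> disjnt A B"
      then obtain w where "w \<in> A" "w \<in> B" by (auto simp: disjnt_def)
      with reach_eq[of w es X a] reach_eq[of w es X b] ab AB(3) show False by simp
    qed
  qed
  then have *: "sorted_wrt disjnt cs" if "distinct cs" "set cs \<subseteq> set (components vs es X C)" for cs
    using that by (induction cs) auto
  show ?thesis by (rule *[OF distinct_components order_refl])
qed

text \<open>An edge can leave \<open>C\<close> only into \<open>X\<close>, so \<open>C\<close> is
  closed under steps that avoid \<open>X\<close>.\<close>

lemma reach_in_block:
  assumes "\<forall>e\<in>set es. e \<inter> C \<noteq> {} \<longrightarrow> e \<subseteq> C \<union> X" "v \<in> C - X"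
  shows "reach es X v \<subseteq> C - X"
proof -
  have "reach es X v \<subseteq> C" by (rule reach_subset) (use assms in blast)+
  with reach_avoids[of _ es X v] assms show ?thesis by blast
qed

end

lemma sum_card_disjoint:
  assumes "finite D" "sorted_wrt disjnt cs" "\<And>C. C \<in> set cs \<Longrightarrow> C \<subseteq> D"
  shows "(\<Sum>C\<leftarrow>cs. card C) \<le> card D"
  using assms
proof (induction cs arbitrary: D)
  case (Cons C cs)
  have "(\<Sum>C\<leftarrow>cs. card C) \<le> card (D - C)"
    by (rule Cons.IH) (use Cons.prems in \<open>auto simp: disjnt_def\<close>)
  moreover have "card D = card C + card (D - C)"
    using Cons.prems by (metis card_Diff_subset card_mono finite_subset le_add_diff_inverse
        list.set_intros(1))
  ultimately show ?case by simp
qed simp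

section \<open>Correctness of the constructed decompositions\<close>

context hypergraph_lists
begin

lemma block_subset:
  assumes "C \<in> set (blocks vs es seps)"
  obtains p v where "p \<in> set seps" "v \<in> set vs - snd p" "C = reach es (snd p) v"
  using assms by (auto simp: blocks_def set_components)

lemma reach_subset_vertices: "v \<in> set vs - X \<Longrightarrow> reach es X v \<subseteq> set vs"
  by (rule reach_subset) (use edge_subset in auto)

text \<open>Every entry is justified by entries of the same table, with no order among them: the
  construction terminates because blocks shrink, not because of the round in which an entry was
  found.\<close>

definition strategy :: "nat \<Rightarrow> ('a set \<times> 'a set set \<times> 'a set) list \<Rightarrow> bool" where
  "strategy k T \<longleftrightarrow> (\<forall>(C, l, X)\<in>set T.
     splits vs es T C X \<and> C \<subseteq> set vs \<and> l \<subseteq> set es \<and> card l \<le> k \<and> X \<subseteq> \<Union>l)"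

lemma splits_mono: "splits vs es T C X \<Longrightarrow> set T \<subseteq> set T' \<Longrightarrow> splits vs es T' C X"
  unfolding splits_def set_map by (meson image_mono in_mono)

lemma winning_Suc: "set (winning vs es seps (Suc r)) =
   {t \<in> set (moves vs es seps). splits vs es (winning vs es seps r) (fst t) (snd (snd t))}"
  by (simp add: winning_def)

lemma winning_mono: "set (winning vs es seps r) \<subseteq> set (winning vs es seps (Suc r))"
proof (induction r)
  case 0
  then show ?case by (simp add: winning_def)
next
  case (Suc r)
  then show ?case unfolding winning_Suc[of _ "Suc r"] by (subst winning_Suc)
      (auto dest: splits_mono)
qed

text \<open>The justification of an entry refers to the previous round; since the rounds are
  increasing, it also holds within the entry's own table.\<close>

lemma strategy_winning:
  assumes "\<And>l X. (l, X) \<in> set seps \<Longrightarrow> l \<subseteq> set es \<and> card l \<le> k \<and> X \<subseteq> \<Union>l"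
  shows "strategy k (winning vs es seps r)"
proof (cases r)
  case 0
  then show ?thesis by (simp add: winning_def strategy_def)
next
  case (Suc r')
  show ?thesis unfolding strategy_def
  proof (clarify)
    fix C l X assume t: "(C, l, X) \<in> set (winning vs es seps r)"
    then have 1: "splits vs es (winning vs es seps r') C X" "(C, l, X) \<in> set (moves vs es seps)"
      unfolding Suc winning_Suc by auto
    from splits_mono[OF 1(1) winning_mono] have 2: "splits vs es (winning vs es seps r) C X"
      by (simp add: Suc)
    from 1(2) have "C \<in> set (blocks vs es seps)" "(l, X) \<in> set seps" by (auto simp: moves_def)
    with assms block_subset[of C seps] reach_subset_vertices 2
    show "splits vs es (winning vs es seps r) C X \<and> C \<subseteq> set vs \<and> l \<subseteq> set es \<and> card l \<le> k \<and> X \<subseteq> \<Union>l"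
      by metis
  qed
qed

lemma lookup_mem:
  assumes "C \<in> set (map fst T)"
  shows "(C, lookup T C) \<in> set T"
proof -
  let ?F = "filter (\<lambda>t. fst t = C) T"
  have "?F \<noteq> []" using assms by (auto simp: filter_empty_conv)
  then have "hd (?F @ [(C, {}, {})]) \<in> set ?F" by (metis hd_append2 hd_in_set)
  then show ?thesis unfolding lookup_def by (simp, metis prod.collapse)
qed

definition bag :: "(nat \<times> 'a set \<times> 'a set set) list \<Rightarrow> nat \<Rightarrow> 'a set" where
  "bag os u = fst (snd (os ! u))"

text \<open>A vertex enters the decomposition at exactly one node, its top node; \<open>tops\<close> lists, for each
  emitted node, the vertices having it as their top node.\<close>

definition build_inv ::
  "nat \<Rightarrow> ('a set \<times> 'a set set \<times> 'a set) list \<Rightarrow> 'a build_state \<Rightarrow> 'a set list \<Rightarrow> bool" where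
  "build_inv k T s tops \<longleftrightarrow> (let q = fst s; os = snd s in
     length tops = length os \<and> os \<noteq> [] \<and>
     (\<forall>(p, C)\<in>set q. p < length os \<and> C \<in> set (map fst T) \<and>
        (\<forall>e\<in>set es. e \<inter> C \<noteq> {} \<longrightarrow> e - C \<subseteq> bag os p)) \<and>
     sorted_wrt disjnt (tops @ map snd q) \<and>
     (\<forall>u<length os. bag os u \<subseteq> set vs \<and> bag os u \<subseteq> \<Union>(snd (snd (os ! u))) \<and>
        snd (snd (os ! u)) \<subseteq> set es \<and> card (snd (snd (os ! u))) \<le> k) \<and>
     bag os 0 = {} \<and> (\<forall>u<length os. 0 < u \<longrightarrow> fst (os ! u) < u \<and> bag os u - tops ! u \<subseteq>
         bag os (fst (os ! u))) \<and>
     (\<forall>e\<in>set es. (\<exists>u<length os. e \<subseteq> bag os u) \<or> (\<exists>C\<in>snd ` set q. e \<inter> C \<noteq> {})))"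

text \<open>With nothing removed, an edge that meets a component lies inside it, so the empty root
  bag contains its boundary. No vertex has the root as its top node.\<close>

lemma build_inv_init:
  assumes "\<And>C. C \<in> set (components vs es {} (set vs)) \<Longrightarrow> C \<in> set (map fst T)"
  shows "build_inv k T (build_init vs es) [{}]"
proof -
  let ?cs = "components vs es {} (set vs)"
  have cs: "set ?cs = reach es {} ` set vs" using set_components[of "set vs" "{}"] by simp
  have 1: "e \<subseteq> C" if "e \<in> set es" "C \<in> set ?cs" "e \<inter> C \<noteq> {}" for e C
  proof -
    from that cs obtain v w where "C = reach es {} v" "w \<in> C" "w \<in> e" by blast
    with reach_edge[of w es "{}" v e] that(1) show ?thesis by simp
  qed
  have 2: "\<exists>C\<in>set ?cs. e \<inter> C \<noteq> {}" if "e \<in> set es" for e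
  proof -
    from edge_nonempty[OF that] edge_subset[OF that] obtain v where "v \<in> e" "v \<in> set vs" by blast
    with cs reach_refl[of v es "{}"] show ?thesis by blast
  qed
  have 3: "snd ` set (map (\<lambda>C. (0::nat, C)) ?cs) = set ?cs" by (simp add: image_image)
  have 4: "map snd (map (\<lambda>C. (0::nat, C)) ?cs) = ?cs" by (simp add: comp_def)
  show ?thesis
    unfolding build_inv_def build_init_def Let_def fst_conv snd_conv 3 4
    using assms 1 2 components_disjoint[of "set vs" "{}"]
    by (auto simp: bag_def disjnt_def; blast)
qed

text \<open>The new node is the top node of exactly the vertices in \<open>C \<inter> X\<close>. The
  other vertices of its bag lie outside \<open>C\<close> in edges that meet \<open>C\<close>, and
  the invariant for the queue places them in the bag of the parent.\<close>

lemma build_inv_step: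
  assumes T: "strategy k T" and inv: "build_inv k T ((p, C) # q, os) tops"
  defines "X \<equiv> snd (lookup T C)" and "l \<equiv> fst (lookup T C)"
  shows "build_inv k T (q @ map (\<lambda>C. (length os, C)) (components vs es X C),
      os @ [(p, X \<inter> neighbourhood es C, l)]) (tops @ [C \<inter> X])"
    and "(\<Sum>C\<leftarrow>components vs es X C. card C) < card C"
proof -
  let ?os = "os @ [(p, X \<inter> neighbourhood es C, l)]"
  let ?cs = "components vs es X C"
  note i1 = inv[unfolded build_inv_def Let_def fst_conv snd_conv]
  note i2 = i1[THEN conjunct2, THEN conjunct2]
  note i3 = i2[THEN conjunct2]
  note i4 = i3[THEN conjunct2]
  note i5 = i4[THEN conjunct2]
  note i6 = i5[THEN conjunct2]
  note len = i1[THEN conjunct1] and queue = i2[THEN conjunct1] and disj = i3[THEN conjunct1,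
      simplified]
    and nodes = i4[THEN conjunct1, rule_format] and root = i5[THEN conjunct1]
    and par = i6[THEN conjunct1, rule_format] and edges = i6[THEN conjunct2, rule_format]
  have p: "p < length os" and CT: "C \<in> set (map fst T)"
    and bagp: "\<And>e. e \<in> set es \<Longrightarrow> e \<inter> C \<noteq> {} \<Longrightarrow> e - C \<subseteq> bag os p"
    using bspec[OF queue, of "(p, C)"] by simp_all
  have q: "p' < length os \<and> D \<in> set (map fst T) \<and> (\<forall>e\<in>set es. e \<inter> D \<noteq> {} \<longrightarrow> e - D \<subseteq> bag os p')"
    if "(p', D) \<in> set q" for p' D
    using bspec[OF queue, of "(p', D)"] that by simp
  have "(C, l, X) \<in> set T" using lookup_mem[OF CT] by (simp add: X_def l_def)
  with T have sp: "splits vs es T C X" and C: "C \<subseteq> set vs" and l: "l \<subseteq> set es" "card l \<le> k" "X \<subseteq> \<Union>l"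
    unfolding strategy_def by auto
  from sp have CX: "C \<inter> X \<noteq> {}" and eCX: "\<forall>e\<in>set es. e \<inter> C \<noteq> {} \<longrightarrow> e \<subseteq> C \<union> X"
    and cT: "\<And>D. D \<in> set ?cs \<Longrightarrow> D \<in> set (map fst T)" unfolding splits_def by auto
  note cs = set_components[OF C, of X]
  have csub: "D \<subseteq> C - X" if "D \<in> set ?cs" for D
    using that reach_in_block[OF eCX] unfolding cs by auto
  have cdisj: "sorted_wrt disjnt ?cs" by (rule components_disjoint[OF C])
  have fin: "finite C" using C finite_subset by blast
  have "(\<Sum>C\<leftarrow>?cs. card C) \<le> card (C - X)"
    by (rule sum_card_disjoint) (use fin cdisj csub in auto)
  also have "card (C - X) < card C"
    using CX fin by (intro psubset_card_mono) auto
  finally show "(\<Sum>C\<leftarrow>?cs. card C) < card C" .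
  have oldbag: "bag ?os u = bag os u" if "u < length os" for u
    using that by (simp add: bag_def nth_append)
  have newbag: "bag ?os (length os) = X \<inter> neighbourhood es C" by (simp add: bag_def)
  \<comment> \<open>An edge that meets the component \<open>D\<close> leaves it only through
    \<open>X\<close>, and it also meets \<open>C\<close>; so the rest of the edge lies in the new
    bag.\<close>
  have cedge: "e - D \<subseteq> X \<inter> neighbourhood es C" if e: "e \<in> set es" "D \<in> set ?cs" "e \<inter> D \<noteq> {}" for e D
  proof -
    from e(2) obtain v where v: "v \<in> C - X" "D = reach es X v" unfolding cs by blast
    from e(3) obtain w where "w \<in> D" "w \<in> e" by blast
    with v reach_edge[of w es X v e] e(1) have "e - X \<subseteq> D" by simp
    moreover have "e \<inter> C \<noteq> {}" using csub[OF e(2)] e(3) by blast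
    then have "e \<subseteq> neighbourhood es C" unfolding neighbourhood_eq using e(1) by blast
    ultimately show ?thesis by blast
  qed
  have qs: "\<forall>(p', D)\<in>set (q @ map (\<lambda>C. (length os, C)) ?cs). p' < length ?os \<and> D \<in> set (map fst T) \<and>
        (\<forall>e\<in>set es. e \<inter> D \<noteq> {} \<longrightarrow> e - D \<subseteq> bag ?os p')"
  proof (clarify)
    fix p' D assume "(p', D) \<in> set (q @ map (\<lambda>C. (length os, C)) ?cs)"
    then consider "(p', D) \<in> set q" | "p' = length os" "D \<in> set ?cs" by auto
    then show "p' < length ?os \<and> D \<in> set (map fst T) \<and> (\<forall>e\<in>set es. e \<inter> D \<noteq> {} \<longrightarrow> e - D \<subseteq> bag ?os p')"
    proof cases
      case 1
      from q[OF this] oldbag[of p'] show ?thesis by simp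
    next
      case 2
      then show ?thesis using cT[OF 2(2)] cedge[OF _ 2(2)] newbag by simp
    qed
  qed
  \<comment> \<open>\<open>C\<close> is replaced by disjoint parts of itself:
    \<open>C \<inter> X\<close> among the tops, the components of \<open>C - X\<close> in the
    queue.\<close>
  have disj': "sorted_wrt disjnt ((tops @ [C \<inter> X]) @ map snd (q @ map (\<lambda>C. (length os, C)) ?cs))"
  proof -
    have dC: "disjnt A C" if "A \<in> set tops" for A using disj that by (auto simp: sorted_wrt_append)
    have dD: "disjnt C D" if "D \<in> snd ` set q" for D using disj that
        by (auto simp: sorted_wrt_append)
    have "map snd (map (\<lambda>C. (length os, C)) ?cs) = ?cs" by (simp add: comp_def)
    moreover have "disjnt A B" if "A \<in> set tops" "B \<in> set ?cs" for A B
      using dC[OF that(1)] csub[OF that(2)] by (auto simp: disjnt_def)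
    moreover have "disjnt A (C \<inter> X)" if "A \<in> set tops" for A
      using dC[OF that(1)] by (auto simp: disjnt_def)
    moreover have "disjnt (C \<inter> X) B" if "B \<in> set ?cs" for B
      using csub[OF that] by (auto simp: disjnt_def)
    moreover have "disjnt (C \<inter> X) (snd t)" if "t \<in> set q" for t
      using dD[of "snd t"] that by (auto simp: disjnt_def)
    moreover have "disjnt (snd t) B" if "t \<in> set q" "B \<in> set ?cs" for t B
      using dD[of "snd t"] csub[OF that(2)] that(1) by (auto simp: disjnt_def)
    ultimately show ?thesis using disj cdisj
      unfolding map_append by (simp add: sorted_wrt_append ball_Un)
  qed
  have nodes': "bag ?os u \<subseteq> set vs \<and> bag ?os u \<subseteq> \<Union>(snd (snd (?os ! u))) \<and>
        snd (snd (?os ! u)) \<subseteq> set es \<and> card (snd (snd (?os ! u))) \<le> k" if "u < length ?os" for u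
  proof (cases "u < length os")
    case True
    then show ?thesis using nodes[OF True] oldbag[OF True] by (simp add: nth_append)
  next
    case False
    with that have u: "u = length os" by simp
    have "neighbourhood es C \<subseteq> set vs" unfolding neighbourhood_eq using edge_subset by blast
    with u l show ?thesis unfolding u newbag by auto
  qed
  have par': "fst (?os ! u) < u \<and> bag ?os u - (tops @ [C \<inter> X]) ! u \<subseteq> bag ?os (fst (?os ! u))"
    if "u < length ?os" "0 < u" for u
  proof (cases "u < length os")
    case True
    from par[OF True that(2)] have "fst (os ! u) < length os" using True by simp
    with par[OF True that(2)] show ?thesis using oldbag True len by (simp add: nth_append)
  next
    case False
    with that have u: "u = length os" by simp
    have "X \<inter> neighbourhood es C - C \<inter> X \<subseteq> bag os p"
      using bagp unfolding neighbourhood_eq by blast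
    moreover have "(tops @ [C \<inter> X]) ! length os = C \<inter> X" using len by (metis nth_append_length)
    ultimately show ?thesis using u p newbag oldbag[OF p] by simp
  qed
  have edges': "(\<exists>u<length ?os. e \<subseteq> bag ?os u) \<or>
      (\<exists>D\<in>snd ` set (q @ map (\<lambda>C. (length os, C)) ?cs). e \<inter> D \<noteq> {})" if e: "e \<in> set es" for e
  proof -
    consider u where "u < length os" "e \<subseteq> bag os u" | "e \<inter> C \<noteq> {}" | "\<exists>D\<in>snd ` set q. e \<inter> D \<noteq> {}"
      using edges[OF e] by (simp, blast)
    then show ?thesis
    proof cases
      case 1
      then have "u < length ?os \<and> e \<subseteq> bag ?os u" using oldbag by simp
      then show ?thesis by blast
    next
      case 2
      show ?thesis
      proof (cases "e \<subseteq> X")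
        case True
        moreover have "e \<subseteq> neighbourhood es C" unfolding neighbourhood_eq using e 2 by blast
        ultimately have "length os < length ?os \<and> e \<subseteq> bag ?os (length os)" using newbag by simp
        then show ?thesis by blast
      next
        case False
        \<comment> \<open>Such a vertex lies in \<open>C\<close>, so the edge is still pending in
          one of the new blocks.\<close>
        then obtain v where v: "v \<in> e" "v \<notin> X" by blast
        with eCX e 2 have "v \<in> C - X" by blast
        then have "reach es X v \<in> set ?cs" "v \<in> e \<inter> reach es X v"
          unfolding cs using v reach_refl[of v es X] by auto
        then have "\<exists>D\<in>set ?cs. e \<inter> D \<noteq> {}" by blast
        then show ?thesis by (simp add: image_Un image_image) blast
      qed
    next
      case 3
      then show ?thesis by (auto simp: image_Un)
    qed
  qed
  have root': "bag ?os 0 = {}" using root p oldbag[of 0] by (cases os) auto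
  show "build_inv k T (q @ map (\<lambda>C. (length os, C)) ?cs, ?os) (tops @ [C \<inter> X])"
    unfolding build_inv_def Let_def fst_conv snd_conv
    using len qs disj' nodes' root' par' edges' by simp
qed

section \<open>Termination of the construction\<close>

definition potential :: "'a build_state \<Rightarrow> nat" where
  "potential s = (\<Sum>t\<leftarrow>fst s. card (snd t))"

lemma build_step_Cons: "build_step vs es T ((p, C) # q, os) =
   (q @ map (\<lambda>D. (length os, D)) (components vs es (snd (lookup T C)) C),
    os @ [(p, snd (lookup T C) \<inter> neighbourhood es C, fst (lookup T C))])"
  by (simp add: build_step_def)

lemma build_inv_iterate:
  assumes T: "strategy k T" and inv: "build_inv k T s tops"
  shows "\<exists>tops. build_inv k T ((build_step vs es T ^^ i) s) tops \<and>
    (fst ((build_step vs es T ^^ i) s) = [] \<or> potential ((build_step vs es T ^^ i) s) + i \<le>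
        potential s)"
proof (induction i)
  case 0
  then show ?case using inv by auto
next
  case (Suc i)
  let ?s = "(build_step vs es T ^^ i) s"
  from Suc obtain tops where 1: "build_inv k T ?s tops" "fst ?s = [] \<or> potential ?s + i \<le>
      potential s"
    by blast
  show ?case
  proof (cases "fst ?s")
    case Nil
    then have "build_step vs es T ?s = ?s" by (simp add: build_step_def)
    then show ?thesis using Nil 1 by auto
  next
    case (Cons a q)
    obtain p C where "a = (p, C)" by fastforce
    with Cons have s: "?s = ((p, C) # q, snd ?s)" by (metis prod.collapse)
    let ?X = "snd (lookup T C)" and ?l = "fst (lookup T C)"
    have step: "build_step vs es T ?s = (q @ map (\<lambda>C. (length (snd ?s), C)) (components vs es ?X C),
      snd ?s @ [(p, ?X \<inter> neighbourhood es C, ?l)])"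
      using build_step_Cons[of T p C q "snd ?s"] by (simp only: s[symmetric])
    note 2 = build_inv_step[OF T, of p C q "snd ?s" tops, folded s, OF 1(1)]
    have "potential (build_step vs es T ?s) < potential ?s"
      using 2(2) Cons \<open>a = (p, C)\<close> unfolding step by (simp add: potential_def comp_def)
    with 1(2) Cons have "potential (build_step vs es T ?s) + Suc i \<le> potential s" by simp
    moreover have "build_inv k T (build_step vs es T ?s) (tops @ [C \<inter> ?X])"
      using 2(1) unfolding step .
    ultimately show ?thesis by auto
  qed
qed

text \<open>If the queue were non-empty after \<open>length vs\<close> steps, the potential would be
  0 and only empty blocks would remain, whereas every block of the table meets its
  separator.\<close>

lemma build_complete:
  assumes T: "strategy k T"
    and init: "\<And>C. C \<in> set (components vs es {} (set vs)) \<Longrightarrow> C \<in> set (map fst T)"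
  obtains tops where "build_inv k T ([], build vs es T) tops"
proof -
  let ?s = "(build_step vs es T ^^ length vs) (build_init vs es)"
  from build_inv_iterate[OF T build_inv_init[OF init], of "length vs"] obtain tops where
    inv: "build_inv k T ?s tops" and
    pot: "fst ?s = [] \<or> potential ?s + length vs \<le> potential (build_init vs es)" by blast
  have "fst ?s = []"
  proof (rule ccontr)
    assume ne: "fst ?s \<noteq> []"
    have "(\<Sum>C\<leftarrow>components vs es {} (set vs). card C) \<le> card (set vs)"
    proof (rule sum_card_disjoint)
      show "sorted_wrt disjnt (components vs es {} (set vs))" by (rule components_disjoint) simp
      show "C \<subseteq> set vs" if "C \<in> set (components vs es {} (set vs))" for C
        using that reach_subset_vertices[of _ "{}"] by (auto simp: set_components)
    qed simp
    then have "potential (build_init vs es) \<le> card (set vs)"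
      unfolding potential_def build_init_def by (simp add: comp_def)
    with pot ne have "potential ?s = 0" using distinct_card[OF distinct_vs] by simp
    obtain p C where pC: "(p, C) \<in> set (fst ?s)" using ne by (cases "fst ?s") auto
    with \<open>potential ?s = 0\<close> have "card C = 0" unfolding potential_def by force
    have "C \<in> set (map fst T)"
      using bspec[OF inv[unfolded build_inv_def Let_def, THEN conjunct2, THEN conjunct2,
          THEN conjunct1] pC] by simp
    from lookup_mem[OF this] obtain l X where "(C, l, X) \<in> set T" by (metis prod.collapse)
    from bspec[OF T[unfolded strategy_def] this] have "C \<inter> X \<noteq> {}" "C \<subseteq> set vs"
      by (simp_all add: splits_def)
    with \<open>card C = 0\<close> show False by (metis List.finite_set card_0_eq finite_subset inf_bot_left)
  qed
  then have "?s = ([], build vs es T)" unfolding build_def by (metis prod.collapse)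
  with inv that show thesis by simp
qed

lemma card_ones:
  assumes "finite E" "l \<subseteq> E"
  shows "(\<Sum>e\<in>E. if e \<in> l then 1 else 0) = card l"
  using assms by (simp add: sum.If_cases Int_absorb1)

text \<open>Occurrences of a vertex are connected: climbing from any of them stays among them until
  the top node, and this node is unique because the \<open>tops\<close> are disjoint.\<close>

theorem build_sound:
  assumes T: "strategy k T"
    and init: "\<And>C. C \<in> set (components vs es {} (set vs)) \<Longrightarrow> C \<in> set (map fst T)"
  defines "os \<equiv> build vs es T"
  defines "Tr \<equiv> \<lparr>nodes = {..<length os}, tree_root = 0, parent = (\<lambda>u. fst (os ! u))\<rparr>"
    and "L \<equiv> (\<lambda>u e. if e \<in> snd (snd (os ! u)) then 1 else 0)"
  shows "is_ghd (presented (vs, es)) Tr (bag os) L" "ghd_width (presented (vs, es)) Tr L \<le> k"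
proof -
  from build_complete[OF T init] obtain tops where inv: "build_inv k T ([], os) tops"
    unfolding os_def by blast
  have len: "length tops = length os" and ne: "os \<noteq> []" and disj: "sorted_wrt disjnt tops"
    and nodes: "\<And>u. u < length os \<Longrightarrow> bag os u \<subseteq> set vs \<and> bag os u \<subseteq> \<Union>(snd (snd (os ! u))) \<and>
        snd (snd (os ! u)) \<subseteq> set es \<and> card (snd (snd (os ! u))) \<le> k"
    and root: "bag os 0 = {}"
    and par: "\<And>u. u < length os \<Longrightarrow> 0 < u \<Longrightarrow> fst (os ! u) < u \<and> bag os u - tops ! u \<subseteq>
        bag os (fst (os ! u))"
    and edges: "\<And>e. e \<in> set es \<Longrightarrow> \<exists>u<length os. e \<subseteq> bag os u"
    using inv unfolding build_inv_def Let_def by simp_all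
  have "0 < length os" using ne by simp
  have [simp]: "nodes Tr = {..<length os}" "tree_root Tr = 0" "parent Tr u = fst (os ! u)" for u
    by (simp_all add: Tr_def)
  have [simp]: "verts (presented (vs, es)) = set vs" "edges (presented (vs, es)) = set es"
      by simp_all
  \<comment> \<open>Parents have smaller numbers, so climbing ends at node 0.\<close>
  have "\<exists>i. (parent Tr ^^ i) u = 0" if "u < length os" for u
    using that
  proof (induction u rule: less_induct)
    case (less u)
    show ?case
    proof (cases "u = 0")
      case True
      then show ?thesis by (metis funpow_0)
    next
      case False
      with less par[of u] obtain i where "(parent Tr ^^ i) (parent Tr u) = 0" by fastforce
      then have "(parent Tr ^^ Suc i) u = 0" by (simp add: funpow_swap1)
      then show ?thesis by blast
    qed
  qed
  then have "is_rtree Tr" unfolding is_rtree_def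
    using \<open>0 < length os\<close> par by (auto simp del: funpow.simps intro: less_trans)
  have connected: "connected_in Tr {u \<in> nodes Tr. v \<in> bag os u}" for v
  proof -
    let ?S = "{u \<in> nodes Tr. v \<in> bag os u}"
    let ?R = "tree_adj Tr \<inter> ?S \<times> ?S"
    have "sym ?R" by (auto simp: sym_def tree_adj_def)
    have top: "\<exists>t\<in>?S. v \<in> tops ! t \<and> (u, t) \<in> ?R\<^sup>*" if "u \<in> ?S" for u
      using that
    proof (induction u rule: less_induct)
      case (less u)
      show ?case
      proof (cases "v \<in> tops ! u")
        case True
        then show ?thesis using less.prems by blast
      next
        case False
        \<comment> \<open>The root bag is empty, so \<open>u\<close> has a parent.\<close>
        have "u \<noteq> 0" using less.prems root by (metis (mono_tags) empty_iff mem_Collect_eq)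
        let ?p = "fst (os ! u)"
        have p: "?p < u" "?p \<in> ?S" using par[of u] \<open>u \<noteq> 0\<close> less.prems False by auto
        from less.IH[OF p] obtain t where t: "t \<in> ?S" "v \<in> tops ! t" "(?p, t) \<in> ?R\<^sup>*" by blast
        have "(u, ?p) \<in> tree_adj Tr" using less.prems \<open>u \<noteq> 0\<close> by (auto simp: tree_adj_def)
        with p less.prems have "(u, ?p) \<in> ?R" by blast
        with t show ?thesis by (meson converse_rtrancl_into_rtrancl)
      qed
    qed
    have unique: "t = t'" if "t \<in> ?S" "t' \<in> ?S" "v \<in> tops ! t" "v \<in> tops ! t'" for t t'
    proof (rule ccontr)
      assume "t \<noteq> t'"
      with that len disj have "disjnt (tops ! t) (tops ! t') \<or> disjnt (tops ! t') (tops ! t)"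
        by (auto simp: sorted_wrt_iff_nth_less nat_neq_iff)
      with that show False by (auto simp: disjnt_def)
    qed
    have "(u, w) \<in> ?R\<^sup>*" if "u \<in> ?S" "w \<in> ?S" for u w
    proof -
      from top[OF that(1)] top[OF that(2)] obtain t t' where
        t: "t \<in> ?S" "v \<in> tops ! t" "(u, t) \<in> ?R\<^sup>*" and t': "t' \<in> ?S" "v \<in> tops ! t'"
            "(w, t') \<in> ?R\<^sup>*"
        by blast
      have "t = t'" using unique t t' by blast
      moreover have "(t', w) \<in> ?R\<^sup>*" using sym_rtrancl[OF \<open>sym ?R\<close>] t'(3) by (rule symD)
      ultimately show ?thesis using rtrancl_trans[OF t(3)] by simp
    qed
    then show ?thesis unfolding connected_in_def by blast
  qed
  have w: "weight (presented (vs, es)) (L u) \<le> k" if "u < length os" for u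
    using nodes[OF that] card_ones[of "set es" "snd (snd (os ! u))"] by (simp add: weight_def L_def)
  have cov: "bag os u \<subseteq> covered (presented (vs, es)) (L u)" if u: "u < length os" for u
  proof
    fix v assume v: "v \<in> bag os u"
    with nodes[OF u] obtain e where e: "e \<in> snd (snd (os ! u))" "v \<in> e" "e \<in> set es" by blast
    have "L u e \<le> (\<Sum>e\<in>{e \<in> set es. v \<in> e}. L u e)" by (rule member_le_sum) (use e in auto)
    moreover have "L u e = 1" using e by (simp add: L_def)
    ultimately show "v \<in> covered (presented (vs, es)) (L u)"
      using v nodes[OF u] by (auto simp: covered_def)
  qed
  show "is_ghd (presented (vs, es)) Tr (bag os) L"
    unfolding is_ghd_def is_tree_decomp_def
  proof (intro conjI ballI)
    show "\<exists>u\<in>nodes Tr. e \<subseteq> bag os u" if "e \<in> edges (presented (vs, es))" for e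
      using edges[of e] that by auto
  qed (use \<open>is_rtree Tr\<close> nodes connected cov in \<open>simp_all add: L_def\<close>)
  show "ghd_width (presented (vs, es)) Tr L \<le> k"
    unfolding ghd_width_def using w \<open>0 < length os\<close> by (subst Max_le_iff) auto
qed

end

section \<open>Subtrees of a rooted tree\<close>

locale rooted_tree =
  fixes T :: "'n rtree"
  assumes rtree: "is_rtree T"
begin

definition depth :: "'n \<Rightarrow> nat" where
  "depth u = (LEAST i. (parent T ^^ i) u = tree_root T)"

lemma finite_nodes: "finite (nodes T)"
  and parent_node: "u \<in> nodes T \<Longrightarrow> u \<noteq> tree_root T \<Longrightarrow> parent T u \<in> nodes T"
  and reaches_root: "u \<in> nodes T \<Longrightarrow> \<exists>i. (parent T ^^ i) u = tree_root T"
  using rtree unfolding is_rtree_def by auto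

lemma depth_root: "depth (tree_root T) = 0"
  unfolding depth_def by (rule Least_eq_0) simp

lemma depth_parent:
  assumes "u \<in> nodes T" "u \<noteq> tree_root T"
  shows "depth u = Suc (depth (parent T u))"
proof -
  from reaches_root[OF assms(1)] obtain i where i: "(parent T ^^ i) u = tree_root T" ..
  have "(LEAST i. (parent T ^^ i) u = tree_root T) = Suc (LEAST i. (parent T ^^ Suc i) u =
      tree_root T)"
    by (rule Least_Suc[of _ i]) (use i assms(2) in auto)
  then show ?thesis unfolding depth_def by (simp add: funpow_swap1)
qed

lemma ancestor:
  assumes "x \<in> nodes T" "n \<le> depth x"
  shows "(parent T ^^ n) x \<in> nodes T \<and> depth ((parent T ^^ n) x) = depth x - n"
  using assms(2)
proof (induction n)
  case (Suc n)
  let ?y = "(parent T ^^ n) x"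
  from Suc have y: "?y \<in> nodes T" "depth ?y = depth x - n" by auto
  with Suc.prems have "?y \<noteq> tree_root T" using depth_root by (metis Suc_diff_le diff_Suc_Suc
      nat.distinct(1))
  with y parent_node[of ?y] depth_parent[of ?y] show ?case by simp
qed (use assms in simp)

lemma sym_tree_adj: "sym (tree_adj T \<inter> S \<times> S)"
  by (auto simp: sym_def tree_adj_def)

lemma ancestor_path:
  assumes "x \<in> nodes T" "n \<le> depth x" "\<And>i. i \<le> n \<Longrightarrow> (parent T ^^ i) x \<in> Q"
  shows "(x, (parent T ^^ n) x) \<in> (tree_adj T \<inter> Q \<times> Q)\<^sup>*"
  using assms(2,3)
proof (induction n)
  case (Suc n)
  let ?y = "(parent T ^^ n) x"
  have y: "?y \<in> nodes T" "depth ?y = depth x - n" using ancestor[OF assms(1), of n] Suc.prems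
      by auto
  with Suc.prems(1) have "?y \<noteq> tree_root T" using depth_root by (metis Suc_diff_le diff_Suc_Suc
      nat.distinct(1))
  then have "(?y, parent T ?y) \<in> tree_adj T" using y by (auto simp: tree_adj_def)
  moreover have "?y \<in> Q" "parent T ?y \<in> Q" using Suc.prems(2)[of n] Suc.prems(2)[of "Suc n"] by auto
  moreover have "(x, ?y) \<in> (tree_adj T \<inter> Q \<times> Q)\<^sup>*" by (rule Suc.IH) (use Suc.prems in auto)
  ultimately show ?case by (auto intro: rtrancl_into_rtrancl)
qed simp

text \<open>A connected set is a subtree with a highest node; this form replaces undirected paths by
  chains of ancestors.\<close>

definition is_top :: "'n set \<Rightarrow> 'n \<Rightarrow> bool" where
  "is_top S t \<longleftrightarrow> t \<in> S \<and> (\<forall>x\<in>S. depth t \<le> depth x \<and> (parent T ^^ (depth x - depth t)) x = t \<and>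
     (\<forall>i\<le>depth x - depth t. (parent T ^^ i) x \<in> S))"

text \<open>Take a node \<open>t\<close> of least depth and follow a path in \<open>S\<close> from
  \<open>t\<close>: by induction, climbing from each node on it reaches \<open>t\<close> inside
  \<open>S\<close>, as no step of the path can pass above \<open>t\<close>.\<close>

lemma connected_top:
  assumes "connected_in T S" "S \<noteq> {}"
  shows "\<exists>t. is_top S t"
proof -
  from assms(2) obtain t where t: "t \<in> S" "\<And>x. x \<in> S \<Longrightarrow> depth t \<le> depth x"
    using ex_has_least_nat[of "\<lambda>x. x \<in> S" _ depth] by blast
  have "depth t \<le> depth x \<and> (parent T ^^ (depth x - depth t)) x = t \<and>
     (\<forall>i\<le>depth x - depth t. (parent T ^^ i) x \<in> S)" if "x \<in> S" for x
  proof -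
    have "(t, x) \<in> (tree_adj T \<inter> S \<times> S)\<^sup>*" using assms(1) t(1) that unfolding connected_in_def
        by blast
    then have "\<exists>i. depth x = depth t + i \<and> (parent T ^^ i) x = t \<and> (\<forall>j\<le>i. (parent T ^^ j) x \<in> S)"
    proof (induction rule: rtrancl_induct)
      case base
      show ?case by (rule exI[of _ 0]) (use t in auto)
    next
      case (step y z)
      from step.IH obtain i where i: "depth y = depth t + i" "(parent T ^^ i) y = t"
          "\<forall>j\<le>i. (parent T ^^ j) y \<in> S"
        by blast
      from step.hyps(2) have S: "y \<in> S" "z \<in> S" by auto
      from step.hyps(2) consider "y \<in> nodes T - {tree_root T}" "z = parent T y" |
          "z \<in> nodes T - {tree_root T}" "y = parent T z"
        by (auto simp: tree_adj_def)
      then show ?case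
      proof cases
        case 1
        then have d: "depth y = Suc (depth z)" using depth_parent by simp
        \<comment> \<open>An upward step from \<open>t\<close> itself would lead to a node of
          \<open>S\<close> of smaller depth; so \<open>i\<close> is positive.\<close>
        with t(2)[OF S(2)] i(1) obtain i' where i': "i = Suc i'" by (cases i) auto
        have "(parent T ^^ j) z = (parent T ^^ Suc j) y" for j using 1 by (simp add: funpow_swap1)
        with i d show ?thesis unfolding i' by (intro exI[of _ i']) auto
      next
        case 2
        then have d: "depth z = Suc (depth y)" using depth_parent by simp
        have eq: "(parent T ^^ Suc j) z = (parent T ^^ j) y" for j using 2
            by (simp add: funpow_swap1)
        have "(parent T ^^ j) z \<in> S" if "j \<le> Suc i" for j
        proof (cases j)
          case (Suc j')
          with that i(3) eq[of j'] show ?thesis by simp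
        qed (use S in simp)
        with i d eq[of i] show ?thesis by (intro exI[of _ "Suc i"]) auto
      qed
    qed
    then show ?thesis using t(2)[OF that] by auto
  qed
  with t(1) show ?thesis unfolding is_top_def by blast
qed

text \<open>The deepest of the tops, that of \<open>S0\<close>, is common to all: a set
  \<open>S\<close> shares a node \<open>x\<close> with \<open>S0\<close>, and the chain from
  \<open>x\<close> up to that top is no longer than the chain inside \<open>S\<close> up to the top
  of \<open>S\<close>. The second conclusion makes \<open>t\<close> the top of the
  intersection.\<close>

lemma helly:
  assumes "finite \<F>" "\<F> \<noteq> {}" "\<And>S. S \<in> \<F> \<Longrightarrow> connected_in T S"
    and meet: "\<And>S S'. S \<in> \<F> \<Longrightarrow> S' \<in> \<F> \<Longrightarrow> S \<inter> S' \<noteq> {}"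
  obtains t where "t \<in> \<Inter>\<F>"
    and "\<And>x S. x \<in> \<Inter>\<F> \<Longrightarrow> depth t \<le> depth x \<and> (parent T ^^ (depth x - depth t)) x = t \<and>
      (\<forall>i\<le>depth x - depth t. (parent T ^^ i) x \<in> \<Inter>\<F>)"
proof -
  have "\<exists>t. is_top S t" if "S \<in> \<F>" for S
    using connected_top[of S] assms(3)[OF that] meet[OF that that] by blast
  then obtain top where top: "\<And>S. S \<in> \<F> \<Longrightarrow> is_top S (top S)" by metis
  obtain S0 where S0: "S0 \<in> \<F>" "\<And>S. S \<in> \<F> \<Longrightarrow> depth (top S) \<le> depth (top S0)"
  proof -
    let ?D = "(\<lambda>S. depth (top S)) ` \<F>"
    have "finite ?D" "?D \<noteq> {}" using assms(1,2) by auto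
    from Max_in[OF this] obtain S0 where "S0 \<in> \<F>" "Max ?D = depth (top S0)" by auto
    with Max_ge[OF \<open>finite ?D\<close>] that[of S0] show thesis by (metis image_eqI)
  qed
  let ?t = "top S0"
  have chain: "(parent T ^^ i) x \<in> S" if "S \<in> \<F>" "x \<in> S" "i \<le> depth x - depth ?t" for S x i
  proof -
    have "i \<le> depth x - depth (top S)" using S0(2)[OF that(1)] that(3) by simp
    with top[OF that(1)] that(2) show ?thesis unfolding is_top_def by blast
  qed
  have t0: "depth ?t \<le> depth x" "(parent T ^^ (depth x - depth ?t)) x = ?t" if "x \<in> S0" for x
    using top[OF S0(1)] that unfolding is_top_def by blast+
  have "?t \<in> S" if "S \<in> \<F>" for S
  proof -
    from meet[OF S0(1) that] obtain x where x: "x \<in> S0" "x \<in> S" by blast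
    from chain[OF that x(2) order_refl] t0[OF x(1)] show ?thesis by simp
  qed
  moreover have "depth ?t \<le> depth x \<and> (parent T ^^ (depth x - depth ?t)) x = ?t \<and>
      (\<forall>i\<le>depth x - depth ?t. (parent T ^^ i) x \<in> \<Inter>\<F>)" if "x \<in> \<Inter>\<F>" for x
    using t0[of x] chain[of _ x] that S0(1) by blast
  ultimately show thesis using that by blast
qed

lemma connected_inI:
  assumes "S \<subseteq> nodes T" "\<And>x. x \<in> S \<Longrightarrow> (x, t) \<in> (tree_adj T \<inter> S \<times> S)\<^sup>*"
  shows "connected_in T S"
  unfolding connected_in_def
proof (intro conjI ballI)
  fix u w assume "u \<in> S" "w \<in> S"
  from assms(2)[OF this(2)] have "(t, w) \<in> (tree_adj T \<inter> S \<times> S)\<^sup>*"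
    using sym_rtrancl[OF sym_tree_adj[of S]] by (auto dest: symD)
  with assms(2)[OF \<open>u \<in> S\<close>] show "(u, w) \<in> (tree_adj T \<inter> S \<times> S)\<^sup>*" by (rule rtrancl_trans)
qed (rule assms(1))

lemma connected_Inter:
  assumes "finite \<F>" "\<F> \<noteq> {}" "\<And>S. S \<in> \<F> \<Longrightarrow> connected_in T S" "u \<in> \<Inter>\<F>"
  shows "connected_in T (\<Inter>\<F>)"
proof -
  have "S \<inter> S' \<noteq> {}" if "S \<in> \<F>" "S' \<in> \<F>" for S S' using assms(4) that by blast
  from helly[OF assms(1-3) this] obtain t where t: "t \<in> \<Inter>\<F>"
    "\<And>x. x \<in> \<Inter>\<F> \<Longrightarrow> depth t \<le> depth x \<and> (parent T ^^ (depth x - depth t)) x = t \<and>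
      (\<forall>i\<le>depth x - depth t. (parent T ^^ i) x \<in> \<Inter>\<F>)" by metis
  have sub: "\<Inter>\<F> \<subseteq> nodes T" using assms(2,3) unfolding connected_in_def by blast
  show ?thesis
  proof (rule connected_inI[OF sub])
    fix x assume x: "x \<in> \<Inter>\<F>"
    have "(x, (parent T ^^ (depth x - depth t)) x) \<in> (tree_adj T \<inter> \<Inter>\<F> \<times> \<Inter>\<F>)\<^sup>*"
      by (rule ancestor_path) (use sub x t(2)[OF x] in auto)
    then show "(x, t) \<in> (tree_adj T \<inter> \<Inter>\<F> \<times> \<Inter>\<F>)\<^sup>*" using t(2)[OF x] by simp
  qed
qed

lemma connected_nodes: "connected_in T (nodes T)"
proof (rule connected_inI[OF order_refl])
  fix x assume x: "x \<in> nodes T"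
  have "(x, (parent T ^^ depth x) x) \<in> (tree_adj T \<inter> nodes T \<times> nodes T)\<^sup>*"
    by (rule ancestor_path[OF x order_refl]) (use ancestor[OF x] in blast)
  moreover have "(parent T ^^ depth x) x = tree_root T"
    unfolding depth_def using LeastI_ex[OF reaches_root[OF x]] .
  ultimately show "(x, tree_root T) \<in> (tree_adj T \<inter> nodes T \<times> nodes T)\<^sup>*" by simp
qed

lemma connected_path_mono:
  assumes "connected_in T S" "x \<in> S" "y \<in> S" "S \<subseteq> S'"
  shows "(x, y) \<in> (tree_adj T \<inter> S' \<times> S')\<^sup>*"
  using assms unfolding connected_in_def by (meson Int_mono Sigma_mono order_refl rtrancl_mono
      subsetD)

lemma connected_Un:
  assumes "connected_in T S" "connected_in T S'" "t \<in> S" "t \<in> S'"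
  shows "connected_in T (S \<union> S')"
proof (rule connected_inI)
  show "S \<union> S' \<subseteq> nodes T" using assms unfolding connected_in_def by blast
  show "(x, t) \<in> (tree_adj T \<inter> (S \<union> S') \<times> (S \<union> S'))\<^sup>*" if "x \<in> S \<union> S'" for x
    using that connected_path_mono[OF assms(1) _ assms(3)] connected_path_mono[OF assms(2) _
        assms(4)] by blast
qed

text \<open>Subtrees that meet along every step of \<open>r\<close> join to one subtree. It is
  applied to the occurrences of the vertices of a component.\<close>

lemma connected_UN_reachable:
  assumes conn: "\<And>v. v \<in> r\<^sup>* `` {v0} \<Longrightarrow> connected_in T (S v)"
    and meet: "\<And>v w. v \<in> r\<^sup>* `` {v0} \<Longrightarrow> (v, w) \<in> r \<Longrightarrow> S v \<inter> S w \<noteq> {}"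
    and t: "t \<in> S v0"
  shows "connected_in T (\<Union>v\<in>r\<^sup>* `` {v0}. S v)" (is "connected_in T ?U")
proof (rule connected_inI)
  show "?U \<subseteq> nodes T" using conn unfolding connected_in_def by blast
  fix x assume "x \<in> ?U"
  then obtain v where "(v0, v) \<in> r\<^sup>*" "x \<in> S v" by blast
  then show "(x, t) \<in> (tree_adj T \<inter> ?U \<times> ?U)\<^sup>*"
  proof (induction arbitrary: x rule: rtrancl_induct)
    case base
    have "S v0 \<subseteq> ?U" by blast
    with connected_path_mono[OF conn base t] show ?case by blast
  next
    case (step v w)
    from step.hyps meet[of v w] obtain y where y: "y \<in> S v" "y \<in> S w" by blast
    have w: "w \<in> r\<^sup>* `` {v0}" using step.hyps by (auto intro: rtrancl_into_rtrancl)
    then have "S w \<subseteq> ?U" by blast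
    from connected_path_mono[OF conn[OF w] step.prems y(2) this] step.IH[OF y(1)]
    show ?case by (rule rtrancl_trans)
  qed
qed

end

section \<open>Separators\<close>

text \<open>A set of \<open>i\<close> edges is listed once for each order of choosing them, which
  does no harm for constant \<open>i\<close>. The filter makes the edges distinct, as in the
  multi-intersection width.\<close>

primrec inters :: "'a list \<Rightarrow> 'a set list \<Rightarrow> nat \<Rightarrow> ('a set set \<times> 'a set) list" where
  "inters vs es 0 = [({}, set vs)]"
| "inters vs es (Suc i) = concat (map (\<lambda>p. map (\<lambda>e. (insert e (fst p), snd p \<inter> e))
     (filter (\<lambda>e. e \<notin> fst p) es)) (inters vs es i))"

primrec unions :: "'a set list \<Rightarrow> nat \<Rightarrow> ('a set set \<times> 'a set) list" where
  "unions es 0 = [({}, {})]"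
| "unions es (Suc i) = unions es i @
     concat (map (\<lambda>p. map (\<lambda>e. (insert e (fst p), snd p \<union> e)) es) (unions es i))"

text \<open>The recursion is on the vertex list, since \<open>X\<close> itself has no order that a
  program could follow; only members of \<open>X\<close> double the list.\<close>

primrec subsets :: "'a list \<Rightarrow> 'a set \<Rightarrow> 'a set list" where
  "subsets [] X = [{}]"
| "subsets (u # us) X = subsets us X @ (if u \<in> X then map (insert u) (subsets us X) else [])"

primrec small_inters :: "'a list \<Rightarrow> 'a set list \<Rightarrow> nat \<Rightarrow> 'a set list" where
  "small_inters vs es 0 = []"
| "small_inters vs es (Suc i) = small_inters vs es i @ map snd (inters vs es i)"

definition basics :: "'a list \<Rightarrow> 'a set list \<Rightarrow> nat \<Rightarrow> 'a set list" where
  "basics vs es c = small_inters vs es c @ concat (map (\<lambda>p. subsets vs (snd p)) (inters vs es c))"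

primrec joins :: "'a set list \<Rightarrow> nat \<Rightarrow> 'a set list" where
  "joins bs 0 = [{}]"
| "joins bs (Suc i) = joins bs i @ concat (map (\<lambda>x. map (\<lambda>b. x \<union> b) bs) (joins bs i))"

text \<open>Cutting each candidate down to the union of a chosen cover makes every entry legal by
  construction. A bag survives this when paired with its own cover.\<close>

definition separators :: "'a list \<Rightarrow> 'a set list \<Rightarrow> nat \<Rightarrow> nat \<Rightarrow> ('a set set \<times> 'a set) list" where
  "separators vs es c k = concat (map (\<lambda>p. map (\<lambda>x. (fst p, snd p \<inter> x))
     (joins (basics vs es c) (k ^ c))) (unions es k))"

section \<open>Contents of the candidate lists\<close>

lemma set_subsets: "set (subsets us X) = {Y. Y \<subseteq> X \<inter> set us}"
proof (induction us)
  case (Cons u us)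
  show ?case
  proof (cases "u \<in> X")
    case True
    have "{Y. Y \<subseteq> X \<inter> set (u # us)} = {Y. Y \<subseteq> insert u (X \<inter> set us)}" using True by auto
    also have "\<dots> = Pow (X \<inter> set us) \<union> insert u ` Pow (X \<inter> set us)"
        by (simp add: Pow_insert flip: Pow_def)
    finally show ?thesis using True Cons by (auto simp: Pow_def)
  qed (use Cons in auto)
qed simp

lemma unions_sound: "(l, r) \<in> set (unions es i) \<Longrightarrow> l \<subseteq> set es \<and> card l \<le> i \<and> r = \<Union>l"
proof (induction i arbitrary: l r)
  case (Suc i)
  then show ?case
  proof (cases "(l, r) \<in> set (unions es i)")
    case False
    with Suc.prems obtain l' r' e where e: "(l', r') \<in> set (unions es i)" "e \<in> set es"
      "l = insert e l'" "r = r' \<union> e" by auto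
    from Suc.IH[OF e(1)] e finite_subset[of l' "set es"] show ?thesis
      by (auto simp: card_insert_if)
  qed fastforce
qed simp

lemma unions_complete:
  "finite l \<Longrightarrow> l \<subseteq> set es \<Longrightarrow> card l \<le> i \<Longrightarrow> (l, \<Union>l) \<in> set (unions es i)"
proof (induction i arbitrary: l)
  case (Suc i)
  show ?case
  proof (cases "card l \<le> i")
    case False
    then obtain e l' where l: "l = insert e l'" "e \<notin> l'" using Suc.prems
        by (metis card_eq_SucD le_Suc_eq)
    then have "(l', \<Union>l') \<in> set (unions es i)" using Suc by auto
    moreover have "e \<in> set es" using Suc.prems l by blast
    ultimately have "(insert e l', \<Union>l' \<union> e) \<in> set (unions es (Suc i))"
      by (auto intro!: bexI[of _ "(l', \<Union>l')"])
    then show ?thesis unfolding l by (simp add: Un_commute)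
  qed (use Suc in auto)
qed simp

lemma inters_sound: "(l, r) \<in> set (inters vs es i) \<Longrightarrow> l \<subseteq> set es \<and> card l = i \<and> r = set vs \<inter> \<Inter>l"
proof (induction i arbitrary: l r)
  case (Suc i)
  then obtain l' r' e where e: "(l', r') \<in> set (inters vs es i)" "e \<in> set es" "e \<notin> l'"
      "l = insert e l'" "r = r' \<inter> e" by auto
  from Suc.IH[OF e(1)] e finite_subset[of l' "set es"] show ?case by auto
qed simp

lemma inters_complete:
  "finite l \<Longrightarrow> l \<subseteq> set es \<Longrightarrow> card l = i \<Longrightarrow> (l, set vs \<inter> \<Inter>l) \<in> set (inters vs es i)"
proof (induction i arbitrary: l)
  case (Suc i)
  then obtain e l' where l: "l = insert e l'" "e \<notin> l'" by (metis card_eq_SucD)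
  then have "(l', set vs \<inter> \<Inter>l') \<in> set (inters vs es i)" using Suc by auto
  moreover have "e \<in> set es" using Suc.prems l by blast
  ultimately have "(insert e l', set vs \<inter> \<Inter>l' \<inter> e) \<in> set (inters vs es (Suc i))"
    using l(2) by (auto intro!: bexI[of _ "(l', set vs \<inter> \<Inter>l')"])
  moreover have "set vs \<inter> \<Inter>l' \<inter> e = set vs \<inter> \<Inter>(insert e l')" by auto
  ultimately show ?case unfolding l by simp
qed simp

lemma small_inters_complete:
  "finite l \<Longrightarrow> l \<subseteq> set es \<Longrightarrow> card l < c \<Longrightarrow> set vs \<inter> \<Inter>l \<in> set (small_inters vs es c)"
proof (induction c)
  case (Suc c)
  show ?case
  proof (cases "card l = c")
    case True
    from imageI[OF inters_complete[OF Suc.prems(1,2) this, of vs], of snd] show ?thesis by simp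
  next
    case False
    with Suc show ?thesis by simp
  qed
qed simp

lemma joins_complete:
  "finite \<G> \<Longrightarrow> \<G> \<subseteq> set bs \<Longrightarrow> card \<G> \<le> i \<Longrightarrow> \<Union>\<G> \<in> set (joins bs i)"
proof (induction i arbitrary: \<G>)
  case (Suc i)
  show ?case
  proof (cases "card \<G> \<le> i")
    case False
    then obtain b \<G>' where g: "\<G> = insert b \<G>'" "b \<notin> \<G>'" using Suc.prems
        by (metis card_eq_SucD le_Suc_eq)
    then have "\<Union>\<G>' \<in> set (joins bs i)" using Suc by auto
    then have "\<Union>\<G>' \<union> b \<in> set (joins bs (Suc i))" using Suc.prems g by auto
    then show ?thesis unfolding g by (simp add: Un_commute)
  qed (use Suc in auto)
qed simp

lemma separators_sound:
  "(l, X) \<in> set (separators vs es c k) \<Longrightarrow> l \<subseteq> set es \<and> card l \<le> k \<and> X \<subseteq> \<Union>l"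
  unfolding separators_def using unions_sound by fastforce

lemma separatorsI:
  assumes "(l, r) \<in> set (unions es k)" "x \<in> set (joins (basics vs es c) (k ^ c))"
  shows "(l, r \<inter> x) \<in> set (separators vs es c k)"
  using assms unfolding separators_def by (auto intro!: bexI[of _ "(l, r)"])

text \<open>The empty separator puts the components of the whole hypergraph among the
  blocks.\<close>

lemma empty_separator: "({}, {}) \<in> set (separators vs es c k)"
proof -
  have "({}, {}) \<in> set (unions es k)" using unions_complete[of "{}" es k] by simp
  moreover have "{} \<in> set (joins (basics vs es c) (k ^ c))" using joins_complete[of "{}"
      "basics vs es c"] by simp
  ultimately show ?thesis using separatorsI[of "{}" "{}" es k "{}" vs c] by simp
qed

text \<open>Distributing an intersection of unions over the edges, one union at a time, and only as long
  as fewer than \<open>c\<close> edges have been collected.\<close>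

lemma inter_of_unions:
  assumes p: "finite p" "p \<subseteq> set es" "card p \<le> c" and "k \<ge> 1"
    and \<Lambda>: "\<And>l. l \<in> \<Lambda> \<Longrightarrow> finite l \<and> l \<subseteq> set es \<and> card l \<le> k"
  shows "\<exists>\<G>. finite \<G> \<and> \<G> \<subseteq> set (basics vs es c) \<and> card \<G> \<le> k ^ (c - card p) \<and>
     \<Union>\<G> = set vs \<inter> \<Inter>p \<inter> (\<Inter>l\<in>\<Lambda>. \<Union>l)"
  using p
proof (induction "c - card p" arbitrary: p)
  case 0
  then have "card p = c" by simp
  let ?Y = "set vs \<inter> \<Inter>p \<inter> (\<Inter>l\<in>\<Lambda>. \<Union>l)"
  \<comment> \<open>With \<open>c\<close> edges collected, whatever the remaining unions cut out is
    a subset of their intersection.\<close>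
  have "?Y \<in> set (subsets vs (set vs \<inter> \<Inter>p))" unfolding set_subsets by blast
  then have "?Y \<in> set (basics vs es c)"
    using inters_complete[OF 0(2,3) \<open>card p = c\<close>, of vs] unfolding basics_def by force
  then show ?case by (intro exI[of _ "{?Y}"]) (use \<open>card p = c\<close> in simp)
next
  case (Suc d)
  then have lt: "card p < c" by simp
  show ?case
  proof (cases "\<forall>l\<in>\<Lambda>. l \<inter> p \<noteq> {}")
    case True
    \<comment> \<open>Every union already contains a collected edge and hence the whole
      intersection, so nothing is left to distribute.\<close>
    then have "\<Inter>p \<subseteq> \<Union>l" if "l \<in> \<Lambda>" for l using that by blast
    then have "\<Inter>p \<subseteq> (\<Inter>l\<in>\<Lambda>. \<Union>l)" by (rule INT_greatest)
    then have "set vs \<inter> \<Inter>p \<inter> (\<Inter>l\<in>\<Lambda>. \<Union>l) = set vs \<inter> \<Inter>p" by blast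
    moreover have "set vs \<inter> \<Inter>p \<in> set (basics vs es c)"
      using small_inters_complete[OF Suc.prems(1,2) lt] unfolding basics_def by simp
    ultimately show ?thesis using \<open>k \<ge> 1\<close> by (intro exI[of _ "{set vs \<inter> \<Inter>p}"]) simp
  next
    case False
    \<comment> \<open>Choosing a union disjoint from \<open>p\<close> guarantees that each of its
      edges is new, so that distributing over it raises the number of collected edges.\<close>
    then obtain l where l: "l \<in> \<Lambda>" "l \<inter> p = {}" by blast
    let ?Z = "\<lambda>p. set vs \<inter> \<Inter>p \<inter> (\<Inter>l\<in>\<Lambda>. \<Union>l)"
    have "\<forall>e\<in>l. \<exists>\<G>. finite \<G> \<and> \<G> \<subseteq> set (basics vs es c) \<and> card \<G> \<le> k ^ d \<and> \<Union>\<G> = ?Z (insert e p)"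
    proof
      fix e assume e: "e \<in> l"
      with l Suc.prems have "card (insert e p) = Suc (card p)" by (subst card_insert_disjoint) auto
      moreover have "d = c - Suc (card p)" using Suc.hyps(2) by simp
      moreover have "finite (insert e p)" "insert e p \<subseteq> set es" using Suc.prems \<Lambda>[OF l(1)] e by auto
      ultimately show "\<exists>\<G>. finite \<G> \<and> \<G> \<subseteq> set (basics vs es c) \<and> card \<G> \<le> k ^ d \<and> \<Union>\<G> =
          ?Z (insert e p)"
        using Suc.hyps(1)[of "insert e p"] lt by simp
    qed
    then obtain G where G: "\<And>e. e \<in> l \<Longrightarrow> finite (G e) \<and> G e \<subseteq> set (basics vs es c) \<and>
        card (G e) \<le> k ^ d \<and> \<Union>(G e) = ?Z (insert e p)" by metis
    have "card (\<Union>e\<in>l. G e) \<le> (\<Sum>e\<in>l. card (G e))" using \<Lambda>[OF l(1)] by (intro card_UN_le) auto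
    also have "\<dots> \<le> (\<Sum>e\<in>l. k ^ d)" by (rule sum_mono) (use G in blast)
    also have "\<dots> \<le> k * k ^ d" using \<Lambda>[OF l(1)] by simp
    also have "\<dots> = k ^ (c - card p)" using Suc.hyps(2) by (metis power_Suc)
    finally have "card (\<Union>e\<in>l. G e) \<le> k ^ (c - card p)" .
    moreover have "\<Union>(\<Union>e\<in>l. G e) = ?Z p"
    proof -
      have "\<Union>(\<Union>e\<in>l. G e) = (\<Union>e\<in>l. \<Union>(G e))" by blast
      also have "\<dots> = (\<Union>e\<in>l. ?Z (insert e p))" using G by simp
      also have "\<dots> = ?Z p" using l(1) by blast
      finally show ?thesis .
    qed
    moreover have "finite (\<Union>e\<in>l. G e)" "(\<Union>e\<in>l. G e) \<subseteq> set (basics vs es c)"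
      using G \<Lambda>[OF l(1)] by blast+
    ultimately show ?thesis by blast
  qed
qed

section \<open>Bags of a decomposition suffice as separators\<close>

locale list_decomp = hypergraph_lists vs es for vs :: "'a list" and es +
  fixes T :: "'n rtree" and B :: "'n \<Rightarrow> 'a set"
  assumes decomp: "is_tree_decomp (presented (vs, es)) T B"

sublocale list_decomp \<subseteq> rooted_tree T
  using decomp unfolding is_tree_decomp_def by unfold_locales blast

context list_decomp
begin

definition occ :: "'a \<Rightarrow> 'n set" where
  "occ v = {u \<in> nodes T. v \<in> B u}"

lemma bag_vertices: "u \<in> nodes T \<Longrightarrow> B u \<subseteq> set vs"
  and edge_bag: "e \<in> set es \<Longrightarrow> \<exists>u\<in>nodes T. e \<subseteq> B u"
  and occ_connected: "v \<in> set vs \<Longrightarrow> connected_in T (occ v)"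
  using decomp unfolding is_tree_decomp_def occ_def by auto

text \<open>Helly's theorem for the subtrees of the boundary vertices of the component and the subtree of
  the nodes whose bags meet it.\<close>

lemma splitting_node:
  assumes v: "v \<in> set vs - X" and X: "X = {} \<or> (\<exists>u\<in>nodes T. X = B u)"
  obtains w where "w \<in> nodes T" "reach es X v \<inter> B w \<noteq> {}"
    "\<And>e. e \<in> set es \<Longrightarrow> e \<inter> reach es X v \<noteq> {} \<Longrightarrow> e \<subseteq> reach es X v \<union> B w"
proof -
  let ?C = "reach es X v"
  let ?U = "\<Union>x\<in>?C. occ x"
  define N where "N = {x. x \<notin> ?C \<and> (\<exists>e\<in>set es. e \<inter> ?C \<noteq> {} \<and> x \<in> e)}"
  have C: "?C \<subseteq> set vs" using reach_subset_vertices[OF v] .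
  have N: "N \<subseteq> set vs" "N \<subseteq> X"
  proof -
    show "N \<subseteq> set vs" using edge_subset unfolding N_def by blast
    show "N \<subseteq> X"
    proof
      fix x assume "x \<in> N"
      then obtain e y where e: "x \<notin> ?C" "e \<in> set es" "y \<in> e" "y \<in> ?C" "x \<in> e" unfolding N_def
          by blast
      have "e - X \<subseteq> ?C" by (rule reach_edge[OF e(4) _ e(2,3)]) (use v in simp)
      with e show "x \<in> X" by blast
    qed
  qed
  have ne: "occ x \<noteq> {}" if "x \<in> set vs" for x
  proof -
    from vertex_covered[OF that] obtain e where e: "e \<in> set es" "x \<in> e" ..
    with edge_bag[OF e(1)] show ?thesis unfolding occ_def by blast
  qed
  have U: "connected_in T ?U"
  proof -
    obtain t where t: "t \<in> occ v" using ne[of v] v by blast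
    show ?thesis unfolding reach_def
    proof (rule connected_UN_reachable[where S = occ, OF _ _ t])
      show "connected_in T (occ x)" if "x \<in> (adj es X)\<^sup>* `` {v}" for x
        using occ_connected C that unfolding reach_def by blast
      show "occ x \<inter> occ y \<noteq> {}" if "(x, y) \<in> adj es X" for x y
      proof -
        from that obtain e where "e \<in> set es" "x \<in> e" "y \<in> e" unfolding adj_def by blast
        with edge_bag[of e] show ?thesis unfolding occ_def by blast
      qed
    qed
  qed
  let ?F = "insert ?U (occ ` N)"
  \<comment> \<open>\<open>N\<close> lies in \<open>X\<close>, which is a single bag unless
    \<open>N\<close> is empty.\<close>
  have NN: "occ x \<inter> occ y \<noteq> {}" if "x \<in> N" "y \<in> N" for x y
    using X N(2) that unfolding occ_def by blast
  have UN: "?U \<inter> occ x \<noteq> {}" if x: "x \<in> N" for x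
  proof -
    from x obtain e y where e: "e \<in> set es" "y \<in> e" "y \<in> ?C" "x \<in> e" unfolding N_def by blast
    with edge_bag[OF e(1)] show ?thesis unfolding occ_def by blast
  qed
  have UU: "?U \<noteq> {}" using ne[of v] v reach_refl[of v es X] by blast
  have "S \<inter> S' \<noteq> {}" if "S \<in> ?F" "S' \<in> ?F" for S S'
    using that NN UN UU by (auto simp: Int_commute)
  moreover have "connected_in T S" if "S \<in> ?F" for S
    using that U N(1) occ_connected by blast
  moreover have "finite ?F" using finite_subset[OF N(1)] by simp
  ultimately obtain t where t: "t \<in> \<Inter>?F" using helly[of ?F] by (metis insert_not_empty)
  then have "t \<in> ?U" by blast
  then have "t \<in> nodes T" "?C \<inter> B t \<noteq> {}" unfolding occ_def by blast+
  moreover have "e \<subseteq> ?C \<union> B t" if "e \<in> set es" "e \<inter> ?C \<noteq> {}" for e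
  proof
    fix x assume "x \<in> e"
    show "x \<in> ?C \<union> B t"
    proof (cases "x \<in> ?C")
      case False
      with that \<open>x \<in> e\<close> have "x \<in> N" unfolding N_def by blast
      with t show ?thesis unfolding occ_def by blast
    qed blast
  qed
  ultimately show thesis by (rule that)
qed

text \<open>The new blocks are strictly smaller and again components of the complement of a bag, so
  the induction on \<open>r\<close> applies to them with that bag as \<open>X\<close>. Quantifying
  over all bags, instead of following the tree, is what closes the induction.\<close>

lemma winning_complete:
  assumes seps: "\<And>u. u \<in> nodes T \<Longrightarrow> B u \<in> snd ` set seps" "{} \<in> snd ` set seps"
    and v: "v \<in> set vs - X" and X: "X = {} \<or> (\<exists>u\<in>nodes T. X = B u)"
    and r: "card (reach es X v) \<le> r"
  shows "reach es X v \<in> set (map fst (winning vs es seps r))"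
  using v X r
proof (induction r arbitrary: v X)
  case 0
  \<comment> \<open>A component contains its starting vertex, so its cardinality cannot be
    0.\<close>
  have "finite (reach es X v)" using finite_subset[OF reach_subset_vertices[OF 0(1)]] by simp
  with 0 reach_refl[of v es X] show ?case by auto
next
  case (Suc r)
  let ?C = "reach es X v"
  have C: "?C \<subseteq> set vs" by (rule reach_subset_vertices[OF Suc.prems(1)])
  then have fin: "finite ?C" using finite_subset by blast
  obtain w where w: "w \<in> nodes T" "?C \<inter> B w \<noteq> {}"
    "\<And>e. e \<in> set es \<Longrightarrow> e \<inter> ?C \<noteq> {} \<Longrightarrow> e \<subseteq> ?C \<union> B w"
    using splitting_node[OF Suc.prems(1,2)] by metis
  have eC: "\<forall>e\<in>set es. e \<inter> ?C \<noteq> {} \<longrightarrow> e \<subseteq> ?C \<union> B w" using w(3) by blast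
  have "D \<in> set (map fst (winning vs es seps r))" if D: "D \<in> set (components vs es (B w) ?C)" for D
  proof -
    from D obtain x where x: "x \<in> ?C - B w" "D = reach es (B w) x" unfolding set_components[OF C]
        by blast
    have "D \<subset> ?C" using reach_in_block[OF eC x(1)] x(2) w(2) by blast
    from psubset_card_mono[OF fin this] Suc.prems(3) have "card D \<le> r" by linarith
    then show ?thesis using Suc.IH[of x "B w"] x C w(1) by blast
  qed
  with w have "splits vs es (winning vs es seps r) ?C (B w)" unfolding splits_def by blast
  moreover obtain l where l: "(l, B w) \<in> set seps" using seps(1)[OF w(1)] by force
  moreover have "?C \<in> set (blocks vs es seps)"
  proof -
    have "X \<in> snd ` set seps" using Suc.prems(2) seps by blast
    then obtain p where p: "p \<in> set seps" "X = snd p" by blast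
    have "?C \<in> set (components vs es X (set vs))" using set_components[of "set vs" X] Suc.prems(1)
        by blast
    with p show ?thesis unfolding blocks_def by auto
  qed
  ultimately have "(?C, l, B w) \<in> set (winning vs es seps (Suc r))"
    unfolding winning_Suc moves_def by auto
  then show ?case by force
qed

end

section \<open>Decompositions with maximal bags\<close>

lemma in_covered_iff:
  assumes "finite (edges H)"
  shows "v \<in> covered H l \<longleftrightarrow> v \<in> verts H \<and> (\<exists>e\<in>edges H. v \<in> e \<and> l e \<ge> 1)"
proof -
  have "finite {e \<in> edges H. v \<in> e}" using assms by simp
  then have "(\<Sum>e\<in>{e \<in> edges H. v \<in> e}. l e) = 0 \<longleftrightarrow> (\<forall>e\<in>{e \<in> edges H. v \<in> e}. l e = 0)"
    by (rule sum_eq_0_iff)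
  then have "1 \<le> (\<Sum>e\<in>{e \<in> edges H. v \<in> e}. l e) \<longleftrightarrow> \<not> (\<forall>e\<in>{e \<in> edges H. v \<in> e}. l e = 0)"
    by linarith
  also have "\<dots> \<longleftrightarrow> (\<exists>e\<in>edges H. v \<in> e \<and> l e \<ge> 1)" by (auto simp: Suc_le_eq)
  finally show ?thesis unfolding covered_def by blast
qed

text \<open>Tree and edge functions stay fixed, so passing to maximal bags does not affect the
  width. A maximum exists because the total bag size is at most the number of nodes times the number
  of vertices.\<close>

definition max_ghd ::
  "'a hypergraph \<Rightarrow> 'n rtree \<Rightarrow> ('n \<Rightarrow> 'a set) \<Rightarrow> ('n \<Rightarrow> 'a set \<Rightarrow> nat) \<Rightarrow> bool" where
  "max_ghd H T B L \<longleftrightarrow> is_ghd H T B L \<and>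
     (\<forall>B'. is_ghd H T B' L \<longrightarrow> (\<Sum>u\<in>nodes T. card (B' u)) \<le> (\<Sum>u\<in>nodes T. card (B u)))"

lemma ex_max_ghd:
  assumes "finite (verts H)" "is_ghd H T B L"
  shows "\<exists>B. max_ghd H T B L"
proof -
  let ?f = "\<lambda>B. \<Sum>u\<in>nodes T. card (B u)"
  have "?f B' < Suc (\<Sum>u\<in>nodes T. card (verts H))" if "is_ghd H T B' L" for B'
  proof -
    have "B' u \<subseteq> verts H" if "u \<in> nodes T" for u
      using \<open>is_ghd H T B' L\<close> that unfolding is_ghd_def is_tree_decomp_def by blast
    then have "?f B' \<le> (\<Sum>u\<in>nodes T. card (verts H))" by (intro sum_mono card_mono assms(1))
    then show ?thesis by (rule le_imp_less_Suc)
  qed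
  then obtain B' where "is_ghd H T B' L" "\<And>B''. is_ghd H T B'' L \<Longrightarrow> ?f B'' \<le> ?f B'"
    using ex_has_greatest_nat[of "\<lambda>B. is_ghd H T B L" B ?f] assms(2) by blast
  then show ?thesis unfolding max_ghd_def by blast
qed

locale max_list_ghd = hypergraph_lists vs es for vs :: "'a list" and es +
  fixes T :: "'n rtree" and B :: "'n \<Rightarrow> 'a set" and L :: "'n \<Rightarrow> 'a set \<Rightarrow> nat"
  assumes max_ghd: "max_ghd (presented (vs, es)) T B L"

sublocale max_list_ghd \<subseteq> list_decomp vs es T B
  using max_ghd unfolding max_ghd_def is_ghd_def by unfold_locales blast

context max_list_ghd
begin

definition cover :: "'n \<Rightarrow> 'a set set" where
  "cover u = {e \<in> set es. L u e = 1}"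

lemma covered_eq:
  assumes "u \<in> nodes T"
  shows "covered (presented (vs, es)) (L u) = \<Union>(cover u)"
proof -
  have "L u e \<ge> 1 \<longleftrightarrow> L u e = 1" if "e \<in> set es" for e
    using max_ghd assms that unfolding max_ghd_def is_ghd_def by fastforce
  then have "v \<in> covered (presented (vs, es)) (L u) \<longleftrightarrow> v \<in> set vs \<and> v \<in> \<Union>(cover u)" for v
    by (subst in_covered_iff) (auto simp: cover_def)
  moreover have "\<Union>(cover u) \<subseteq> set vs" using edge_subset unfolding cover_def by blast
  ultimately show ?thesis by blast
qed

lemma bag_covered: "u \<in> nodes T \<Longrightarrow> B u \<subseteq> \<Union>(cover u)"
  using max_ghd covered_eq unfolding max_ghd_def is_ghd_def by blast

text \<open>\<open>Q\<close> is the set of nodes whose bags contain \<open>e \<inter> B u\<close>.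
  It contains \<open>u\<close> and, since \<open>e\<close> is an edge, a node \<open>t\<close> whose
  bag contains all of \<open>e\<close>. A vertex of \<open>e\<close> that is covered throughout
  \<open>Q\<close> can be added to all bags of \<open>Q\<close>: its subtree stays connected because
  it already meets \<open>Q\<close> in \<open>t\<close>. By maximality the vertex was in
  \<open>B u\<close> before.\<close>

lemma edge_inter_bag:
  assumes u: "u \<in> nodes T" and e: "e \<in> cover u"
  shows "\<exists>Q \<subseteq> nodes T. e \<inter> B u = e \<inter> (\<Inter>q\<in>Q. \<Union>(cover q))"
proof -
  \<comment> \<open>\<open>nodes T\<close> keeps the intersection inside the tree when
    \<open>e \<inter> B u\<close> is empty.\<close>
  let ?F = "insert (nodes T) (occ ` (e \<inter> B u))"
  let ?Q = "\<Inter>?F"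
  have e_es: "e \<in> set es" using e unfolding cover_def by blast
  have uQ: "u \<in> ?Q" using u unfolding occ_def by blast
  from edge_bag[OF e_es] obtain t where t: "t \<in> nodes T" "e \<subseteq> B t" by blast
  have tQ: "t \<in> ?Q" using t unfolding occ_def by blast
  have Q: "?Q \<subseteq> nodes T" by blast
  have fin: "finite (e \<inter> B u)" using edge_subset[OF e_es] finite_subset by blast
  have conn: "connected_in T ?Q"
  proof (rule connected_Inter[OF _ _ _ uQ])
    show "connected_in T S" if "S \<in> ?F" for S
      using that connected_nodes occ_connected edge_subset[OF e_es] by blast
  qed (use fin in auto)
  have "e \<inter> B u = e \<inter> (\<Inter>q\<in>?Q. \<Union>(cover q))"
  proof
    show "e \<inter> B u \<subseteq> e \<inter> (\<Inter>q\<in>?Q. \<Union>(cover q))"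
    proof
      fix v assume v: "v \<in> e \<inter> B u"
      have "v \<in> \<Union>(cover q)" if q: "q \<in> ?Q" for q
      proof -
        have "q \<in> occ v" using q v by blast
        then show ?thesis using bag_covered[of q] unfolding occ_def by blast
      qed
      with v show "v \<in> e \<inter> (\<Inter>q\<in>?Q. \<Union>(cover q))" by blast
    qed
    show "e \<inter> (\<Inter>q\<in>?Q. \<Union>(cover q)) \<subseteq> e \<inter> B u"
    proof (rule ccontr)
      assume "\<not> ?thesis"
      then obtain v where ve: "v \<in> e" "v \<notin> B u" "v \<in> (\<Inter>q\<in>?Q. \<Union>(cover q))" by blast
      from ve(3) have "v \<in> \<Union>(cover q)" if "q \<in> ?Q" for q using that by (rule INT_D)
      note v = ve(1,2) this
      have v_vs: "v \<in> set vs" using v(1) edge_subset[OF e_es] by blast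
      define B' where "B' q = (if q \<in> ?Q then insert v (B q) else B q)" for q
      have BB': "B q \<subseteq> B' q" for q unfolding B'_def by auto
      have bv: "B' q \<subseteq> set vs" if "q \<in> nodes T" for q
        using bag_vertices[OF that] v_vs unfolding B'_def by auto
      have "{q \<in> nodes T. v \<in> B' q} = occ v \<union> ?Q"
        unfolding B'_def occ_def using Q by auto
      moreover have "connected_in T (occ v \<union> ?Q)"
        by (rule connected_Un[OF occ_connected[OF v_vs] conn _ tQ])
            (use t v(1) in \<open>auto simp: occ_def\<close>)
      ultimately have cv: "connected_in T {q \<in> nodes T. v \<in> B' q}" by simp
      have "connected_in T {q \<in> nodes T. x \<in> B' q}" if "x \<in> set vs" for x
      proof (cases "x = v")
        case False
        then have "{q \<in> nodes T. x \<in> B' q} = occ x" unfolding B'_def occ_def by auto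
        then show ?thesis using occ_connected[OF that] by simp
      qed (use cv in simp)
      moreover have "\<exists>q\<in>nodes T. f \<subseteq> B' q" if "f \<in> set es" for f
        using edge_bag[OF that] BB' by blast
      ultimately have td: "is_tree_decomp (presented (vs, es)) T B'"
        unfolding is_tree_decomp_def using rtree bv by simp
      have "B' q \<subseteq> covered (presented (vs, es)) (L q)" if "q \<in> nodes T" for q
        unfolding covered_eq[OF that] B'_def using bag_covered[OF that] v(3) by auto
      with td max_ghd have "is_ghd (presented (vs, es)) T B' L"
        unfolding max_ghd_def is_ghd_def by blast
      with max_ghd have le: "(\<Sum>q\<in>nodes T. card (B' q)) \<le> (\<Sum>q\<in>nodes T. card (B q))"
        unfolding max_ghd_def by blast
      have finB: "finite (B' q)" if "q \<in> nodes T" for q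
        using bv[OF that] finite_subset by blast
      have "(\<Sum>q\<in>nodes T. card (B q)) < (\<Sum>q\<in>nodes T. card (B' q))"
      proof (rule sum_strict_mono_ex1[OF finite_nodes])
        show "\<forall>q\<in>nodes T. card (B q) \<le> card (B' q)" using BB' finB by (simp add: card_mono)
        have "B u \<subset> B' u" using v(2) uQ unfolding B'_def by auto
        then show "\<exists>q\<in>nodes T. card (B q) < card (B' q)"
          using psubset_card_mono[OF finB[OF u]] u by blast
      qed
      with le show False by simp
    qed
  qed
  then show ?thesis using Q by blast
qed

text \<open>Each of the at most \<open>k\<close> edges of the cover contributes at most
  \<open>k ^ (c - 1)\<close> basic sets. Together they make up the bag because the edges cover
  it.\<close>

lemma bag_in_separators:
  assumes k: "k \<ge> 1" "c \<ge> 1" and width: "\<And>u. u \<in> nodes T \<Longrightarrow> weight (presented (vs, es)) (L u) \<le> k"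
    and u: "u \<in> nodes T"
  shows "B u \<in> snd ` set (separators vs es c k)"
proof -
  have cover: "finite (cover q) \<and> cover q \<subseteq> set es \<and> card (cover q) \<le> k" if q: "q \<in> nodes T" for q
  proof -
    have "card (cover q) = (\<Sum>e\<in>cover q. L q e)" by (simp add: cover_def)
    also have "\<dots> \<le> (\<Sum>e\<in>set es. L q e)" by (rule sum_mono2) (auto simp: cover_def)
    also have "\<dots> \<le> k" using width[OF q] by (simp add: weight_def)
    finally show ?thesis by (auto simp: cover_def)
  qed
  have "\<forall>e\<in>cover u. \<exists>\<G>. finite \<G> \<and> \<G> \<subseteq> set (basics vs es c) \<and> card \<G> \<le> k ^ (c - 1) \<and> \<Union>\<G> = e \<inter> B u"
  proof
    fix e assume e: "e \<in> cover u"
    from edge_inter_bag[OF u e] obtain Q where Q: "Q \<subseteq> nodes T" "e \<inter> B u = e \<inter> (\<Inter>q\<in>Q. \<Union>(cover q))"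
      by blast
    have e_es: "e \<in> set es" using e unfolding cover_def by blast
    \<comment> \<open>The distribution starts with \<open>e\<close> collected, hence the exponent
      \<open>c - 1\<close>.\<close>
    have "\<exists>\<G>. finite \<G> \<and> \<G> \<subseteq> set (basics vs es c) \<and> card \<G> \<le> k ^ (c - card {e}) \<and>
        \<Union>\<G> = set vs \<inter> \<Inter>{e} \<inter> (\<Inter>l\<in>cover ` Q. \<Union>l)"
    proof (rule inter_of_unions)
      show "finite l \<and> l \<subseteq> set es \<and> card l \<le> k" if "l \<in> cover ` Q" for l
        using that cover Q(1) by blast
    qed (use e_es k in auto)
    moreover have "set vs \<inter> \<Inter>{e} \<inter> (\<Inter>l\<in>cover ` Q. \<Union>l) = e \<inter> B u"
      unfolding Q(2) using edge_subset[OF e_es] by auto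
    ultimately show "\<exists>\<G>. finite \<G> \<and> \<G> \<subseteq> set (basics vs es c) \<and> card \<G> \<le> k ^ (c - 1) \<and> \<Union>\<G> = e \<inter> B u"
      by simp
  qed
  then obtain G where G: "\<And>e. e \<in> cover u \<Longrightarrow> finite (G e) \<and> G e \<subseteq> set (basics vs es c) \<and>
      card (G e) \<le> k ^ (c - 1) \<and> \<Union>(G e) = e \<inter> B u" by metis
  have "card (\<Union>e\<in>cover u. G e) \<le> (\<Sum>e\<in>cover u. card (G e))" using cover[OF u] by (intro card_UN_le)
      auto
  also have "\<dots> \<le> (\<Sum>e\<in>cover u. k ^ (c - 1))" by (rule sum_mono) (use G in blast)
  also have "\<dots> \<le> k * k ^ (c - 1)" using cover[OF u] by simp
  also have "\<dots> = k ^ c" using k(2) by (metis Suc_diff_1 less_le_trans power_Suc zero_less_one)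
  finally have "card (\<Union>e\<in>cover u. G e) \<le> k ^ c" .
  moreover have "\<Union>(\<Union>e\<in>cover u. G e) = B u"
  proof -
    have "\<Union>(\<Union>e\<in>cover u. G e) = (\<Union>e\<in>cover u. \<Union>(G e))" by blast
    also have "\<dots> = (\<Union>e\<in>cover u. e \<inter> B u)" using G by simp
    also have "\<dots> = B u" using bag_covered[OF u] by blast
    finally show ?thesis .
  qed
  moreover have "finite (\<Union>e\<in>cover u. G e)" "(\<Union>e\<in>cover u. G e) \<subseteq> set (basics vs es c)"
    using G cover[OF u] by blast+
  ultimately have "B u \<in> set (joins (basics vs es c) (k ^ c))"
    using joins_complete[of "\<Union>e\<in>cover u. G e" "basics vs es c" "k ^ c"] by simp
  with unions_complete[of "cover u" es k] cover[OF u]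
  have "(cover u, \<Union>(cover u) \<inter> B u) \<in> set (separators vs es c k)" by (intro separatorsI) auto
  moreover have "\<Union>(cover u) \<inter> B u = B u" using bag_covered[OF u] by blast
  ultimately show ?thesis by (metis imageI snd_conv)
qed

end

section \<open>Correctness of the answer\<close>

definition cvec :: "'x list \<Rightarrow> 'x set \<Rightarrow> data" where
  "cvec us X = elist (\<lambda>u. enc_bool (u \<in> X)) us"

text \<open>\<open>enc_bool\<close> agrees with \<open>enc_nat\<close> on 0 and 1, so the
  characteristic vector of a cover has the form that \<open>enc_ghd\<close> prescribes for the edge
  function.\<close>

definition enc_node :: "'a list \<Rightarrow> 'a set list \<Rightarrow> nat \<times> 'a set \<times> 'a set set \<Rightarrow> data" where
  "enc_node vs es t = Pair (enc_nat (fst t)) (Pair (cvec vs (fst (snd t))) (cvec es (snd (snd t))))"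

definition solvable :: "'a list \<Rightarrow> 'a set list \<Rightarrow> ('a set \<times> 'a set set \<times> 'a set) list \<Rightarrow> bool" where
  "solvable vs es T \<longleftrightarrow> (\<forall>C\<in>set (components vs es {} (set vs)). C \<in> set (map fst T))"

text \<open>The leading \<open>Atom\<close> is the unary code of the root, node 0.\<close>

definition answer :: "'a list \<Rightarrow> 'a set list \<Rightarrow> ('a set \<times> 'a set set \<times> 'a set) list \<Rightarrow> data" where
  "answer vs es T = (if solvable vs es T then Pair Atom (elist (enc_node vs es) (build vs es T))
      else Atom)"

context hypergraph_lists
begin

text \<open>A single node with all vertices and all edges. It guarantees that the least width
  defining \<open>ghw\<close> is attained.\<close>

lemma ex_ghd: "\<exists>(T :: nat rtree) B L. is_ghd (presented (vs, es)) T B L"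
proof -
  let ?T = "\<lparr>nodes = {0}, tree_root = 0, parent = (\<lambda>_. 0)\<rparr> :: nat rtree"
  have "is_rtree ?T" unfolding is_rtree_def by (auto intro: exI[of _ 0])
  moreover have "connected_in ?T {0}"
    unfolding connected_in_def by auto
  moreover have "set vs \<subseteq> covered (presented (vs, es)) (\<lambda>_. 1)"
    using vertex_covered by (auto simp: in_covered_iff)
  ultimately have "is_ghd (presented (vs, es)) ?T (\<lambda>_. set vs) (\<lambda>_ _. 1)"
    unfolding is_ghd_def is_tree_decomp_def using edge_subset by simp
  then show ?thesis by blast
qed

lemma ghw_le_iff:
  "ghw (presented (vs, es)) \<le> k \<longleftrightarrow> (\<exists>(T :: nat rtree) B L.
     is_ghd (presented (vs, es)) T B L \<and> ghd_width (presented (vs, es)) T L \<le> k)"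
proof
  let ?P = "\<lambda>w. \<exists>(T :: nat rtree) B L. is_ghd (presented (vs, es)) T B L \<and>
      ghd_width (presented (vs, es)) T L = w"
  assume "ghw (presented (vs, es)) \<le> k"
  moreover have "?P (ghw (presented (vs, es)))"
    unfolding ghw_def by (rule LeastI_ex) (use ex_ghd in blast)
  ultimately show "\<exists>(T :: nat rtree) B L. is_ghd (presented (vs, es)) T B L \<and>
      ghd_width (presented (vs, es)) T L \<le> k"
    by (metis (no_types, lifting))
next
  assume "\<exists>(T :: nat rtree) B L. is_ghd (presented (vs, es)) T B L \<and> ghd_width (presented (vs, es))
      T L \<le> k"
  then obtain T :: "nat rtree" and B L where
    *: "is_ghd (presented (vs, es)) T B L" "ghd_width (presented (vs, es)) T L \<le> k" by blast
  have "ghw (presented (vs, es)) \<le> ghd_width (presented (vs, es)) T L"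
    unfolding ghw_def by (rule Least_le) (use *(1) in blast)
  with *(2) show "ghw (presented (vs, es)) \<le> k" by simp
qed

text \<open>The given decomposition is first replaced by one with maximal bags, which are all listed
  as separators. A component has at most \<open>length vs\<close> vertices, so as many rounds
  suffice.\<close>

lemma ghd_solvable:
  fixes T :: "nat rtree"
  assumes "is_ghd (presented (vs, es)) T B L" "ghd_width (presented (vs, es)) T L \<le> k" "k \<ge> 1"
      "c \<ge> 1"
  shows "solvable vs es (winning vs es (separators vs es c k) (length vs))"
proof -
  obtain B' where B': "max_ghd (presented (vs, es)) T B' L"
    using ex_max_ghd[OF _ assms(1)] by auto
  interpret max_list_ghd vs es T B' L by unfold_locales (rule B')
  have w: "weight (presented (vs, es)) (L u) \<le> k" if "u \<in> nodes T" for u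
    using assms(2) Max_ge[of "(\<lambda>u. weight (presented (vs, es)) (L u)) ` nodes T"] finite_nodes that
    unfolding ghd_width_def by (meson finite_imageI image_eqI le_trans)
  let ?seps = "separators vs es c k"
  have e: "{} \<in> snd ` set ?seps" using empty_separator[of vs es c k] by force
  have b: "B' u \<in> snd ` set ?seps" if "u \<in> nodes T" for u
    by (rule bag_in_separators[OF assms(3,4) w that])
  have "C \<in> set (map fst (winning vs es ?seps (length vs)))"
    if C: "C \<in> set (components vs es {} (set vs))" for C
  proof -
    from C obtain v where v: "v \<in> set vs - {}" "C = reach es {} v"
      using set_components[of "set vs" "{}"] by auto
    have "card C \<le> card (set vs)" using reach_subset_vertices[OF v(1)] v(2) by (simp add: card_mono)
    then have "card (reach es {} v) \<le> length vs" using v(2) distinct_card[OF distinct_vs] by simp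
    with winning_complete[OF b e v(1)] v(2) show ?thesis by blast
  qed
  then show ?thesis unfolding solvable_def by blast
qed

theorem answer_correct:
  assumes "k \<ge> 1" "c \<ge> 1"
  shows "ghd_answer k (vs, es) (answer vs es (winning vs es (separators vs es c k) (length vs)))"
proof -
  let ?T = "winning vs es (separators vs es c k) (length vs)"
  have T: "strategy k ?T" by (rule strategy_winning) (rule separators_sound)
  show ?thesis
  proof (cases "solvable vs es ?T")
    case True
    let ?os = "build vs es ?T"
    let ?Tr = "\<lparr>nodes = {..<length ?os}, tree_root = 0, parent = (\<lambda>u. fst (?os ! u))\<rparr>"
    let ?L = "\<lambda>u e. if e \<in> snd (snd (?os ! u)) then 1 else 0 :: nat"
    have init: "C \<in> set (map fst ?T)" if "C \<in> set (components vs es {} (set vs))" for C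
      using True that unfolding solvable_def by blast
    note ghd = build_sound[OF T init]
    have "ghw (presented (vs, es)) \<le> k" using ghd ghw_le_iff by blast
    moreover have "answer vs es ?T = enc_ghd (vs, es) (length ?os) ?Tr (bag ?os) ?L"
    proof -
      have node: "Pair (enc_nat (parent ?Tr u)) (Pair (elist (\<lambda>v. enc_bool (v \<in> bag ?os u)) vs)
                  (elist (\<lambda>e. enc_nat (?L u e)) es)) = enc_node vs es (?os ! u)" for u
        by (auto simp: enc_node_def cvec_def bag_def enc_bool_def intro!: arg_cong[of _ _ enc_list])
      have "map (\<lambda>u. enc_node vs es (?os ! u)) [0..<length ?os] = map (enc_node vs es) ?os"
        by (rule nth_equalityI) auto
      then show ?thesis using True unfolding enc_ghd.simps node by (simp add: answer_def)
    qed
    ultimately show ?thesis unfolding ghd_answer_def using ghd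
      by (simp del: presented.simps enc_ghd.simps) (metis lessThan_iff rtree.select_convs(1))
  next
    case False
    then have "\<not> ghw (presented (vs, es)) \<le> k"
      using ghd_solvable assms unfolding ghw_le_iff by blast
    with False show ?thesis unfolding ghd_answer_def answer_def by simp
  qed
qed

end

section \<open>Complexity of the algorithm\<close>

lemma ptime_bool_op:
  assumes "ptime N A e (\<lambda>j. enc_bool (a j))" "ptime N A e (\<lambda>j. enc_bool (b j))"
  shows "ptime N A e (\<lambda>j. enc_bool (g (a j) (b j)))"
proof -
  have sub: "ptime N B e f" if "ptime N A e f" "B \<subseteq> A" for B f using that by (rule ptime_subset)
  \<comment> \<open>The four values of the fixed function \<open>g\<close> are written into the
    program.\<close>
  have "ptime N A e (\<lambda>j. if a j then (if b j then enc_bool (g True True) else enc_bool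
      (g True False))
      else (if b j then enc_bool (g False True) else enc_bool (g False False)))"
    by (intro ptime_if) (auto intro!: sub assms ptime_const[OF assms(1)]
        sub[OF ptime_const[OF assms(1)]])
  then show ?thesis by (rule ptime_cong) simp
qed

lemma ptime_cvec_op:
  assumes "ptime N A e (\<lambda>j. cvec (us j) (X j))" "ptime N A e (\<lambda>j. cvec (us j) (Y j))"
  shows "ptime N A e (\<lambda>j. elist (\<lambda>u. enc_bool (g (u \<in> X j) (u \<in> Y j))) (us j))"
proof (rule ptime_map[OF ptime_zip[OF assms[unfolded cvec_def]]], goal_cases)
  case (1 e')
  show ?case
    by (rule ptime_bool_op) (use ptime_hd[OF 1(2)] ptime_tl[OF 1(2)] in simp_all)
qed

lemma ptime_cvec_all:
  assumes "ptime N A e (\<lambda>j. cvec (us j) (X j))" "ptime N A e (\<lambda>j. cvec (us j) (Y j))"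
  shows "ptime N A e (\<lambda>j. enc_bool (\<forall>u\<in>set (us j). g (u \<in> X j) (u \<in> Y j)))"
  by (rule ptime_list_all[OF ptime_cvec_op[OF assms]])

lemma ptime_cvec_Un:
  "ptime N A e (\<lambda>j. cvec (us j) (X j)) \<Longrightarrow> ptime N A e (\<lambda>j. cvec (us j) (Y j)) \<Longrightarrow>
   ptime N A e (\<lambda>j. cvec (us j) (X j \<union> Y j))"
  using ptime_cvec_op[where g = "(\<or>)"] by (simp add: cvec_def)

lemma ptime_cvec_Int:
  "ptime N A e (\<lambda>j. cvec (us j) (X j)) \<Longrightarrow> ptime N A e (\<lambda>j. cvec (us j) (Y j)) \<Longrightarrow>
   ptime N A e (\<lambda>j. cvec (us j) (X j \<inter> Y j))"
  using ptime_cvec_op[where g = "(\<and>)"] by (simp add: cvec_def)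

lemma ptime_cvec_Diff:
  "ptime N A e (\<lambda>j. cvec (us j) (X j)) \<Longrightarrow> ptime N A e (\<lambda>j. cvec (us j) (Y j)) \<Longrightarrow>
   ptime N A e (\<lambda>j. cvec (us j) (X j - Y j))"
  using ptime_cvec_op[where g = "\<lambda>x y. x \<and> \<not> y"] by (simp add: cvec_def)

lemma ptime_cvec_empty:
  "ptime N A e (\<lambda>j. cvec (us j) (X j)) \<Longrightarrow> ptime N A e (\<lambda>j. cvec (us j) {})"
  using ptime_cvec_op[where g = "\<lambda>_ _. False" and X = X and Y = X] by (simp add: cvec_def)

lemma ptime_cvec_full:
  assumes "ptime N A e (\<lambda>j. cvec (us j) (X j))"
  shows "ptime N A e (\<lambda>j. cvec (us j) (set (us j)))"
  using ptime_cvec_op[OF assms assms, of "\<lambda>_ _. True"] by (rule ptime_cong) (auto simp: cvec_def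
      intro!: arg_cong[of _ _ enc_list])

lemma ptime_cvec_subset:
  assumes "ptime N A e (\<lambda>j. cvec (us j) (X j))" "ptime N A e (\<lambda>j. cvec (us j) (Y j))"
    and "\<And>j. j \<in> A \<Longrightarrow> X j \<subseteq> set (us j)"
  shows "ptime N A e (\<lambda>j. enc_bool (X j \<subseteq> Y j))"
  by (rule ptime_cong[OF ptime_cvec_all[OF assms(1,2), of "(\<longrightarrow>)"]])
    (use assms(3) in \<open>auto intro!: arg_cong[of _ _ enc_bool]\<close>)

lemma ptime_cvec_disjoint:
  assumes "ptime N A e (\<lambda>j. cvec (us j) (X j))" "ptime N A e (\<lambda>j. cvec (us j) (Y j))"
    and "\<And>j. j \<in> A \<Longrightarrow> X j \<subseteq> set (us j)"
  shows "ptime N A e (\<lambda>j. enc_bool (X j \<inter> Y j = {}))"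
  by (rule ptime_cong[OF ptime_cvec_all[OF assms(1,2), of "\<lambda>x y. \<not> (x \<and> y)"]])
    (use assms(3) in \<open>auto intro!: arg_cong[of _ _ enc_bool]\<close>)

lemma ptime_cvec_length:
  "ptime N A e (\<lambda>j. cvec (us j) (X j)) \<Longrightarrow> ptime N A e (\<lambda>j. enc_nat (length (us j)))"
  unfolding cvec_def by (rule ptime_length)

lemma dsize_cvec: "dsize (cvec us X) \<le> 1 + 4 * length us" "1 + 2 * length us \<le> dsize (cvec us X)"
  unfolding cvec_def by (induction us) (simp_all add: enc_bool_def)

text \<open>The size of a characteristic vector depends on the set only up to a factor of 2. This
  supplies the size bounds for the loops that iterate set operations over one list.\<close>

lemma dsize_cvec_le: "dsize (cvec us X) \<le> 2 * dsize (cvec us Y)"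
  using dsize_cvec[of us X] dsize_cvec[of us Y] by simp

lemma cvec_inj: "cvec us X = cvec us Y \<longleftrightarrow> X \<inter> set us = Y \<inter> set us"
  unfolding cvec_def by (induction us) auto

lemma cvec_eqD: "cvec us X = cvec us Y \<Longrightarrow> X \<subseteq> set us \<Longrightarrow> Y \<subseteq> set us \<Longrightarrow> X = Y"
  unfolding cvec_inj by blast

text \<open>The unit vector with respect to \<open>es\<close> tells a program the position of the
  edge, which it needs to put the edge into a cover.\<close>

definition enc_edge :: "'a list \<Rightarrow> 'a set list \<Rightarrow> 'a set \<Rightarrow> data" where
  "enc_edge vs es x = Pair (cvec es {x}) (cvec vs x)"

definition enc_sep :: "'a list \<Rightarrow> 'a set list \<Rightarrow> 'a set set \<times> 'a set \<Rightarrow> data" where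
  "enc_sep vs es p = Pair (cvec es (fst p)) (cvec vs (snd p))"

definition enc_move :: "'a list \<Rightarrow> 'a set list \<Rightarrow> 'a set \<times> 'a set set \<times> 'a set \<Rightarrow> data" where
  "enc_move vs es t = Pair (cvec vs (fst t)) (enc_sep vs es (snd t))"

definition enc_item :: "'a list \<Rightarrow> nat \<times> 'a set \<Rightarrow> data" where
  "enc_item vs t = Pair (enc_nat (fst t)) (cvec vs (snd t))"

lemma ptime_edge:
  assumes "ptime N A e (\<lambda>j. enc_edge (vs j) (es j) (x j))"
  shows "ptime N A e (\<lambda>j. cvec (es j) {x j})" "ptime N A e (\<lambda>j. cvec (vs j) (x j))"
  using ptime_hd[OF assms] ptime_tl[OF assms] by (simp_all add: enc_edge_def)

lemma ptime_sep:
  assumes "ptime N A e (\<lambda>j. enc_sep (vs j) (es j) (p j))"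
  shows "ptime N A e (\<lambda>j. cvec (es j) (fst (p j)))" "ptime N A e (\<lambda>j. cvec (vs j) (snd (p j)))"
  using ptime_hd[OF assms] ptime_tl[OF assms] by (simp_all add: enc_sep_def)

lemma ptime_move:
  assumes "ptime N A e (\<lambda>j. enc_move (vs j) (es j) (t j))"
  shows "ptime N A e (\<lambda>j. cvec (vs j) (fst (t j)))" "ptime N A e (\<lambda>j. enc_sep (vs j) (es j)
      (snd (t j)))"
  using ptime_hd[OF assms] ptime_tl[OF assms] by (simp_all add: enc_move_def)

lemma ptime_item:
  assumes "ptime N A e (\<lambda>j. enc_item (vs j) (t j))"
  shows "ptime N A e (\<lambda>j. enc_nat (fst (t j)))" "ptime N A e (\<lambda>j. cvec (vs j) (snd (t j)))"
  using ptime_hd[OF assms] ptime_tl[OF assms] by (simp_all add: enc_item_def)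

lemma ptime_enc_sepI:
  "ptime N A e (\<lambda>j. cvec (es j) (l j)) \<Longrightarrow> ptime N A e (\<lambda>j. cvec (vs j) (r j)) \<Longrightarrow>
   ptime N A e (\<lambda>j. enc_sep (vs j) (es j) (l j, r j))"
  by (simp add: enc_sep_def ptime_Pair)

lemma ptime_cvec_insert:
  "ptime N A e (\<lambda>j. cvec (es j) {x j}) \<Longrightarrow> ptime N A e (\<lambda>j. cvec (es j) (l j)) \<Longrightarrow>
   ptime N A e (\<lambda>j. cvec (es j) (insert (x j) (l j)))"
  using ptime_cvec_Un[of N A e es "\<lambda>j. {x j}" l] by simp

lemma spread_subset:
  assumes "C \<subseteq> V" "\<And>e. e \<in> set es \<Longrightarrow> e \<subseteq> V"
  shows "spread es X C \<subseteq> V"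
  by (rule spread_least) (use assms in auto)

lemma component_subset:
  assumes "C \<subseteq> V" "\<And>e. e \<in> set es \<Longrightarrow> e \<subseteq> V"
  shows "component vs es X C \<subseteq> V"
proof -
  have "(spread es X ^^ n) C \<subseteq> V" for n
    by (induction n) (simp_all add: assms spread_subset)
  then show ?thesis by (simp add: component_def)
qed

lemma components_subset:
  assumes "\<And>e. e \<in> set es \<Longrightarrow> e \<subseteq> V" "D \<in> set (components vs es X C)"
  shows "D \<subseteq> V"
proof -
  from assms(2) obtain e where e: "e \<in> set es" "D = component vs es X (e - X)"
    unfolding components_def set_fold_insert by auto
  have "e - X \<subseteq> V" using assms(1)[OF e(1)] by blast
  from component_subset[OF this assms(1)] show ?thesis unfolding e(2) by blast
qed

lemma length_fold_insert: "length (fold List.insert xs a) \<le> length xs + length a"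
proof (induction xs arbitrary: a)
  case (Cons x xs)
  have "length (List.insert x a) \<le> Suc (length a)" by (simp add: List.insert_def)
  with Cons[of "List.insert x a"] show ?case by simp
qed simp

lemma length_components: "length (components vs es X C) \<le> length es"
proof -
  let ?xs = "map (\<lambda>e. component vs es X (e - X)) (filter (\<lambda>e. \<not> e \<inter> C \<subseteq> X) es)"
  have "length (components vs es X C) \<le> length ?xs + 0"
    unfolding components_def using length_fold_insert[of ?xs "[]"] by simp
  also have "\<dots> \<le> length es" by simp
  finally show ?thesis .
qed

text \<open>Lemmas of this locale are also used for the environments inside loops, which are again
  instances of it by \<open>lift\<close>.\<close>

locale graph_ptime =
  fixes N :: "'j \<Rightarrow> nat" and A :: "'j set" and e :: "'j \<Rightarrow> data"
    and vs :: "'j \<Rightarrow> 'a list" and es :: "'j \<Rightarrow> 'a set list"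
  assumes lists: "j \<in> A \<Longrightarrow> hypergraph_lists (vs j) (es j)"
    and ES: "ptime N A e (\<lambda>j. elist (enc_edge (vs j) (es j)) (es j))"
    and V: "ptime N A e (\<lambda>j. cvec (vs j) {})" and E: "ptime N A e (\<lambda>j. cvec (es j) {})"
begin

lemma sub: "j \<in> A \<Longrightarrow> x \<in> set (es j) \<Longrightarrow> x \<subseteq> set (vs j)"
  using hypergraph_lists.edge_subset[OF lists] .

lemma lift:
  assumes "\<And>z. z \<in> B \<Longrightarrow> fst z \<in> A"
    and "\<And>f. ptime N A e f \<Longrightarrow> ptime (\<lambda>z. N (fst z)) B e' (\<lambda>z. f (fst z))"
  shows "graph_ptime (\<lambda>z. N (fst z)) B e' (\<lambda>z. vs (fst z)) (\<lambda>z. es (fst z))"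
  by (rule graph_ptime.intro[OF lists[OF assms(1)] assms(2)[OF ES] assms(2)[OF V] assms(2)[OF E]])

lemma ptime_spread:
  assumes X: "ptime N A e (\<lambda>j. cvec (vs j) (X j))" and C: "ptime N A e (\<lambda>j. cvec (vs j) (C j))"
  shows "ptime N A e (\<lambda>j. cvec (vs j) (spread (es j) (X j) (C j)))"
  unfolding spread_def
proof (rule ptime_fold[where F = "\<lambda>j. cvec (vs j)" and a = C and b =
    "\<lambda>j. 2 * dsize (cvec (vs j) (C j))",
      OF ES C], goal_cases)
  case 1
  show ?case by (intro pbound_intros ptime_pbound[OF C])
next
  case (2 j ys zs)
  show ?case by (rule dsize_cvec_le)
next
  case (3 e')
  let ?B = "{(j, fold (\<lambda>e C. if e \<inter> C = {} then C else C \<union> (e - X j)) ys (C j), x) | j ys x.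
      j \<in> A \<and> (\<exists>zs. es j = ys @ x # zs)}"
  note a = 3(2) and x = ptime_edge(2)[OF 3(3)]
  have x_sub: "snd (snd z) \<subseteq> set (vs (fst z))" if "z \<in> ?B" for z
    using that sub by fastforce
  have "ptime (\<lambda>z. N (fst z)) ?B e' (\<lambda>z. if snd (snd z) \<inter> fst (snd z) = {} then cvec (vs (fst z))
      (fst (snd z))
     else cvec (vs (fst z)) (fst (snd z) \<union> (snd (snd z) - X (fst z))))"
    by (rule ptime_if[OF ptime_cvec_disjoint[OF x a x_sub]])
      (auto intro: ptime_subset[OF a] ptime_subset[OF ptime_cvec_Un[OF a ptime_cvec_Diff[OF x
          3(1)[OF X]]]])
  then show ?case by (rule ptime_cong) auto
qed

lemma ptime_component:
  assumes X: "ptime N A e (\<lambda>j. cvec (vs j) (X j))" and C: "ptime N A e (\<lambda>j. cvec (vs j) (C j))"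
  shows "ptime N A e (\<lambda>j. cvec (vs j) (component (vs j) (es j) (X j) (C j)))"
  unfolding component_def
proof (rule ptime_iterate[where F = "\<lambda>j. cvec (vs j)" and a = C and b =
    "\<lambda>j. 2 * dsize (cvec (vs j) (C j))",
      OF ptime_cvec_length[OF C] C], goal_cases)
  case 1
  show ?case by (intro pbound_intros ptime_pbound[OF C])
next
  case (2 j i)
  show ?case by (rule dsize_cvec_le)
next
  case (3 e')
  show ?case by (rule graph_ptime.ptime_spread[OF lift[OF _ 3(1)] 3(1)[OF X] 3(2)]) auto
qed

lemma ptime_components:
  assumes X: "ptime N A e (\<lambda>j. cvec (vs j) (X j))" and C: "ptime N A e (\<lambda>j. cvec (vs j) (C j))"
  shows "ptime N A e (\<lambda>j. elist (cvec (vs j)) (components (vs j) (es j) (X j) (C j)))"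
proof -
  let ?F = "\<lambda>j. filter (\<lambda>x. \<not> x \<inter> C j \<subseteq> X j) (es j)"
  have F: "ptime N A e (\<lambda>j. elist (enc_edge (vs j) (es j)) (?F j))"
  proof (rule ptime_filter[OF ES], goal_cases)
    case (1 e')
    show ?case
      by (rule ptime_not, rule ptime_cvec_subset[OF ptime_cvec_Int[OF ptime_edge(2)[OF 1(2)]
          1(1)[OF C]] 1(1)[OF X]])
        (use sub in fastforce)
  qed
  have "ptime N A e (\<lambda>j. elist (\<lambda>x. cvec (vs j) (component (vs j) (es j) (X j) (x - X j))) (?F j))"
  proof (rule ptime_map[OF F], goal_cases)
    case (1 e')
    show ?case
      by (rule graph_ptime.ptime_component[OF lift[OF _ 1(1)] 1(1)[OF X]
            ptime_cvec_Diff[OF ptime_edge(2)[OF 1(2)] 1(1)[OF X]]]) auto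
  qed
  then have "ptime N A e (\<lambda>j. elist (cvec (vs j)) (map (\<lambda>x. component (vs j) (es j) (X j) (x - X j))
      (?F j)))"
    by (simp add: comp_def)
  then show ?thesis unfolding components_def
  proof (rule ptime_uniq)
    fix j assume j: "j \<in> A"
    have "component (vs j) (es j) (X j) (x - X j) \<subseteq> set (vs j)" if "x \<in> set (es j)" for x
      by (rule component_subset) (use sub[OF j] that in auto)
    then show "inj_on (cvec (vs j)) (set (map (\<lambda>x. component (vs j) (es j) (X j) (x - X j))
        (?F j)))"
      by (auto intro!: inj_onI dest!: cvec_eqD)
  qed
qed

lemma ptime_neighbourhood:
  assumes C: "ptime N A e (\<lambda>j. cvec (vs j) (C j))"
  shows "ptime N A e (\<lambda>j. cvec (vs j) (neighbourhood (es j) (C j)))"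
proof -
  have F: "ptime N A e (\<lambda>j. elist (enc_edge (vs j) (es j)) (filter (\<lambda>x. x \<inter> C j \<noteq> {}) (es j)))"
  proof (rule ptime_filter[OF ES], goal_cases)
    case (1 e')
    show ?case
      by (rule ptime_not, rule ptime_cvec_disjoint[OF ptime_edge(2)[OF 1(2)] 1(1)[OF C]])
        (use sub in fastforce)
  qed
  show ?thesis unfolding neighbourhood_def
  proof (rule ptime_fold[where F = "\<lambda>j. cvec (vs j)" and a = "\<lambda>_. {}" and b =
      "\<lambda>j. 2 * dsize (cvec (vs j) (C j))",
        OF F ptime_cvec_empty[OF C]], goal_cases)
    case 1
    show ?case by (intro pbound_intros ptime_pbound[OF C])
  next
    case (2 j ys zs)
    show ?case by (rule dsize_cvec_le)
  next
    case (3 e')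
    show ?case by (rule ptime_cvec_Un[OF 3(2) ptime_edge(2)[OF 3(3)]])
  qed
qed

end

text \<open>The unit vector of an edge is found by comparing its row with all rows: distinct edges
  have distinct rows because they lie inside the vertex list.\<close>

lemma ptime_enc_edges:
  fixes vs :: "'j \<Rightarrow> 'a list" and es :: "'j \<Rightarrow> 'a set list"
  assumes hyp: "\<And>j. j \<in> A \<Longrightarrow> hypergraph_lists (vs j) (es j)"
    and rows: "ptime N A e (\<lambda>j. elist (cvec (vs j)) (es j))"
  shows "ptime N A e (\<lambda>j. elist (enc_edge (vs j) (es j)) (es j))"
proof (rule ptime_map[OF rows], goal_cases)
  case (1 e')
  have "ptime (\<lambda>z. N (fst z)) (SIGMA j:A. set (es j)) e'
     (\<lambda>z. elist (\<lambda>x. enc_bool (cvec (vs (fst z)) x = cvec (vs (fst z)) (snd z))) (es (fst z)))"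
  proof (rule ptime_map[OF 1(1)[OF rows]], goal_cases)
    case (1 e'')
    show ?case by (rule ptime_Eq[OF 1(2) 1(1)[OF \<open>ptime _ _ e' (\<lambda>z. cvec (vs (fst z)) (snd z))\<close>]])
  qed
  then have "ptime (\<lambda>z. N (fst z)) (SIGMA j:A. set (es j)) e' (\<lambda>z. cvec (es (fst z)) {snd z})"
  proof (rule ptime_cong)
    fix z assume z: "z \<in> (SIGMA j:A. set (es j))"
    then have "fst z \<in> A" by auto
    then have "x \<subseteq> set (vs (fst z))" if "x \<in> set (es (fst z))" for x
      using hypergraph_lists.edge_subset[OF hyp[OF \<open>fst z \<in> A\<close>] that] by blast
    then have "cvec (vs (fst z)) x = cvec (vs (fst z)) (snd z) \<longleftrightarrow> x = snd z" if
        "x \<in> set (es (fst z))" for x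
      using cvec_eqD[of "vs (fst z)" x "snd z"] that z by auto
    then show "elist (\<lambda>x. enc_bool (cvec (vs (fst z)) x = cvec (vs (fst z)) (snd z))) (es (fst z)) =
        cvec (es (fst z)) {snd z}"
      unfolding cvec_def[of "es _"] by (auto intro!: arg_cong[of _ _ enc_list])
  qed
  from ptime_Pair[OF this 1(2)] show ?case by (simp add: enc_edge_def)
qed

section \<open>Generating the separators\<close>

context graph_ptime
begin

text \<open>The induction on \<open>i\<close> takes place outside the machine: each constant
  \<open>i\<close> has its own program, whose degree may grow with \<open>i\<close>. The same holds
  for the unions and joins below.\<close>

lemma ptime_inters: "ptime N A e (\<lambda>j. elist (enc_sep (vs j) (es j)) (inters (vs j) (es j) i))"
proof (induction i)
  case 0
  show ?case unfolding inters.simps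
    by (rule ptime_Cons) (rule ptime_enc_sepI[OF E ptime_cvec_full[OF V]], rule ptime_Nil[OF V])
next
  case (Suc i)
  have "ptime N A e (\<lambda>j. elist (\<lambda>p. elist (\<lambda>x. enc_sep (vs j) (es j) (insert x (fst p), snd p \<inter> x))
      (filter (\<lambda>x. x \<notin> fst p) (es j))) (inters (vs j) (es j) i))"
  proof (rule ptime_map[OF Suc.IH], goal_cases)
    case (1 e')
    note p = ptime_sep[OF 1(2)]
    have "ptime (\<lambda>z. N (fst z)) (SIGMA j:A. set (inters (vs j) (es j) i)) e'
       (\<lambda>z. elist (enc_edge (vs (fst z)) (es (fst z))) (filter (\<lambda>x. x \<notin> fst (snd z)) (es (fst z))))"
    proof (rule ptime_filter[OF 1(1)[OF ES]], goal_cases)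
      case (1 e'')
      show ?case
        by (rule ptime_cong, rule ptime_cvec_disjoint[OF ptime_edge(1)[OF 1(2)] 1(1)[OF p(1)]]) auto
    qed
    then show ?case
    proof (rule ptime_map, goal_cases)
      case (1 e'')
      show ?case
        by (rule ptime_enc_sepI[OF ptime_cvec_insert[OF ptime_edge(1)[OF 1(2)] 1(1)[OF p(1)]]
            ptime_cvec_Int[OF 1(1)[OF p(2)] ptime_edge(2)[OF 1(2)]]])
    qed
  qed
  then have "ptime N A e (\<lambda>j. elist (elist (enc_sep (vs j) (es j)))
      (map (\<lambda>p. map (\<lambda>x. (insert x (fst p), snd p \<inter> x))
      (filter (\<lambda>x. x \<notin> fst p) (es j))) (inters (vs j) (es j) i)))"
    by (simp add: comp_def)
  from ptime_concat[OF this] show ?case unfolding inters.simps .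
qed

lemma ptime_unions: "ptime N A e (\<lambda>j. elist (enc_sep (vs j) (es j)) (unions (es j) i))"
proof (induction i)
  case 0
  show ?case unfolding unions.simps
    by (rule ptime_Cons) (rule ptime_enc_sepI[OF E V], rule ptime_Nil[OF V])
next
  case (Suc i)
  have "ptime N A e (\<lambda>j. elist (\<lambda>p. elist (\<lambda>x. enc_sep (vs j) (es j) (insert x (fst p), snd p \<union> x))
      (es j)) (unions (es j) i))"
  proof (rule ptime_map[OF Suc.IH], goal_cases)
    case (1 e')
    note p = ptime_sep[OF 1(2)]
    show ?case
    proof (rule ptime_map[OF 1(1)[OF ES]], goal_cases)
      case (1 e'')
      show ?case
        by (rule ptime_enc_sepI[OF ptime_cvec_insert[OF ptime_edge(1)[OF 1(2)] 1(1)[OF p(1)]]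
            ptime_cvec_Un[OF 1(1)[OF p(2)] ptime_edge(2)[OF 1(2)]]])
    qed
  qed
  then have "ptime N A e (\<lambda>j. elist (elist (enc_sep (vs j) (es j)))
      (map (\<lambda>p. map (\<lambda>x. (insert x (fst p), snd p \<union> x))
      (es j)) (unions (es j) i)))"
    by (simp add: comp_def)
  from ptime_append[OF Suc.IH ptime_concat[OF this]] show ?case unfolding unions.simps .
qed

lemma ptime_small_inters: "ptime N A e (\<lambda>j. elist (cvec (vs j)) (small_inters (vs j) (es j) i))"
proof (induction i)
  case 0
  show ?case unfolding small_inters.simps by (rule ptime_Nil[OF V])
next
  case (Suc i)
  have "ptime N A e (\<lambda>j. elist (\<lambda>p. cvec (vs j) (snd p)) (inters (vs j) (es j) i))"
  proof (rule ptime_map[OF ptime_inters], goal_cases)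
    case (1 e')
    show ?case by (rule ptime_sep(2)[OF 1(2)])
  qed
  then have "ptime N A e (\<lambda>j. elist (cvec (vs j)) (map snd (inters (vs j) (es j) i)))"
    by (simp add: comp_def)
  from ptime_append[OF Suc.IH this] show ?case unfolding small_inters.simps .
qed

end

text \<open>The vertex list is processed from its end, and a set is held as its characteristic
  vector over the suffix processed so far. As this suffix changes, plain Boolean lists serve as the
  values of the fold.\<close>

definition subsets_step :: "'a set \<Rightarrow> 'a \<Rightarrow> bool list list \<Rightarrow> bool list list" where
  "subsets_step X u a = map (\<lambda>bs. False # bs) a @ (if u \<in> X then map (\<lambda>bs. True # bs) a else [])"

lemma fold_subsets_step:
  "distinct us \<Longrightarrow> fold (subsets_step X) (rev us) [[]] = map (\<lambda>Y. map (\<lambda>u. u \<in> Y) us) (subsets us X)"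
proof (induction us)
  case (Cons w us)
  have F: "map (\<lambda>u. u \<in> Y) (w # us) = False # map (\<lambda>u. u \<in> Y) us" if "Y \<in> set (subsets us X)" for Y
    using that Cons.prems by (auto simp: set_subsets)
  have T: "map (\<lambda>u. u \<in> insert w Y) (w # us) = True # map (\<lambda>u. u \<in> Y) us" for Y
    using Cons.prems by auto
  have "fold (subsets_step X) (rev (w # us)) [[]] = subsets_step X w (map (\<lambda>Y. map (\<lambda>u. u \<in> Y) us)
      (subsets us X))"
    using Cons by simp
  also have "\<dots> = map (\<lambda>Y. map (\<lambda>u. u \<in> Y) (w # us)) (subsets (w # us) X)"
    unfolding subsets_step_def subsets.simps map_append
    by (intro arg_cong2[of _ _ _ _ "(@)"]) (use F T in \<open>simp_all del: list.map add: comp_def\<close>)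
  finally show ?case .
qed simp

lemma length_subsets: "distinct us \<Longrightarrow> length (subsets us X) = 2 ^ card (X \<inter> set us)"
proof (induction us)
  case (Cons u us)
  have "X \<inter> set (u # us) = (if u \<in> X then insert u (X \<inter> set us) else X \<inter> set us)" by auto
  then show ?case using Cons by simp
qed simp

lemma dsize_elist_le: "(\<And>x. x \<in> set xs \<Longrightarrow> dsize (E x) \<le> M) \<Longrightarrow> dsize (elist E xs) \<le> 1 + length xs *
    (1 + M)"
proof (induction xs)
  case (Cons x xs)
  from Cons.prems[of x] Cons.IH Cons.prems show ?case by fastforce
qed simp

text \<open>The only step that is not polynomial without the promise on the input.\<close>

lemma ptime_subsets:
  fixes us :: "'j \<Rightarrow> 'a list"
  assumes X: "ptime N A e (\<lambda>j. cvec (us j) (X j))" and us: "\<And>j. j \<in> A \<Longrightarrow> distinct (us j)"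
    and b: "pbound N A b" "\<And>j. j \<in> A \<Longrightarrow> 2 ^ card (X j) \<le> b j" "\<And>j. j \<in> A \<Longrightarrow> X j \<subseteq> set (us j)"
  shows "ptime N A e (\<lambda>j. elist (cvec (us j)) (subsets (us j) (X j)))"
proof -
  have "ptime N A e (\<lambda>j. elist (elist enc_bool) (fold (subsets_step (X j)) (rev (us j)) [[]]))"
  proof (rule ptime_fold[where F = "\<lambda>j. elist (elist enc_bool)" and a = "\<lambda>_. [[]]" and
        b = "\<lambda>j. 1 + b j * (1 + 2 * dsize (cvec (us j) (X j)))",
        OF ptime_rev[OF X[unfolded cvec_def]]], goal_cases)
    case 1
    show ?case by (rule ptime_const[OF X])
  next
    case 2
    show ?case by (intro pbound_intros b(1) ptime_pbound[OF X])
  next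
    case (3 j ys zs)
    \<comment> \<open>The processed vertices form a suffix of \<open>us j\<close>, and the
      accumulator lists the subsets of \<open>X j\<close> within it.\<close>
    have ys: "ys = rev (rev ys)" "us j = rev zs @ rev ys" using 3(2) by (simp_all add: rev_swap)
    have d: "distinct (rev ys)" using us[OF 3(1)] ys(2) by auto
    have card: "2 ^ card (X j \<inter> set (rev ys)) \<le> b j"
    proof -
      have "card (X j \<inter> set (rev ys)) \<le> card (X j)"
        by (rule card_mono) (use b(3)[OF 3(1)] finite_subset in auto)
      then have "(2::nat) ^ card (X j \<inter> set (rev ys)) \<le> 2 ^ card (X j)" by (rule power_increasing)
          simp
      from le_trans[OF this b(2)[OF 3(1)]] show ?thesis .
    qed
    have "dsize (elist (elist enc_bool) (map (\<lambda>Y. map (\<lambda>u. u \<in> Y) (rev ys)) (subsets (rev ys)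
        (X j))))
        = dsize (elist (cvec (rev ys)) (subsets (rev ys) (X j)))"
      by (simp add: cvec_def[abs_def] comp_def)
    also have "\<dots> \<le> 1 + length (subsets (rev ys) (X j)) * (1 + 2 * dsize (cvec (us j) (X j)))"
    proof (rule dsize_elist_le)
      fix Y
      show "dsize (cvec (rev ys) Y) \<le> 2 * dsize (cvec (us j) (X j))"
        using dsize_cvec(1)[of "rev ys" Y] dsize_cvec(2)[of "us j" "X j"] ys(2) by simp
    qed
    also have "\<dots> \<le> 1 + b j * (1 + 2 * dsize (cvec (us j) (X j)))"
      unfolding length_subsets[OF d] using card by (intro add_left_mono mult_right_mono) auto
    finally show ?case using fold_subsets_step[OF d, of "X j"] by simp
  next
    case (4 e')
    note a = 4(2) and u = 4(3)
    have cons: "ptime (\<lambda>z. N (fst z)) B e' (\<lambda>z. elist (elist enc_bool) (map (\<lambda>bs. c # bs)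
        (fst (snd z))))"
      if a: "ptime (\<lambda>z. N (fst z)) B e' (\<lambda>z. elist (elist enc_bool) (fst (snd z)))" for c and B ::
          "('j \<times> bool list list \<times> 'a) set"
    proof -
      have "ptime (\<lambda>z. N (fst z)) B e' (\<lambda>z. elist (\<lambda>bs. elist enc_bool (c # bs)) (fst (snd z)))"
      proof (rule ptime_map[OF a], goal_cases)
        case (1 e'')
        show ?case by (rule ptime_Cons[where E = "\<lambda>_. enc_bool", OF ptime_const[OF 1(2)] 1(2)])
      qed
      then show ?thesis by (simp add: comp_def)
    qed
    let ?B = "{(j, fold (subsets_step (X j)) ys [[]], x) | j ys x. j \<in> A \<and> (\<exists>zs. rev (us j) =
        ys @ x # zs)}"
    have "ptime (\<lambda>z. N (fst z)) ?B e' (\<lambda>z. if snd (snd z) \<in> X (fst z)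
        then elist (elist enc_bool) (map (\<lambda>bs. True # bs) (fst (snd z))) else elist (elist enc_bool)
            ([] :: bool list list))"
    proof (rule ptime_if[OF u])
      show "ptime (\<lambda>z. N (fst z)) {z \<in> ?B. snd (snd z) \<in> X (fst z)} e' (\<lambda>z. elist (elist enc_bool)
          (map (\<lambda>bs. True # bs) (fst (snd z))))"
        by (rule cons, rule ptime_subset[OF a]) blast
      show "ptime (\<lambda>z. N (fst z)) {z \<in> ?B. snd (snd z) \<notin> X (fst z)} e' (\<lambda>z. elist (elist enc_bool)
          ([] :: bool list list))"
        by (rule ptime_Nil, rule ptime_subset[OF a]) blast
    qed
    then have "ptime (\<lambda>z. N (fst z)) ?B e' (\<lambda>z. elist (elist enc_bool) (if snd (snd z) \<in> X (fst z)
        then map (\<lambda>bs. True # bs) (fst (snd z)) else []))"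
      by (rule ptime_cong) simp
    from ptime_append[OF cons[OF a] this] show ?case unfolding subsets_step_def .
  qed
  then show ?thesis
    by (rule ptime_cong) (simp add: fold_subsets_step us cvec_def[abs_def] comp_def)
qed

lemma ptime_joins:
  fixes us :: "'j \<Rightarrow> 'a list"
  assumes bs: "ptime N A e (\<lambda>j. elist (cvec (us j)) (bs j))" and V:
      "ptime N A e (\<lambda>j. cvec (us j) {})"
  shows "ptime N A e (\<lambda>j. elist (cvec (us j)) (joins (bs j) i))"
proof (induction i)
  case 0
  show ?case unfolding joins.simps by (rule ptime_Cons) (rule V, rule ptime_Nil[OF V])
next
  case (Suc i)
  have "ptime N A e (\<lambda>j. elist (\<lambda>x. elist (\<lambda>b. cvec (us j) (x \<union> b)) (bs j)) (joins (bs j) i))"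
  proof (rule ptime_map[OF Suc.IH], goal_cases)
    case (1 e')
    note x = 1(2)
    show ?case
    proof (rule ptime_map[OF 1(1)[OF bs]], goal_cases)
      case (1 e'')
      show ?case by (rule ptime_cvec_Un[OF 1(1)[OF x] 1(2)])
    qed
  qed
  then have "ptime N A e (\<lambda>j. elist (elist (cvec (us j))) (map (\<lambda>x. map (\<lambda>b. x \<union> b) (bs j))
      (joins (bs j) i)))"
    by (simp add: comp_def)
  from ptime_append[OF Suc.IH ptime_concat[OF this]] show ?case unfolding joins.simps .
qed

context graph_ptime
begin

lemma ptime_basics:
  assumes b: "pbound N A b" "\<And>j p. j \<in> A \<Longrightarrow> p \<in> set (inters (vs j) (es j) c) \<Longrightarrow> 2 ^ card (snd p) \<le>
      b j"
  shows "ptime N A e (\<lambda>j. elist (cvec (vs j)) (basics (vs j) (es j) c))"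
proof -
  have "ptime N A e (\<lambda>j. elist (\<lambda>p. elist (cvec (vs j)) (subsets (vs j) (snd p)))
      (inters (vs j) (es j) c))"
  proof (rule ptime_map[OF ptime_inters], goal_cases)
    case (1 e')
    let ?B = "SIGMA j:A. set (inters (vs j) (es j) c)"
    have B: "fst z \<in> A" "snd z \<in> set (inters (vs (fst z)) (es (fst z)) c)" if "z \<in> ?B" for z using
        that by auto
    show ?case
    proof (rule ptime_subsets[OF ptime_sep(2)[OF 1(2)], where b = "\<lambda>z. b (fst z)"])
      show "pbound (\<lambda>z. N (fst z)) ?B (\<lambda>z. b (fst z))" by (rule pbound_reindex[OF b(1)]) auto
      show "distinct (vs (fst z))" if "z \<in> ?B" for z
        using hypergraph_lists.distinct_vs[OF lists[OF B(1)[OF that]]] .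
      show "2 ^ card (snd (snd z)) \<le> b (fst z)" if "z \<in> ?B" for z
        using b(2)[OF B[OF that]] .
      show "snd (snd z) \<subseteq> set (vs (fst z))" if "z \<in> ?B" for z
        using inters_sound[of "fst (snd z)" "snd (snd z)"] B(2)[OF that] by simp
    qed
  qed
  then have "ptime N A e (\<lambda>j. elist (elist (cvec (vs j))) (map (\<lambda>p. subsets (vs j) (snd p))
      (inters (vs j) (es j) c)))"
    by (simp add: comp_def)
  from ptime_append[OF ptime_small_inters ptime_concat[OF this]]
  show ?thesis unfolding basics_def .
qed

lemma ptime_separators:
  assumes b: "pbound N A b" "\<And>j p. j \<in> A \<Longrightarrow> p \<in> set (inters (vs j) (es j) c) \<Longrightarrow> 2 ^ card (snd p) \<le>
      b j"
  shows "ptime N A e (\<lambda>j. elist (enc_sep (vs j) (es j)) (separators (vs j) (es j) c k))"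
proof -
  have joins: "ptime N A e (\<lambda>j. elist (cvec (vs j)) (joins (basics (vs j) (es j) c) (k ^ c)))"
    by (rule ptime_joins[OF ptime_basics[OF b] V])
  have "ptime N A e (\<lambda>j. elist (\<lambda>p. elist (\<lambda>x. enc_sep (vs j) (es j) (fst p, snd p \<inter> x))
      (joins (basics (vs j) (es j) c) (k ^ c))) (unions (es j) k))"
  proof (rule ptime_map[OF ptime_unions], goal_cases)
    case (1 e')
    note p = ptime_sep[OF 1(2)]
    show ?case
    proof (rule ptime_map[OF 1(1)[OF joins]], goal_cases)
      case (1 e'')
      show ?case by (rule ptime_enc_sepI[OF 1(1)[OF p(1)] ptime_cvec_Int[OF 1(1)[OF p(2)] 1(2)]])
    qed
  qed
  then have "ptime N A e (\<lambda>j. elist (elist (enc_sep (vs j) (es j)))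
      (map (\<lambda>p. map (\<lambda>x. (fst p, snd p \<inter> x))
      (joins (basics (vs j) (es j) c) (k ^ c))) (unions (es j) k)))"
    by (simp add: comp_def)
  from ptime_concat[OF this] show ?thesis unfolding separators_def .
qed

end

section \<open>Computing the table and the output\<close>

lemma dsize_filter_le: "dsize (elist E (filter P xs)) \<le> dsize (elist E xs)"
  by (induction xs) auto

lemma blocks_subset:
  assumes "\<And>x. x \<in> set es \<Longrightarrow> x \<subseteq> V" "C \<in> set (blocks vs es seps)"
  shows "C \<subseteq> V"
proof -
  from assms(2) obtain p where "C \<in> set (components vs es (snd p) (set vs))" unfolding blocks_def
      by auto
  from components_subset[OF assms(1) this] show ?thesis by blast
qed

lemma winning_subset_moves: "set (winning vs es seps r) \<subseteq> set (moves vs es seps)"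
  unfolding winning_def by (cases r) auto

lemma winning_blocks:
  assumes "\<And>x. x \<in> set es \<Longrightarrow> x \<subseteq> V" "t \<in> set (winning vs es seps r)"
  shows "fst t \<subseteq> V"
proof -
  from assms(2) winning_subset_moves have "t \<in> set (moves vs es seps)" by blast
  then have "fst t \<in> set (blocks vs es seps)" by (auto simp: moves_def)
  with blocks_subset[OF assms(1)] show ?thesis by blast
qed

definition enc_state :: "'a list \<Rightarrow> 'a set list \<Rightarrow> 'a build_state \<Rightarrow> data" where
  "enc_state vs es s = Pair (elist (enc_item vs) (fst s)) (elist (enc_node vs es) (snd s))"

context graph_ptime
begin

lemma ptime_blocks:
  assumes "ptime N A e (\<lambda>j. elist (enc_sep (vs j) (es j)) (seps j))"
  shows "ptime N A e (\<lambda>j. elist (cvec (vs j)) (blocks (vs j) (es j) (seps j)))"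
proof -
  have "ptime N A e (\<lambda>j. elist (\<lambda>p. elist (cvec (vs j)) (components (vs j) (es j) (snd p)
      (set (vs j)))) (seps j))"
  proof (rule ptime_map[OF assms], goal_cases)
    case (1 e')
    show ?case
      by (rule graph_ptime.ptime_components[OF lift[OF _ 1(1)] ptime_sep(2)[OF 1(2)]
          1(1)[OF ptime_cvec_full[OF V]]])
        auto
  qed
  then have "ptime N A e (\<lambda>j. elist (elist (cvec (vs j)))
      (map (\<lambda>p. components (vs j) (es j) (snd p) (set (vs j))) (seps j)))"
    by (simp add: comp_def)
  from ptime_concat[OF this] show ?thesis unfolding blocks_def .
qed

lemma ptime_moves:
  assumes seps: "ptime N A e (\<lambda>j. elist (enc_sep (vs j) (es j)) (seps j))"
  shows "ptime N A e (\<lambda>j. elist (enc_move (vs j) (es j)) (moves (vs j) (es j) (seps j)))"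
proof -
  have "ptime N A e (\<lambda>j. elist (\<lambda>C. elist (\<lambda>p. enc_move (vs j) (es j) (C, p)) (seps j))
      (blocks (vs j) (es j) (seps j)))"
  proof (rule ptime_map[OF ptime_blocks[OF seps]], goal_cases)
    case (1 e')
    note C = 1(2)
    show ?case
    proof (rule ptime_map[OF 1(1)[OF seps]], goal_cases)
      case (1 e'')
      from ptime_Pair[OF 1(1)[OF C] 1(2)] show ?case by (simp add: enc_move_def)
    qed
  qed
  then have "ptime N A e (\<lambda>j. elist (elist (enc_move (vs j) (es j)))
      (map (\<lambda>C. map (\<lambda>p. (C, p)) (seps j)) (blocks (vs j) (es j) (seps j))))"
    by (simp add: comp_def)
  from ptime_concat[OF this] show ?thesis unfolding moves_def .
qed

lemma ptime_mem_table:
  assumes T: "ptime N A e (\<lambda>j. elist (enc_move (vs j) (es j)) (T j))"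
    and wf: "\<And>j t. j \<in> A \<Longrightarrow> t \<in> set (T j) \<Longrightarrow> fst t \<subseteq> set (vs j)"
    and C: "ptime N A e (\<lambda>j. cvec (vs j) (C j))" "\<And>j. j \<in> A \<Longrightarrow> C j \<subseteq> set (vs j)"
  shows "ptime N A e (\<lambda>j. enc_bool (C j \<in> set (map fst (T j))))"
proof (rule ptime_mem[where E = "\<lambda>j. cvec (vs j)", OF C(1)])
  have "ptime N A e (\<lambda>j. elist (\<lambda>t. cvec (vs j) (fst t)) (T j))"
  proof (rule ptime_map[OF T], goal_cases)
    case (1 e')
    show ?case by (rule ptime_move(1)[OF 1(2)])
  qed
  then show "ptime N A e (\<lambda>j. elist (cvec (vs j)) (map fst (T j)))" by (simp add: comp_def)
  show "y = C j" if "j \<in> A" "y \<in> set (map fst (T j))" "cvec (vs j) y = cvec (vs j) (C j)" for j y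
    using cvec_eqD[OF that(3)] wf[OF that(1)] C(2)[OF that(1)] that(2) by auto
qed

lemma ptime_components_solved:
  assumes T: "ptime N A e (\<lambda>j. elist (enc_move (vs j) (es j)) (T j))"
    and wf: "\<And>j t. j \<in> A \<Longrightarrow> t \<in> set (T j) \<Longrightarrow> fst t \<subseteq> set (vs j)"
    and C: "ptime N A e (\<lambda>j. cvec (vs j) (C j))" and X: "ptime N A e (\<lambda>j. cvec (vs j) (X j))"
  shows "ptime N A e (\<lambda>j. enc_bool (\<forall>D\<in>set (components (vs j) (es j) (X j) (C j)). D \<in> set
      (map fst (T j))))"
proof (rule ptime_list_all[OF ptime_components[OF X C]], goal_cases)
  case (1 e')
  show ?case
  proof (rule graph_ptime.ptime_mem_table[OF lift[OF _ 1(1)] 1(1)[OF T] _ 1(2)], goal_cases)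
    case (3 z t)
    then show ?case using wf[of "fst z" t] by auto
  next
    case (4 z)
    then have "fst z \<in> A" "snd z \<in> set (components (vs (fst z)) (es (fst z)) (X (fst z))
        (C (fst z)))" by auto
    from components_subset[OF sub[OF this(1)] this(2)] show ?case .
  qed auto
qed

lemma ptime_splits:
  assumes T: "ptime N A e (\<lambda>j. elist (enc_move (vs j) (es j)) (T j))"
    and wf: "\<And>j t. j \<in> A \<Longrightarrow> t \<in> set (T j) \<Longrightarrow> fst t \<subseteq> set (vs j)"
    and C: "ptime N A e (\<lambda>j. cvec (vs j) (C j))" "\<And>j. j \<in> A \<Longrightarrow> C j \<subseteq> set (vs j)"
    and X: "ptime N A e (\<lambda>j. cvec (vs j) (X j))"
  shows "ptime N A e (\<lambda>j. enc_bool (splits (vs j) (es j) (T j) (C j) (X j)))"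
  unfolding splits_def
proof (intro ptime_conj ptime_components_solved[OF T wf C(1) X])
  show "ptime N A e (\<lambda>j. enc_bool (C j \<inter> X j \<noteq> {}))"
    by (rule ptime_not[OF ptime_cvec_disjoint[OF C(1) X C(2)]])
  show "ptime N A e (\<lambda>j. enc_bool (\<forall>x\<in>set (es j). x \<inter> C j \<noteq> {} \<longrightarrow> x \<subseteq> C j \<union> X j))"
  proof (rule ptime_list_all[OF ES], goal_cases)
    case (1 e')
    note x = ptime_edge(2)[OF 1(2)]
    have x_sub: "snd z \<subseteq> set (vs (fst z))" if "z \<in> (SIGMA j:A. set (es j))" for z
      using sub that by fastforce
    show ?case
      by (intro ptime_imp ptime_not ptime_cvec_disjoint[OF x 1(1)[OF C(1)] x_sub]
          ptime_cvec_subset[OF x ptime_cvec_Un[OF 1(1)[OF C(1)] 1(1)[OF X]] x_sub])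
  qed
qed

lemma ptime_winning:
  assumes seps: "ptime N A e (\<lambda>j. elist (enc_sep (vs j) (es j)) (seps j))"
  shows "ptime N A e (\<lambda>j. elist (enc_move (vs j) (es j)) (winning (vs j) (es j) (seps j)
      (length (vs j))))"
  unfolding winning_def
proof (rule ptime_iterate[where F = "\<lambda>j. elist (enc_move (vs j) (es j))" and a = "\<lambda>_. []" and
      b = "\<lambda>j. dsize (elist (enc_move (vs j) (es j)) (moves (vs j) (es j) (seps j)))",
      OF ptime_cvec_length[OF V] ptime_Nil[OF V]], goal_cases)
  case 1
  show ?case by (rule ptime_pbound[OF ptime_moves[OF seps]])
next
  case (2 j i)
  show ?case by (cases i) (simp_all add: dsize_filter_le Suc_le_eq)
next
  case (3 e')
  let ?f = "\<lambda>j T. filter (\<lambda>t. splits (vs j) (es j) T (fst t) (snd (snd t))) (moves (vs j) (es j)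
      (seps j))"
  let ?B = "{(j, (?f j ^^ i) []) | j i. j \<in> A \<and> i < length (vs j)}"
  have wf: "fst t \<subseteq> set (vs (fst z))" if "z \<in> ?B" "t \<in> set (snd z)" for z t
  proof -
    from that obtain j i where *: "z = (j, winning (vs j) (es j) (seps j) i)" "j \<in> A"
      unfolding winning_def by blast
    with that(2) winning_blocks[OF sub[of j]] show ?thesis by simp
  qed
  have A: "fst z \<in> A" if "z \<in> ?B" for z using that by auto
  show ?case
  proof (rule ptime_filter[OF 3(1)[OF ptime_moves[OF seps]]], goal_cases)
    case (1 e'')
    let ?B' = "SIGMA z:?B. set (moves (vs (fst z)) (es (fst z)) (seps (fst z)))"
    have C: "fst (snd z) \<subseteq> set (vs (fst (fst z)))" if "z \<in> ?B'" for z
    proof -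
      from that have "fst z \<in> ?B" by auto
      note A = A[OF this]
      from that have "fst (snd z) \<in> set (blocks (vs (fst (fst z))) (es (fst (fst z)))
          (seps (fst (fst z))))"
        by (auto simp: moves_def)
      with blocks_subset[OF sub[OF A]] show ?thesis by blast
    qed
    note m = ptime_move[OF 1(2)]
    show ?case
    proof (rule graph_ptime.ptime_splits[OF graph_ptime.lift[OF lift[OF A 3(1)] _ 1(1)]
        1(1)[OF 3(2)] _ m(1) C
          ptime_sep(2)[OF m(2)]])
      fix z t assume "z \<in> ?B'" and t: "t \<in> set (snd (fst z))"
      then have "fst z \<in> ?B" by auto
      from wf[OF this t] show "fst t \<subseteq> set (vs (fst (fst z)))" .
    qed auto
  qed
qed

lemma ptime_lookup:
  assumes T: "ptime N A e (\<lambda>j. elist (enc_move (vs j) (es j)) (T j))"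
    and wf: "\<And>j t. j \<in> A \<Longrightarrow> t \<in> set (T j) \<Longrightarrow> fst t \<subseteq> set (vs j)"
    and C: "ptime N A e (\<lambda>j. cvec (vs j) (C j))" "\<And>j. j \<in> A \<Longrightarrow> C j \<subseteq> set (vs j)"
  shows "ptime N A e (\<lambda>j. enc_sep (vs j) (es j) (lookup (T j) (C j)))"
proof -
  have F: "ptime N A e (\<lambda>j. elist (enc_move (vs j) (es j)) (filter (\<lambda>t. fst t = C j) (T j)))"
  proof (rule ptime_filter[OF T], goal_cases)
    case (1 e')
    have "ptime (\<lambda>z. N (fst z)) (SIGMA j:A. set (T j)) e' (\<lambda>z. enc_bool (cvec (vs (fst z))
        (fst (snd z)) = cvec (vs (fst z)) (C (fst z))))"
      by (rule ptime_Eq[OF ptime_move(1)[OF 1(2)] 1(1)[OF C(1)]])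
    then show ?case
    proof (rule ptime_cong)
      fix z assume "z \<in> (SIGMA j:A. set (T j))"
      then have "fst z \<in> A" "snd z \<in> set (T (fst z))" by auto
      from cvec_eqD[OF _ wf[OF this] C(2)[OF this(1)]]
      show "enc_bool (cvec (vs (fst z)) (fst (snd z)) = cvec (vs (fst z)) (C (fst z))) =
          enc_bool (fst (snd z) = C (fst z))"
        by auto
    qed
  qed
  have D: "ptime N A e (\<lambda>j. elist (enc_move (vs j) (es j)) [(C j, {}, {})])"
    by (rule ptime_Cons, unfold enc_move_def enc_sep_def fst_conv snd_conv)
      (intro ptime_Pair C(1) E V, rule ptime_Nil[OF V])
  show ?thesis unfolding lookup_def
    by (rule ptime_move(2)[OF ptime_list_hd[OF ptime_append[OF F D]]]) simp
qed

lemma ptime_build_step: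
  assumes T: "ptime N A e (\<lambda>j. elist (enc_move (vs j) (es j)) (T j))"
    and wf: "\<And>j t. j \<in> A \<Longrightarrow> t \<in> set (T j) \<Longrightarrow> fst t \<subseteq> set (vs j)"
    and s: "ptime N A e (\<lambda>j. enc_state (vs j) (es j) (s j))"
      "\<And>j t. j \<in> A \<Longrightarrow> t \<in> set (fst (s j)) \<Longrightarrow> snd t \<subseteq> set (vs j)"
    and ne: "\<And>j. j \<in> A \<Longrightarrow> fst (s j) \<noteq> []"
  shows "ptime N A e (\<lambda>j. enc_state (vs j) (es j) (build_step (vs j) (es j) (T j) (s j)))"
proof -
  have q: "ptime N A e (\<lambda>j. elist (enc_item (vs j)) (fst (s j)))"
    and os: "ptime N A e (\<lambda>j. elist (enc_node (vs j) (es j)) (snd (s j)))"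
    using ptime_hd[OF s(1)] ptime_tl[OF s(1)] by (simp_all add: enc_state_def)
  let ?C = "\<lambda>j. snd (hd (fst (s j)))" and ?p = "\<lambda>j. fst (hd (fst (s j)))"
  let ?l = "\<lambda>j. fst (lookup (T j) (?C j))" and ?X = "\<lambda>j. snd (lookup (T j) (?C j))"
  have h: "ptime N A e (\<lambda>j. enc_nat (?p j))" "ptime N A e (\<lambda>j. cvec (vs j) (?C j))"
    by (rule ptime_item(1)[OF ptime_list_hd[OF q ne]], assumption)
      (rule ptime_item(2)[OF ptime_list_hd[OF q ne]], assumption)
  have C: "?C j \<subseteq> set (vs j)" if "j \<in> A" for j
    using s(2)[OF that, of "hd (fst (s j))"] ne[OF that] by simp
  have lookup: "ptime N A e (\<lambda>j. enc_sep (vs j) (es j) (lookup (T j) (?C j)))"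
    by (rule ptime_lookup[OF T wf h(2) C])
  note l = ptime_sep[OF lookup]
  have "ptime N A e (\<lambda>j. elist (\<lambda>D. enc_item (vs j) (length (snd (s j)), D)) (components (vs j)
      (es j) (?X j) (?C j)))"
  proof (rule ptime_map[OF ptime_components[OF l(2) h(2)]], goal_cases)
    case (1 e')
    from ptime_Pair[OF 1(1)[OF ptime_length[OF os]] 1(2)] show ?case by (simp add: enc_item_def)
  qed
  then have "ptime N A e (\<lambda>j. elist (enc_item (vs j)) (map (\<lambda>D. (length (snd (s j)), D))
      (components (vs j) (es j) (?X j) (?C j))))"
    by (simp add: comp_def)
  note q' = ptime_append[OF ptime_list_tl[OF q] this]
  have "ptime N A e (\<lambda>j. elist (enc_node (vs j) (es j)) [(?p j, ?X j \<inter> neighbourhood (es j) (?C j),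
      ?l j)])"
    by (rule ptime_Cons, unfold enc_node_def fst_conv snd_conv)
      (intro ptime_Pair h(1) l(1) ptime_cvec_Int[OF l(2) ptime_neighbourhood[OF h(2)]],
       rule ptime_Nil[OF V])
  from ptime_Pair[OF q' ptime_append[OF os this]] show ?thesis
    by (rule ptime_cong) (simp add: enc_state_def build_step_def ne)
qed

end

text \<open>Node numbers are encoded in unary, so their values need a bound as much as the lengths
  of the lists. Each step emits at most one node and enqueues at most one block per edge, whatever
  the table.\<close>

lemma build_state_bounds:
  fixes vs :: "'a list" and es :: "'a set list" and T :: "('a set \<times> 'a set set \<times> 'a set) list"
  assumes "\<And>x. x \<in> set es \<Longrightarrow> x \<subseteq> set vs"
  defines "s i \<equiv> (build_step vs es T ^^ i) (build_init vs es)"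
  shows "length (snd (s i)) \<le> i + 1 \<and> length (fst (s i)) \<le> (i + 1) * length es \<and>
     (\<forall>t\<in>set (fst (s i)). fst t \<le> i \<and> snd t \<subseteq> set vs) \<and> (\<forall>t\<in>set (snd (s i)). fst t \<le> i)"
proof (induction i)
  case 0
  show ?case using length_components[of vs es] components_subset[OF assms(1)]
    by (auto simp: s_def build_init_def)
next
  case (Suc i)
  have Suc_s: "s (Suc i) = build_step vs es T (s i)" by (simp add: s_def)
  show ?case
  proof (cases "fst (s i)")
    case Nil
    then show ?thesis using Suc unfolding Suc_s build_step_def by auto
  next
    case (Cons a q)
    let ?C = "snd a" and ?X = "snd (lookup T (snd a))"
    have cs: "D \<subseteq> set vs" if "D \<in> set (components vs es ?X ?C)" for D
      using components_subset[OF assms(1) that] by blast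
    have q: "fst (s (Suc i)) = q @ map (\<lambda>C. (length (snd (s i)), C)) (components vs es ?X ?C)"
      and os: "snd (s (Suc i)) = snd (s i) @ [(fst a, ?X \<inter> neighbourhood es ?C, fst (lookup T ?C))]"
      using Cons unfolding Suc_s build_step_def by auto
    from Suc Cons have IH: "length (snd (s i)) \<le> i + 1" "length q \<le> (i + 1) * length es"
      "\<And>t. t \<in> set q \<Longrightarrow> fst t \<le> i \<and> snd t \<subseteq> set vs" "fst a \<le> i" "\<And>t. t \<in> set (snd (s i)) \<Longrightarrow> fst t \<le> i"
      by auto
    have "length (fst (s (Suc i))) \<le> (Suc i + 1) * length es"
      unfolding q using IH(2) length_components[of vs es ?X ?C] by simp
    moreover have "length (snd (s (Suc i))) \<le> Suc i + 1" unfolding os using IH(1) by simp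
    moreover have "\<forall>t\<in>set (fst (s (Suc i))). fst t \<le> Suc i \<and> snd t \<subseteq> set vs"
      unfolding q using IH(1,3) cs by fastforce
    moreover have "\<forall>t\<in>set (snd (s (Suc i))). fst t \<le> Suc i"
      unfolding os using IH(4,5) by fastforce
    ultimately show ?thesis by blast
  qed
qed

context graph_ptime
begin

lemma ptime_build_init: "ptime N A e (\<lambda>j. enc_state (vs j) (es j) (build_init (vs j) (es j)))"
proof -
  have "ptime N A e (\<lambda>j. elist (\<lambda>C. enc_item (vs j) (0, C)) (components (vs j) (es j) {}
      (set (vs j))))"
  proof (rule ptime_map[OF ptime_components[OF V ptime_cvec_full[OF V]]], goal_cases)
    case (1 e')
    from ptime_Pair[OF ptime_const[OF 1(2)] 1(2)] show ?case unfolding enc_item_def fst_conv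
        snd_conv .
  qed
  then have q: "ptime N A e (\<lambda>j. elist (enc_item (vs j)) (map (\<lambda>C. (0, C)) (components (vs j) (es j)
      {} (set (vs j)))))"
    by (simp add: comp_def)
  have "ptime N A e (\<lambda>j. elist (enc_node (vs j) (es j)) [(0, {}, {})])"
    by (rule ptime_Cons, unfold enc_node_def fst_conv snd_conv)
      (intro ptime_Pair E V ptime_const[OF V], rule ptime_Nil[OF V])
  from ptime_Pair[OF q this] show ?thesis unfolding enc_state_def build_init_def fst_conv snd_conv .
qed

lemma pbound_lengths: "pbound N A (\<lambda>j. length (vs j))" "pbound N A (\<lambda>j. length (es j))"
  using pbound_mono[OF ptime_pbound[OF ptime_cvec_length[OF V]]]
    pbound_mono[OF ptime_pbound[OF ptime_cvec_length[OF E]]]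
  by (simp_all add: dsize_enc_nat)

lemma ptime_build:
  assumes T: "ptime N A e (\<lambda>j. elist (enc_move (vs j) (es j)) (T j))"
    and wf: "\<And>j t. j \<in> A \<Longrightarrow> t \<in> set (T j) \<Longrightarrow> fst t \<subseteq> set (vs j)"
  shows "ptime N A e (\<lambda>j. elist (enc_node (vs j) (es j)) (build (vs j) (es j) (T j)))"
proof -
  \<comment> \<open>A bound on the code of one node: a unary number at most
    \<open>length vs\<close>, a vector over \<open>vs\<close> and one over \<open>es\<close>, which
    with the two \<open>Pair\<close> constructors take at most
    \<open>5 + 6 * length vs + 4 * length es\<close>.\<close>
  define M where "M j = 10 + 6 * length (vs j) + 4 * length (es j)" for j
  let ?b = "\<lambda>j. 1 + ((1 + ((length (vs j) + 1) * length (es j)) * (1 + M j)) +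
      (1 + (length (vs j) + 1) * (1 + M j)))"
  let ?f = "\<lambda>j. build_step (vs j) (es j) (T j)"
  let ?s = "\<lambda>j i. (?f j ^^ i) (build_init (vs j) (es j))"
  have bounds: "length (snd (?s j i)) \<le> i + 1 \<and> length (fst (?s j i)) \<le> (i + 1) * length (es j) \<and>
     (\<forall>t\<in>set (fst (?s j i)). fst t \<le> i \<and> snd t \<subseteq> set (vs j)) \<and> (\<forall>t\<in>set (snd (?s j i)). fst t \<le> i)"
    if "j \<in> A" for j i
    by (rule build_state_bounds[OF sub[OF that]])
  have "ptime N A e (\<lambda>j. enc_state (vs j) (es j) ((?f j ^^ length (vs j)) (build_init (vs j)
      (es j))))"
  proof (rule ptime_iterate[where F = "\<lambda>j. enc_state (vs j) (es j)" and b = ?b,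
        OF ptime_cvec_length[OF V] ptime_build_init], goal_cases)
    case 1
    show ?case unfolding M_def by (intro pbound_intros pbound_lengths)
  next
    case (2 j i)
    let ?s = "(?f j ^^ i) (build_init (vs j) (es j))"
    note b = bounds[OF 2(1), of i]
    have "dsize (elist (enc_item (vs j)) (fst ?s)) \<le> 1 + length (fst ?s) * (1 + M j)"
    proof (rule dsize_elist_le)
      fix t assume "t \<in> set (fst ?s)"
      with b 2(2) have "fst t \<le> length (vs j)" by fastforce
      then show "dsize (enc_item (vs j) t) \<le> M j"
        using dsize_cvec(1)[of "vs j" "snd t"] by (simp add: enc_item_def M_def dsize_enc_nat)
    qed
    also have "\<dots> \<le> 1 + ((length (vs j) + 1) * length (es j)) * (1 + M j)"
    proof -
      have "length (fst ?s) \<le> (i + 1) * length (es j)" using b by blast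
      also have "\<dots> \<le> (length (vs j) + 1) * length (es j)" using 2(2) by (intro mult_right_mono) auto
      finally show ?thesis by (intro add_left_mono mult_right_mono) auto
    qed
    finally have q: "dsize (elist (enc_item (vs j)) (fst ?s)) \<le> 1 + ((length (vs j) + 1) * length
        (es j)) * (1 + M j)" .
    have "dsize (elist (enc_node (vs j) (es j)) (snd ?s)) \<le> 1 + length (snd ?s) * (1 + M j)"
    proof (rule dsize_elist_le)
      fix t assume "t \<in> set (snd ?s)"
      with b 2(2) have "fst t \<le> length (vs j)" by fastforce
      then show "dsize (enc_node (vs j) (es j) t) \<le> M j"
        using dsize_cvec(1)[of "vs j" "fst (snd t)"] dsize_cvec(1)[of "es j" "snd (snd t)"]
        by (simp add: enc_node_def M_def dsize_enc_nat)
    qed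
    also have "\<dots> \<le> 1 + (length (vs j) + 1) * (1 + M j)"
      using b 2(2) by (intro add_left_mono mult_right_mono) auto
    finally have os: "dsize (elist (enc_node (vs j) (es j)) (snd ?s)) \<le> 1 + (length (vs j) + 1) *
        (1 + M j)" .
    show ?case unfolding enc_state_def dsize.simps using q os by linarith
  next
    case (3 e')
    let ?B = "{(j, (?f j ^^ i) (build_init (vs j) (es j))) | j i. j \<in> A \<and> i < length (vs j)}"
    note w = 3(1) and s = 3(2)
    have q: "ptime (\<lambda>z. N (fst z)) ?B e' (\<lambda>z. elist (enc_item (vs (fst z))) (fst (snd z)))"
      using ptime_hd[OF s] by (simp add: enc_state_def)
    have items: "snd t \<subseteq> set (vs (fst z))" if "z \<in> ?B" "t \<in> set (fst (snd z))" for z t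
    proof -
      from that(1) obtain j i where z: "z = (j, (?f j ^^ i) (build_init (vs j) (es j)))" "j \<in> A"
          by blast
      with that(2) bounds[OF z(2), of i] show ?thesis by auto
    qed
    have "ptime (\<lambda>z. N (fst z)) ?B e' (\<lambda>z. if fst (snd z) = [] then enc_state (vs (fst z))
        (es (fst z)) (snd z)
       else enc_state (vs (fst z)) (es (fst z)) (?f (fst z) (snd z)))"
    proof (rule ptime_if[OF ptime_is_Nil[OF q]])
      show "ptime (\<lambda>z. N (fst z)) {z \<in> ?B. fst (snd z) = []} e' (\<lambda>z. enc_state (vs (fst z))
          (es (fst z)) (snd z))"
        by (rule ptime_subset[OF s]) blast
      let ?B' = "{z \<in> ?B. fst (snd z) \<noteq> []}"
      have sub: "ptime (\<lambda>z. N (fst z)) ?B' e' g" if "ptime (\<lambda>z. N (fst z)) ?B e' g" for g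
        using that by (rule ptime_subset) blast
      show "ptime (\<lambda>z. N (fst z)) ?B' e' (\<lambda>z. enc_state (vs (fst z)) (es (fst z))
          (?f (fst z) (snd z)))"
      proof (rule graph_ptime.ptime_build_step[OF lift[OF _ sub[OF w]] sub[OF w[OF T]] _ sub[OF s]])
        fix z assume z: "z \<in> ?B'"
        then show "fst z \<in> A" by auto
        then show "\<And>t. t \<in> set (T (fst z)) \<Longrightarrow> fst t \<subseteq> set (vs (fst z))"
          using wf by blast
        show "\<And>t. t \<in> set (fst (snd z)) \<Longrightarrow> snd t \<subseteq> set (vs (fst z))" using items z by blast
        show "fst (snd z) \<noteq> []" using z by blast
      qed
    qed
    then show ?case by (rule ptime_cong) (simp add: build_step_def)
  qed
  from ptime_tl[OF this] show ?thesis by (simp add: enc_state_def build_def)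
qed

lemma ptime_answer:
  assumes T: "ptime N A e (\<lambda>j. elist (enc_move (vs j) (es j)) (T j))"
    and wf: "\<And>j t. j \<in> A \<Longrightarrow> t \<in> set (T j) \<Longrightarrow> fst t \<subseteq> set (vs j)"
  shows "ptime N A e (\<lambda>j. answer (vs j) (es j) (T j))"
  unfolding answer_def
proof (rule ptime_if)
  show "ptime N A e (\<lambda>j. enc_bool (solvable (vs j) (es j) (T j)))"
    unfolding solvable_def by (rule ptime_components_solved[OF T wf ptime_cvec_full[OF V] V])
  have "ptime N A e (\<lambda>j. Pair Atom (elist (enc_node (vs j) (es j)) (build (vs j) (es j) (T j))))"
    by (rule ptime_Pair[OF ptime_const[OF V] ptime_build[OF T wf]])
  then show "ptime N {j \<in> A. solvable (vs j) (es j) (T j)} e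
     (\<lambda>j. Pair Atom (elist (enc_node (vs j) (es j)) (build (vs j) (es j) (T j))))"
    by (rule ptime_subset) blast
  show "ptime N {j \<in> A. \<not> solvable (vs j) (es j) (T j)} e (\<lambda>j. Atom)"
    by (rule ptime_subset[OF ptime_const[OF V]]) blast
qed

end

section \<open>From logarithmic width to polynomially many subsets\<close>

lemma two_power_le:
  fixes K :: real
  assumes "1 \<le> n" "real m \<le> K * ln (real n)" "0 \<le> K"
  shows "2 ^ m \<le> n ^ nat \<lceil>K\<rceil>"
proof -
  have "(2::real) ^ m = 2 powr real m" by (simp add: powr_realpow)
  also have "\<dots> = exp (real m * ln 2)" by (simp add: powr_def)
  \<comment> \<open>Since ln 2 < 1, the natural logarithm in the promise needs no change of
    base.\<close>
  also have "real m * ln 2 \<le> real m * 1" by (intro mult_left_mono) (use ln_2_less_1 in auto)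
  then have "exp (real m * ln 2) \<le> exp (K * ln (real n))" using assms(2) by simp
  also have "\<dots> = real n powr K" using assms(1) by (simp add: powr_def)
  also have "\<dots> \<le> real n powr real (nat \<lceil>K\<rceil>)"
    by (rule powr_mono) (use assms(1,3) real_nat_ceiling_ge in auto)
  also have "\<dots> = real n ^ nat \<lceil>K\<rceil>" using assms(1) by (simp add: powr_realpow)
  finally have "real (2 ^ m) \<le> real (n ^ nat \<lceil>K\<rceil>)" by simp
  then show ?thesis by (simp only: of_nat_le_iff)
qed

text \<open>The asymptotic bound holds from some size on; the finitely many smaller sizes are
  absorbed by the constant \<open>d\<close>.\<close>

lemma LogBMIP_power_bound:
  assumes "LogBMIP \<C>"
  obtains c d q :: nat where "c \<ge> 1" "\<And>H. H \<in> \<C> \<Longrightarrow> 2 ^ miwidth c H \<le> d + hsize H ^ q"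
proof -
  from assms obtain c f where c: "c \<ge> 1" and f: "f \<in> O(\<lambda>n. ln (real n))"
    and mi: "\<And>H. H \<in> \<C> \<Longrightarrow> real (miwidth c H) \<le> f (hsize H)" unfolding LogBMIP_def by blast
  from landau_o.bigE[OF f] obtain K where K: "K > 0" "\<forall>\<^sub>F n in sequentially. norm (f n) \<le>
      K * norm (ln (real n))"
    by blast
  then obtain n0 where n0: "\<And>n. n \<ge> n0 \<Longrightarrow> norm (f n) \<le> K * norm (ln (real n))"
    unfolding eventually_sequentially by blast
  define n1 where "n1 = max n0 1"
  define D where "D = (\<Sum>n<n1. nat \<lceil>f n\<rceil>)"
  have "2 ^ miwidth c H \<le> 2 ^ D + hsize H ^ nat \<lceil>K\<rceil>" if H: "H \<in> \<C>" for H
  proof (cases "hsize H < n1")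
    case True
    have "miwidth c H \<le> nat \<lceil>f (hsize H)\<rceil>" using mi[OF H] by linarith
    also have "\<dots> \<le> D" unfolding D_def by (rule member_le_sum) (use True in auto)
    finally have "(2::nat) ^ miwidth c H \<le> 2 ^ D" by (rule power_increasing) simp
    then show ?thesis by (rule trans_le_add1)
  next
    case False
    then have h: "hsize H \<ge> n0" "hsize H \<ge> 1" unfolding n1_def by auto
    have "real (miwidth c H) \<le> K * ln (real (hsize H))"
      using mi[OF H] n0[OF h(1)] h(2) by (simp add: abs_le_iff)
    from two_power_le[OF h(2) this] K(1) show ?thesis by simp
  qed
  with c that show thesis by blast
qed

lemma card_Inter_le_miwidth:
  assumes "finite (edges H)" "S \<subseteq> edges H" "card S = c"
  shows "card (\<Inter>S) \<le> miwidth c H"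
proof -
  have "{card (\<Inter>S) | S. S \<subseteq> edges H \<and> card S = c} = (\<lambda>S. card (\<Inter>S)) ` {S. S \<subseteq> edges H \<and> card S = c}"
      by blast
  moreover have "finite {S. S \<subseteq> edges H \<and> card S = c}" using assms(1) by simp
  ultimately have "finite (insert 0 {card (\<Inter>S) | S. S \<subseteq> edges H \<and> card S = c})" by simp
  then show ?thesis unfolding miwidth_def by (rule Max_ge) (use assms in blast)
qed

lemma enc_hypergraph_eq:
  "enc_hypergraph P = Pair (enc_nat (length (fst P))) (elist (cvec (fst P)) (snd P))"
  by (cases P) (simp add: cvec_def[abs_def])

text \<open>The unary number of vertices in the input doubles as the vector of the empty set, which
  makes a vector over \<open>vs\<close> available at once.\<close>

lemma cvec_empty: "cvec us {} = enc_nat (length us)"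
  unfolding cvec_def by (induction us) (simp_all add: enc_bool_def)

text \<open>The promise is stated in terms of \<open>hsize\<close>, the running time in terms of the
  size of the encoded input.\<close>

lemma hsize_le_dsize:
  assumes "distinct (fst P)" "distinct (snd P)"
  shows "hsize (presented P) \<le> dsize (enc_hypergraph P)"
proof -
  obtain vs es where P: "P = (vs, es)" by fastforce
  have "1 + length es * length vs \<le> dsize (elist (cvec vs) es)"
  proof (induction es)
    case (Cons x es)
    then show ?case using dsize_cvec(2)[of vs x] by simp
  qed simp
  moreover have "card (set vs) = length vs" "card (set es) = length es"
    using assms P by (simp_all add: distinct_card)
  ultimately show ?thesis unfolding enc_hypergraph_eq P
    by (simp add: hsize_def dsize_enc_nat)
qed

theorem theorem5p4:
  fixes \<C> :: "'a hypergraph set" and k :: nat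
  assumes "\<forall>H\<in>\<C>. is_hypergraph H"
    and "LogBMIP \<C>"
    and "k \<ge> 1"
  shows "solvable_in_poly_time enc_hypergraph (presentations \<C>) (ghd_answer k)"
proof -
  let ?A = "presentations \<C>" and ?e = "enc_hypergraph :: 'a presentation \<Rightarrow> data"
  let ?N = "\<lambda>P. dsize (?e P)"
  from LogBMIP_power_bound[OF assms(2)] obtain c d q where c: "c \<ge> 1"
    and mi: "\<And>H. H \<in> \<C> \<Longrightarrow> 2 ^ miwidth c H \<le> d + hsize H ^ q" by metis
  have hyp: "hypergraph_lists (fst P) (snd P)" if "P \<in> ?A" for P
  proof -
    from that have "distinct (fst P)" "distinct (snd P)"
      "presented P = \<lparr>verts = set (fst P), edges = set (snd P)\<rparr>" "presented P \<in> \<C>"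
      unfolding presentations_def by auto
    moreover from this assms(1) have "is_hypergraph \<lparr>verts = set (fst P), edges = set (snd P)\<rparr>"
        by metis
    ultimately show ?thesis unfolding is_hypergraph_def by unfold_locales simp_all
  qed
  have env: "ptime ?N ?A ?e ?e" by (rule ptime_env[OF pbound_self])
  have V: "ptime ?N ?A ?e (\<lambda>P. cvec (fst P) {})"
    using ptime_hd[OF env] by (simp add: enc_hypergraph_eq cvec_empty)
  have rows: "ptime ?N ?A ?e (\<lambda>P. elist (cvec (fst P)) (snd P))"
    using ptime_tl[OF env] by (simp add: enc_hypergraph_eq)
  have E: "ptime ?N ?A ?e (\<lambda>P. cvec (snd P) {})"
    using ptime_length[OF rows] by (simp add: cvec_empty)
  interpret gp: graph_ptime ?N ?A ?e fst snd
    by (rule graph_ptime.intro[OF hyp ptime_enc_edges[OF hyp rows] V E])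
  let ?seps = "\<lambda>P. separators (fst P) (snd P) c k"
  let ?T = "\<lambda>P. winning (fst P) (snd P) (?seps P) (length (fst P))"
  have seps: "ptime ?N ?A ?e (\<lambda>P. elist (enc_sep (fst P) (snd P)) (?seps P))"
  proof (rule gp.ptime_separators)
    show "pbound ?N ?A (\<lambda>P. d + ?N P ^ q)" by (intro pbound_intros pbound_self)
    fix P p assume P: "P \<in> ?A" and p: "p \<in> set (inters (fst P) (snd P) c)"
    interpret hypergraph_lists "fst P" "snd P" by (rule hyp[OF P])
    have pres: "presented P = \<lparr>verts = set (fst P), edges = set (snd P)\<rparr>" by (cases P) simp
    from p have in_p: "fst p \<subseteq> set (snd P)" "card (fst p) = c" "snd p = set (fst P) \<inter> \<Inter>(fst p)"
      using inters_sound[of "fst p" "snd p"] by auto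
    \<comment> \<open>Because \<open>c\<close> is at least 1, an actual edge is involved and the
      intersection of the edges lies inside the vertex set.\<close>
    have "fst p \<noteq> {}" using in_p(2) c by auto
    then have "snd p = \<Inter>(fst p)" unfolding in_p(3) using in_p(1) edge_subset by blast
    then have "card (snd p) \<le> miwidth c (presented P)"
      using card_Inter_le_miwidth[of "presented P" "fst p" c] in_p pres by simp
    then have "2 ^ card (snd p) \<le> (2::nat) ^ miwidth c (presented P)" by (rule power_increasing)
        simp
    also have "\<dots> \<le> d + hsize (presented P) ^ q"
      using mi P unfolding presentations_def by auto
    also have "\<dots> \<le> d + ?N P ^ q"
      using hsize_le_dsize[OF distinct_vs distinct_es] by (intro add_left_mono power_mono) auto
    finally show "2 ^ card (snd p) \<le> d + ?N P ^ q" .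
  qed
  have "ptime ?N ?A ?e (\<lambda>P. answer (fst P) (snd P) (?T P))"
  proof (rule gp.ptime_answer[OF gp.ptime_winning[OF seps]])
    show "fst t \<subseteq> set (fst P)" if "P \<in> ?A" "t \<in> set (?T P)" for P t
      using winning_blocks[OF hypergraph_lists.edge_subset[OF hyp[OF that(1)]] that(2)] .
  qed
  then obtain C p where C: "runs C ?N p ?A ?e (\<lambda>P. answer (fst P) (snd P) (?T P))"
    unfolding ptime_def by blast
  have "\<exists>t s. exec C ((\<lambda>_. Atom)(0 := ?e P)) t s \<and> t \<le> poly p (?N P) \<and> ghd_answer k P (s 0)"
    if P: "P \<in> ?A" for P
  proof -
    \<comment> \<open>\<open>runs\<close> allows arbitrary contents of the other variables, in
      particular \<open>Atom\<close>.\<close>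
    from C P obtain t s where "exec C ((\<lambda>_. Atom)(0 := ?e P)) t s" "s 0 = answer (fst P) (snd P)
        (?T P)"
      "t \<le> poly p (?N P)" unfolding runs_def by (metis fun_upd_same)
    with hypergraph_lists.answer_correct[OF hyp[OF P] assms(3) c] show ?thesis
      by (intro exI[of _ t] exI[of _ s]) simp
  qed
  then show ?thesis unfolding solvable_in_poly_time_def by blast
qed

end
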